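(* For $1<p<\infty$, $\bm{h}^p_e(\mathbb{B})=\bm{H}^p_e(\mathbb{B})$.
   Context: $\mathbb{B}$ is the open unit ball of $\mathbb{R}^3$, $\mathbb{S}$ the unit sphere, $\sigma$ surface measure. Lamé constants $\mu>0$, $2\mu+\lambda>0$; $\Delta^*\bm{u}=\mu\Delta\bm{u}+(\lambda+\mu)\nabla\,\mathrm{div}\,\bm{u}$. $\bm{h}^p_e(\mathbb{B})$ ($1\le p<\infty$) is the space of solutions $\bm{u}:\mathbb{B}\to\mathbb{R}^3$ of $\Delta^*\bm{u}=0$ with $\sup_{0\le r<1}(\int_{\mathbb{S}}|\bm{u}(rw)|^pd\sigma(w))^{1/p}<\infty$. For $\xi\in\mathbb{S}$, $\Gamma_\xi=\mathbb{B}\cap\mathrm{conv}(\{\xi\}\cup\{x:|x|\le1/2\})$ and $\mathcal{N}\bm{u}(\xi)=\sup_{x\in\Gamma_\xi}|\bm{u}(x)|$. $\bm{H}^p_e(\mathbb{B})$ is the space of solutions $\bm{u}$ of $\Delta^*\bm{u}=0$ in $\mathbb{B}$ with $\mathcal{N}\bm{u}\in L^p(\mathbb{S})$. *)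

theory Defs
  imports "HOL-Analysis.Analysis"
begin

type_synonym R3 = "real ^ 3"

definition pd :: "(R3 \<Rightarrow> 'b::real_normed_vector) \<Rightarrow> 3 \<Rightarrow> R3 \<Rightarrow> 'b" where
  "pd f i x = vector_derivative (\<lambda>t. f (x + t *\<^sub>R axis i 1)) (at 0)"

definition has_pd :: "(R3 \<Rightarrow> 'b::real_normed_vector) \<Rightarrow> 3 \<Rightarrow> R3 \<Rightarrow> bool" where
  "has_pd f i x \<longleftrightarrow> (\<lambda>t. f (x + t *\<^sub>R axis i 1)) differentiable (at 0)"

definition divg :: "(R3 \<Rightarrow> R3) \<Rightarrow> R3 \<Rightarrow> real" where
  "divg u y = (\<Sum>j\<in>UNIV. pd u j y $ j)"

definition lame_op :: "real \<Rightarrow> real \<Rightarrow> (R3 \<Rightarrow> R3) \<Rightarrow> R3 \<Rightarrow> R3" where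
  "lame_op \<mu> lam u x =
     \<mu> *\<^sub>R (\<Sum>i\<in>UNIV. pd (pd u i) i x) + (lam + \<mu>) *\<^sub>R (\<chi> k. pd (divg u) k x)"

definition lame_solution :: "real \<Rightarrow> real \<Rightarrow> R3 set \<Rightarrow> (R3 \<Rightarrow> R3) \<Rightarrow> bool" where
  "lame_solution \<mu> lam S u \<longleftrightarrow>
     continuous_on S u \<and>
     (\<forall>i. \<forall>x\<in>S. has_pd u i x) \<and> (\<forall>i. continuous_on S (pd u i)) \<and>
     (\<forall>i j. \<forall>x\<in>S. has_pd (pd u i) j x) \<and> (\<forall>i j. continuous_on S (pd (pd u i) j)) \<and>
     (\<forall>x\<in>S. lame_op \<mu> lam u x = 0)"

abbreviation unit_ball :: "R3 set" where "unit_ball \<equiv> ball 0 1"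
abbreviation unit_sphere :: "R3 set" where "unit_sphere \<equiv> sphere 0 1"

text \<open>Integral over the unit sphere w.r.t. surface measure sigma, for nonnegative
  functions, via polar coordinates:
  integral over the sphere of g d sigma = 3 * integral over the ball of g(x/|x|) dx.\<close>
definition sphere_nn_integral :: "(R3 \<Rightarrow> ennreal) \<Rightarrow> ennreal" where
  "sphere_nn_integral g = 3 * (\<integral>\<^sup>+ x. indicator unit_ball x * g (x /\<^sub>R norm x) \<partial>lborel)"

definition ennpow :: "ennreal \<Rightarrow> real \<Rightarrow> ennreal" where
  "ennpow a p = (if a = \<infinity> then \<infinity> else ennreal (enn2real a powr p))"

definition Gamma :: "R3 \<Rightarrow> R3 set" where
  "Gamma \<xi> = unit_ball \<inter> convex hull (insert \<xi> (cball 0 (1/2)))"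

definition ntmax :: "(R3 \<Rightarrow> R3) \<Rightarrow> R3 \<Rightarrow> ennreal" where
  "ntmax u \<xi> = (SUP x\<in>Gamma \<xi>. ennreal (norm (u x)))"

definition hp_e :: "real \<Rightarrow> real \<Rightarrow> real \<Rightarrow> (R3 \<Rightarrow> R3) set" where
  "hp_e \<mu> lam p = {u. lame_solution \<mu> lam unit_ball u \<and>
     (SUP r\<in>{0..<1}. sphere_nn_integral (\<lambda>w. ennreal (norm (u (r *\<^sub>R w)) powr p))) < \<infinity>}"

definition Hp_e :: "real \<Rightarrow> real \<Rightarrow> real \<Rightarrow> (R3 \<Rightarrow> R3) set" where
  "Hp_e \<mu> lam p = {u. lame_solution \<mu> lam unit_ball u \<and>
     sphere_nn_integral (\<lambda>\<xi>. ennpow (ntmax u \<xi>) p) < \<infinity>}"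

end

theory Submission
  imports Defs
begin

text \<open>
  The inclusion of \<open>H\<^sup>p\<close> in \<open>h\<^sup>p\<close> is clear, since \<open>r w\<close> lies in \<open>\<Gamma>\<^sub>w\<close>. For the converse, let first \<open>u\<close> be a
  solution that is smooth near the closed ball and put \<open>c = (\<lambda> + \<mu>) / \<mu>\<close>. The divergence of \<open>u\<close> is
  harmonic, and so is the potential \<open>\<psi>\<close> with \<open>2 \<psi> + 4 x \<cdot> \<nabla>\<psi> = c div u\<close>. Then
  \<open>v = u - (1 - |x|\<^sup>2) \<nabla>\<psi>\<close> is harmonic with the boundary values of \<open>u\<close>, and on each ray \<open>\<nabla>\<psi>\<close> solves
  a linear first-order equation with right-hand side \<open>c \<nabla> div v\<close>. The Poisson formula bounds \<open>v\<close> and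
  its second derivatives, the latter with a factor \<open>(1 - |x|)\<^sup>-\<^sup>2\<close>, by the maximal function of the
  boundary values; integration along the ray turns this factor into \<open>(1 - |x|)\<^sup>-\<^sup>1\<close>, which
  \<open>1 - |x|\<^sup>2\<close> absorbs. So the nontangential maximal function of \<open>u\<close> is dominated by the
  Hardy-Littlewood maximal function of \<open>u\<close> on the sphere, which is bounded in \<open>L\<^sup>p\<close> for \<open>p > 1\<close>.
  A general solution is dilated and then smoothed by averaging over short coordinate segments, an
  operation that preserves the equation, and Fatou's lemma passes to the limit.
\<close>

section \<open>Surface measure\<close>

text \<open>The equation for \<open>\<psi>\<close> is forced by a cancellation. For harmonic
  \<open>\<psi>\<close> the Laplacian of \<open>(1 - |x|^2) * pd \<psi> k\<close> is
  \<open>- 6 * pd \<psi> k - 4 * euler (pd \<psi> k)\<close>, minus the k-th derivative of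
  \<open>2 * \<psi> + 4 * euler \<psi>\<close>, while the system says that the Laplacian of
  \<open>u k\<close> is \<open>- c * pd D k\<close> with \<open>D = div u\<close>. The quantity
  \<open>D\<close> is not controlled by boundary values of \<open>u\<close> directly, so it must be
  eliminated: \<open>div v = D + 2 * euler \<psi>\<close>, and together with the equation for
  \<open>\<psi>\<close> this leaves \<open>(4 + 2 * c) * euler (pd \<psi> k) + (6 + 2 * c) * pd
  \<psi> k = c * pd (div v) k\<close>, in which only \<open>v\<close> occurs. Ellipticity,
  \<open>2 * \<mu> + lam > 0\<close>, is exactly \<open>c > -1\<close>: it makes \<open>D\<close>
  harmonic and \<open>4 + 2 * c\<close> positive. A solution is only assumed C^2 inside the ball,
  whereas the splitting uses boundary values and third derivatives; hence the dilation and a gain of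
  two derivatives by smoothing. All constants depend on \<open>\<mu>\<close>, \<open>lam\<close>,
  \<open>p\<close> alone, so that the limit is possible. \<open>ntmax\<close> is handled through a
  measurable majorant, and monotonicity of \<open>nn_integral\<close> holds for arbitrary
  integrands.\<close>

lemma distr_lborel_orthogonal_transformation:
  fixes Q :: "R3 \<Rightarrow> R3"
  assumes Q: "orthogonal_transformation Q"
  shows "distr lborel borel Q = lborel"
proof (rule lborel_eqI[symmetric])
  have Qm: "Q \<in> borel_measurable borel"
    using Q by (simp add: borel_measurable_continuous_onI linear_continuous_on orthogonal_transformation_linear linear_linear)
  obtain Qi where Qi: "orthogonal_transformation Qi" "\<And>x. Q (Qi x) = x" "\<And>x. Qi (Q x) = x"
    using orthogonal_transformation_inv[OF Q] orthogonal_transformation_bij[OF Q]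
    by (metis bij_inv_eq_iff)
  fix l u :: R3 assume lu: "\<And>b. b \<in> Basis \<Longrightarrow> l \<bullet> b \<le> u \<bullet> b"
  have eq: "Q -` box l u = Qi ` box l u"
    by (auto simp: image_iff Qi) (metis Qi(3))
  have "emeasure (distr lborel borel Q) (box l u) = emeasure lborel (Qi ` box l u)"
    using Qm by (subst emeasure_distr) (auto simp: eq)
  also have "\<dots> = emeasure lebesgue (Qi ` box l u)"
    using measurable_sets[OF Qm, of "box l u"] by (simp add: eq)
  also have "\<dots> = ennreal (measure lebesgue (Qi ` box l u))"
    using measurable_orthogonal_image[OF Qi(1), of "box l u"] 
    by (intro emeasure_eq_ennreal_measure fmeasurableD2) simp
  also have "\<dots> = ennreal (measure lebesgue (box l u))"
    by (simp add: measure_orthogonal_image[OF Qi(1)])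
  also have "\<dots> = ennreal (\<Prod>b\<in>Basis. (u - l) \<bullet> b)"
    using lu by (simp add: measure_lborel_box_eq)
  finally show "emeasure (distr lborel borel Q) (box l u) = (\<Prod>b\<in>Basis. (u - l) \<bullet> b)" .
qed simp

text \<open>The polar-coordinate formula behind \<open>sphere_nn_integral\<close>, recast as a
  genuine measure so that Fubini, Fatou and dominated convergence apply. It lives on all of
  \<open>R3\<close>, with null complement of the sphere, and is not normalised.\<close>

definition sphere_measure :: "R3 measure" where
  "sphere_measure =
     distr (density lborel (\<lambda>x. 3 * indicator unit_ball x)) borel (\<lambda>x. x /\<^sub>R norm x)"

lemma space_sphere_measure [simp]: "space sphere_measure = UNIV"
  and sets_sphere_measure [simp, measurable_cong]: "sets sphere_measure = sets borel"
  by (simp_all add: sphere_measure_def)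

lemma measurable_normalize [measurable]: "(\<lambda>x::R3. x /\<^sub>R norm x) \<in> borel_measurable borel"
  by measurable

lemma measurable_radial [measurable]:
  assumes "g \<in> borel_measurable borel"
  shows "(\<lambda>x::R3. indicator unit_ball x * g (x /\<^sub>R norm x) :: ennreal) \<in> borel_measurable borel"
  by (intro borel_measurable_times_ennreal borel_measurable_indicator borel_open open_ball
      measurable_compose[OF measurable_normalize assms])

lemma nn_integral_sphere_measure:
  assumes [measurable]: "g \<in> borel_measurable borel"
  shows "(\<integral>\<^sup>+ w. g w \<partial>sphere_measure) = sphere_nn_integral g"
proof -
  have "(\<integral>\<^sup>+ w. g w \<partial>sphere_measure) =
      (\<integral>\<^sup>+ x. 3 * indicator unit_ball x * g (x /\<^sub>R norm x) \<partial>lborel)"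
    unfolding sphere_measure_def
    using assms measurable_compose[OF measurable_normalize assms]
    by (subst nn_integral_distr) (auto intro!: nn_integral_density borel_measurable_times_ennreal borel_measurable_indicator)
  also have "\<dots> = 3 * (\<integral>\<^sup>+ x. indicator unit_ball x * g (x /\<^sub>R norm x) \<partial>lborel)"
    unfolding mult.assoc by (rule nn_integral_cmult) (use assms measurable_radial in auto)
  finally show ?thesis
    by (simp add: sphere_nn_integral_def)
qed

lemma emeasure_sphere_measure:
  assumes [measurable]: "A \<in> sets borel"
  shows "emeasure sphere_measure A = 3 * emeasure lborel (unit_ball \<inter> (\<lambda>x. x /\<^sub>R norm x) -` A)"
proof -
  have m: "(\<lambda>x::R3. x /\<^sub>R norm x) -` A \<in> sets borel"
    using measurable_sets[OF measurable_normalize assms] by simp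
  have "emeasure sphere_measure A = (\<integral>\<^sup>+ w. indicator A w \<partial>sphere_measure)"
    by simp
  also have "\<dots> = 3 * (\<integral>\<^sup>+ x. indicator (unit_ball \<inter> (\<lambda>x. x /\<^sub>R norm x) -` A) x \<partial>lborel)"
    by (subst nn_integral_sphere_measure)
       (auto simp: sphere_nn_integral_def indicator_def intro!: arg_cong[where f="\<lambda>x. 3 * x"] nn_integral_cong)
  finally show ?thesis using m by simp
qed

lemma finite_sphere_measure: "finite_measure sphere_measure"
proof
  have "emeasure sphere_measure UNIV = 3 * emeasure lborel unit_ball"
    by (subst emeasure_sphere_measure) auto
  also have "\<dots> < \<infinity>"
    using emeasure_lborel_ball_finite[of "0::R3" 1] by (simp add: ennreal_mult_less_top)
  finally show "emeasure sphere_measure (space sphere_measure) \<noteq> \<infinity>" by simp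
qed

interpretation sphere: finite_measure sphere_measure
  by (rule finite_sphere_measure)

text \<open>Only the origin is not normalised to a unit vector (\<open>inverse 0 = 0\<close> sends
  it to 0), and a point is a null set. Pointwise estimates on integrands therefore have to be proved
  for unit vectors only.\<close>

lemma AE_sphere_measure: "AE w in sphere_measure. norm w = 1"
proof (rule AE_I)
  have "emeasure sphere_measure {w. norm w \<noteq> 1} \<le> 3 * emeasure lborel {0::R3}"
    by (subst emeasure_sphere_measure)
       (auto simp del: emeasure_lborel_countable emeasure_lborel_singleton right_inverse left_inverse
         simp: divide_inverse[symmetric] mult.commute intro!: mult_left_mono emeasure_mono)
  then show "emeasure sphere_measure {w. norm w \<noteq> 1} = 0"
    by simp
qed auto

lemma measure_sphere_measure_pos: "0 < measure sphere_measure UNIV"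
proof -
  have "emeasure sphere_measure UNIV = 3 * emeasure lborel unit_ball"
    by (subst emeasure_sphere_measure) auto
  also have "\<dots> \<noteq> 0"
    by (simp add: emeasure_ball order_less_imp_not_eq2[OF unit_ball_vol_pos])
  finally show ?thesis
    by (metis measure_nonneg less_le sphere.emeasure_eq_measure ennreal_0)
qed

lemma nn_integral_sphere_orthogonal_transformation:
  assumes Q: "orthogonal_transformation Q" and [measurable]: "g \<in> borel_measurable borel"
  shows "(\<integral>\<^sup>+ w. g (Q w) \<partial>sphere_measure) = (\<integral>\<^sup>+ w. g w \<partial>sphere_measure)"
proof -
  have lin: "linear Q" using Q by (simp add: orthogonal_transformation_linear)
  have [measurable]: "Q \<in> borel_measurable borel"
    using lin by (simp add: borel_measurable_continuous_onI linear_continuous_on linear_linear)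
  have "(\<integral>\<^sup>+ w. g w \<partial>sphere_measure) =
      3 * (\<integral>\<^sup>+ x. indicator unit_ball x * g (x /\<^sub>R norm x) \<partial>distr lborel borel Q)"
    by (simp add: nn_integral_sphere_measure sphere_nn_integral_def
        distr_lborel_orthogonal_transformation[OF Q])
  also have "\<dots> = 3 * (\<integral>\<^sup>+ x. indicator unit_ball (Q x) * g (Q x /\<^sub>R norm (Q x)) \<partial>lborel)"
    by (subst nn_integral_distr) (use assms measurable_radial in auto)
  also have "\<dots> = 3 * (\<integral>\<^sup>+ x. indicator unit_ball x * g (Q (x /\<^sub>R norm x)) \<partial>lborel)"
    using Q by (simp add: orthogonal_transformation_norm indicator_def linear_scale[OF lin])
  also have "\<dots> = (\<integral>\<^sup>+ w. g (Q w) \<partial>sphere_measure)"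
    by (subst nn_integral_sphere_measure) (auto simp: sphere_nn_integral_def)
  finally show ?thesis by simp
qed

lemma distr_sphere_measure:
  assumes Q: "orthogonal_transformation Q"
  shows "distr sphere_measure borel Q = sphere_measure"
proof (rule measure_eqI)
  have [measurable]: "Q \<in> borel_measurable borel"
    using Q by (simp add: borel_measurable_continuous_onI linear_continuous_on linear_linear orthogonal_transformation_linear)
  fix A assume "A \<in> sets (distr sphere_measure borel Q)"
  then have A[measurable]: "A \<in> sets borel" by simp
  have "emeasure (distr sphere_measure borel Q) A = (\<integral>\<^sup>+ w. indicator A w \<partial>distr sphere_measure borel Q)"
    by simp
  also have "\<dots> = (\<integral>\<^sup>+ w. indicator A (Q w) \<partial>sphere_measure)"
    by (subst nn_integral_distr) auto
  also have "\<dots> = (\<integral>\<^sup>+ w. indicator A w \<partial>sphere_measure)"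
    by (rule nn_integral_sphere_orthogonal_transformation[OF Q]) measurable
  finally show "emeasure (distr sphere_measure borel Q) A = emeasure sphere_measure A" 
    by simp
qed simp

text \<open>After a rotation the cap is centred at the first axis. The cone over it inside the unit
  ball has its other two coordinates bounded by \<open>s\<close>, so it fits into a box of volume
  \<open>2 * (2 * s)^2\<close>; the factor 3 of \<open>sphere_measure\<close> gives 24.\<close>

lemma emeasure_sphere_cap_le:
  assumes \<xi>: "norm \<xi> = 1" and s: "0 < s"
  shows "emeasure sphere_measure (ball \<xi> s) \<le> ennreal (24 * s\<^sup>2)"
proof -
  have "norm \<xi> = norm (axis 1 1 :: R3)" using \<xi> by simp
  then obtain Q where Q: "orthogonal_transformation Q" "Q \<xi> = (axis 1 1 :: R3)"
    by (rule orthogonal_transformation_exists) auto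
  have "emeasure sphere_measure (ball \<xi> s) = (\<integral>\<^sup>+ w. indicator (ball (axis 1 1) s) (Q w) \<partial>sphere_measure)"
  proof (subst nn_integral_indicator[symmetric], simp, rule nn_integral_cong)
    fix x show "indicator (ball \<xi> s) x = (indicator (ball (axis 1 1) s) (Q x) :: ennreal)"
      using Q unfolding orthogonal_transformation_isometry by (metis indicator_simps mem_ball)
  qed
  also have "\<dots> = emeasure sphere_measure (ball (axis 1 1) s)"
    by (subst nn_integral_sphere_orthogonal_transformation[OF Q(1)]) (auto intro: borel_measurable_indicator)
  also have "\<dots> = 3 * emeasure lborel (unit_ball \<inter> (\<lambda>x. x /\<^sub>R norm x) -` (ball (axis 1 1) s))"
    by (rule emeasure_sphere_measure) auto
  also have "\<dots> \<le> 3 * emeasure lborel (cbox (\<chi> i. if i = 1 then - 1 else - s) (\<chi> i. if i = 1 then 1 else s :: R3))"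
  proof (intro mult_left_mono emeasure_mono subsetI)
    fix y :: R3 assume "y \<in> unit_ball \<inter> (\<lambda>x. x /\<^sub>R norm x) -` (ball (axis 1 1) s)"
    then have y: "norm y < 1" "norm (axis 1 1 - y /\<^sub>R norm y) < s"
      by (auto simp: dist_norm)
    have "\<bar>y $ i\<bar> \<le> s" if "i \<noteq> 1" for i
    proof (cases "y = 0")
      case False
      have "\<bar>y $ i / norm y\<bar> = \<bar>(axis 1 1 - y /\<^sub>R norm y) $ i\<bar>"
        using that by (simp add: axis_def divide_inverse mult.commute)
      also have "\<dots> < s" using y(2) component_le_norm_cart[of "axis 1 1 - y /\<^sub>R norm y" i] by linarith
      finally have "\<bar>y $ i\<bar> / norm y < s" by simp
      then have "\<bar>y $ i\<bar> < s * norm y" using False by (simp add: pos_divide_less_eq)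
      also have "\<dots> \<le> s * 1" using y s by (intro mult_left_mono) auto
      finally show ?thesis by simp
    qed (use s in auto)
    moreover have "\<bar>y $ 1\<bar> \<le> 1" using y(1) component_le_norm_cart[of y 1] by linarith
    ultimately show "y \<in> cbox (\<chi> i. if i = 1 then - 1 else - s) (\<chi> i. if i = 1 then 1 else s)"
      by (simp add: mem_box_cart abs_le_iff minus_le_iff)
  qed auto
  also have "\<dots> = 3 * ennreal (8 * s\<^sup>2)"
  proof -
    have "cbox (\<chi> i. if i = 1 then - 1 else - s) (\<chi> i. if i = 1 then 1 else s :: R3) \<noteq> {}"
      using s by (simp add: interval_ne_empty_cart)
    then have "measure lborel (cbox (\<chi> i. if i = 1 then - 1 else - s) (\<chi> i. if i = 1 then 1 else s :: R3)) = 8 * s\<^sup>2"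
      by (simp add: content_cbox_cart prod.remove[of UNIV "1::3"] card_Diff_singleton power2_eq_square)
    then show ?thesis
      by (subst emeasure_eq_ennreal_measure)
        (use emeasure_lborel_cbox_finite in \<open>auto simp: less_top[symmetric]\<close>)
  qed
  also have "\<dots> = ennreal (24 * s\<^sup>2)"
    by (simp add: ennreal_mult'[symmetric] ennreal_numeral[symmetric] del: ennreal_numeral)
  finally show ?thesis .
qed

section \<open>The maximal function on the sphere\<close>

text \<open>Hardy-Littlewood maximal function over dyadic caps. Since a cap of radius
  \<open>r\<close> has area of order at most \<open>r^2\<close>, the factor \<open>4 ^ n\<close>
  replaces division by the area. Countably many radii keep it measurable; the first radius 4 makes
  cap 0 contain the whole sphere and fits the inequality
  \<open>dist \<xi> w \<le> 4 * norm (x - w)\<close> used in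
  \<open>kernel_le_dyadic_caps\<close>.\<close>

definition sphere_maximal :: "(R3 \<Rightarrow> ennreal) \<Rightarrow> R3 \<Rightarrow> ennreal" where
  "sphere_maximal f \<xi> =
     (SUP n::nat. 4 ^ n * (\<integral>\<^sup>+ w. f w * indicator (ball \<xi> (4 / 2 ^ n)) w \<partial>sphere_measure))"

lemma measurable_sphere_maximal [measurable]:
  assumes [measurable]: "f \<in> borel_measurable borel"
  shows "sphere_maximal f \<in> borel_measurable borel"
proof -
  have "{p::R3 \<times> R3. dist (fst p) (snd p) < r} \<in> sets (borel \<Otimes>\<^sub>M borel)" for r :: real
  proof -
    have "open {p::R3 \<times> R3. dist (fst p) (snd p) < r}"
      by (intro open_Collect_less continuous_intros)
    then show ?thesis unfolding borel_prod by (rule borel_open)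
  qed
  note [measurable] = this
  have "(\<lambda>p. indicator (ball (fst p) r) (snd p) :: ennreal) \<in> borel_measurable (borel \<Otimes>\<^sub>M sphere_measure)" for r
  proof -
    have "(\<lambda>p. indicator (ball (fst p) r) (snd p) :: ennreal) = indicator {p::R3 \<times> R3. dist (fst p) (snd p) < r}"
      by (auto simp: indicator_def fun_eq_iff)
    then show ?thesis
      by (simp add: borel_measurable_indicator sets_pair_measure_cong[OF refl sets_sphere_measure])
  qed
  then have "(\<lambda>\<xi>. \<integral>\<^sup>+ w. f w * indicator (ball \<xi> r) w \<partial>sphere_measure) \<in> borel_measurable borel" for r
    by (intro sphere.borel_measurable_nn_integral) (auto simp: split_beta')
  then show ?thesis
    unfolding sphere_maximal_def[abs_def] by measurable
qed

lemma four_power: "(2 ^ n)\<^sup>2 = (4::real) ^ n"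
  by (simp add: power2_eq_square power_mult_distrib[symmetric])

text \<open>The endpoint estimate for bounded functions: \<open>384 = 24 * 4^2\<close> is the cap
  bound at radius \<open>4 / 2 ^ n\<close> times \<open>4 ^ n\<close>.\<close>

lemma sphere_maximal_le_const:
  assumes "norm \<xi> = 1" "\<And>w. f w \<le> ennreal b" "0 \<le> b"
  shows "sphere_maximal f \<xi> \<le> ennreal (384 * b)"
  unfolding sphere_maximal_def
proof (rule SUP_least)
  fix n :: nat
  have "(\<integral>\<^sup>+ w. f w * indicator (ball \<xi> (4 / 2 ^ n)) w \<partial>sphere_measure)
      \<le> (\<integral>\<^sup>+ w. ennreal b * indicator (ball \<xi> (4 / 2 ^ n)) w \<partial>sphere_measure)"
    by (intro nn_integral_mono mult_right_mono assms) auto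
  also have "\<dots> = ennreal b * emeasure sphere_measure (ball \<xi> (4 / 2 ^ n))"
    by (subst nn_integral_cmult_indicator) auto
  also have "\<dots> \<le> ennreal b * ennreal (24 * (4 / 2 ^ n)\<^sup>2)"
    by (intro mult_left_mono emeasure_sphere_cap_le assms) auto
  finally have "4 ^ n * (\<integral>\<^sup>+ w. f w * indicator (ball \<xi> (4 / 2 ^ n)) w \<partial>sphere_measure)
      \<le> ennreal (4 ^ n) * (ennreal b * ennreal (24 * (4 / 2 ^ n)\<^sup>2))"
    by (intro mult_mono) (auto simp: ennreal_power[symmetric])
  also have "\<dots> = ennreal (4 ^ n * (b * (24 * (4 / 2 ^ n)\<^sup>2)))"
    using assms by (simp add: ennreal_mult)
  also have "4 ^ n * (b * (24 * (4 / 2 ^ n)\<^sup>2)) = 384 * b"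
    by (simp add: power_divide four_power)
  finally show "4 ^ n * (\<integral>\<^sup>+ w. f w * indicator (ball \<xi> (4 / 2 ^ n)) w \<partial>sphere_measure) \<le> ennreal (384 * b)" .
qed

lemma sphere_maximal_add_le:
  assumes [measurable]: "f \<in> borel_measurable borel" "g \<in> borel_measurable borel"
    and le: "\<And>w. h w \<le> f w + g w"
  shows "sphere_maximal h \<xi> \<le> sphere_maximal f \<xi> + sphere_maximal g \<xi>"
  unfolding sphere_maximal_def[of h]
proof (rule SUP_least)
  fix n :: nat
  let ?I = "\<lambda>f. (\<integral>\<^sup>+ w. f w * indicator (ball \<xi> (4 / 2 ^ n)) w \<partial>sphere_measure)"
  have "?I h \<le> (\<integral>\<^sup>+ w. f w * indicator (ball \<xi> (4 / 2 ^ n)) w + g w * indicator (ball \<xi> (4 / 2 ^ n)) w \<partial>sphere_measure)"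
    unfolding distrib_right[symmetric] by (intro nn_integral_mono mult_right_mono le) auto
  also have "\<dots> = ?I f + ?I g"
    by (intro nn_integral_add borel_measurable_times_ennreal borel_measurable_indicator) auto
  finally have "4 ^ n * ?I h \<le> 4 ^ n * ?I f + 4 ^ n * ?I g"
    unfolding distrib_left[symmetric] by (intro mult_left_mono) auto
  also have "\<dots> \<le> sphere_maximal f \<xi> + sphere_maximal g \<xi>"
    unfolding sphere_maximal_def by (intro add_mono SUP_upper) auto
  finally show "4 ^ n * ?I h \<le> sphere_maximal f \<xi> + sphere_maximal g \<xi>" .
qed

text \<open>Vitali covering: each point of the set is the centre of a cap on which the integral of
  \<open>f\<close> exceeds \<open>l / 4 ^ n\<close>; disjoint caps are selected whose fivefold
  enlargements still cover. The constant is \<open>24 * 5^2 * 4^2 = 9600\<close>.\<close>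

lemma sphere_maximal_weak_type:
  assumes [measurable]: "f \<in> borel_measurable borel" and l: "0 < l"
  shows "emeasure sphere_measure {\<xi>. norm \<xi> = 1 \<and> ennreal l < sphere_maximal f \<xi>}
    \<le> ennreal (9600 / l) * (\<integral>\<^sup>+ w. f w \<partial>sphere_measure)"
proof -
  define K where "K = {\<xi>. norm \<xi> = 1 \<and> ennreal l < sphere_maximal f \<xi>}"
  have "\<exists>n. ennreal l < 4 ^ n * (\<integral>\<^sup>+ w. f w * indicator (ball \<xi> (4 / 2 ^ n)) w \<partial>sphere_measure)"
    if "\<xi> \<in> K" for \<xi>
    using that unfolding K_def sphere_maximal_def by (auto simp: less_SUP_iff)
  then obtain n where n: "\<And>\<xi>. \<xi> \<in> K \<Longrightarrow>
      ennreal l < 4 ^ n \<xi> * (\<integral>\<^sup>+ w. f w * indicator (ball \<xi> (4 / 2 ^ n \<xi>)) w \<partial>sphere_measure)"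
    by metis
  define r :: "R3 \<Rightarrow> real" where "r \<xi> = 4 / 2 ^ n \<xi>" for \<xi>
  have r: "0 < r \<xi>" "r \<xi> \<le> 4" for \<xi> by (auto simp: r_def divide_le_eq)
  obtain C where C: "countable C" "C \<subseteq> K"
      "pairwise (\<lambda>i j. disjnt (ball i (r i)) (ball j (r j))) C"
      "K \<subseteq> (\<Union>i\<in>C. ball i (5 * r i))"
  proof (rule Vitali_covering_lemma_balls[where S=K and K=K and a="\<lambda>i. i" and r=r and B=4])
    show "K \<subseteq> (\<Union>i\<in>K. ball i (r i))" using r by force
  qed (use r in auto)
  have cap: "emeasure sphere_measure (ball i (5 * r i)) \<le>
      ennreal (9600 / l) * (\<integral>\<^sup>+ w. f w * indicator (ball i (r i)) w \<partial>sphere_measure)" (is "?L \<le> _ * ?I")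
    if i: "i \<in> C" for i
  proof -
    have "?L \<le> ennreal (24 * (5 * r i)\<^sup>2)"
      using i C r by (intro emeasure_sphere_cap_le) (auto simp: K_def)
    also have "24 * (5 * r i)\<^sup>2 = (9600 / l) * (l / 4 ^ n i)"
      using l by (simp add: r_def power_divide power_mult_distrib four_power)
    also have "ennreal \<dots> = ennreal (9600 / l) * ennreal (l / 4 ^ n i)"
      using l by (intro ennreal_mult) auto
    also have "ennreal (l / 4 ^ n i) \<le> ?I"
    proof -
      have "ennreal (l / 4 ^ n i) = ennreal (1 / 4 ^ n i) * ennreal l"
        using l by (subst ennreal_mult[symmetric]) auto
      also have "\<dots> \<le> ennreal (1 / 4 ^ n i) * (4 ^ n i * ?I)"
        using n[of i] i C by (intro mult_left_mono) (auto simp: r_def)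
      also have "\<dots> = ennreal (1 / 4 ^ n i) * ennreal (4 ^ n i) * ?I"
        by (simp add: ennreal_power[symmetric] mult.assoc)
      also have "\<dots> = ?I" 
        by (subst ennreal_mult[symmetric]) auto
      finally show ?thesis .
    qed
    then have "ennreal (9600 / l) * ennreal (l / 4 ^ n i) \<le> ennreal (9600 / l) * ?I"
      by (intro mult_left_mono) auto
    finally show ?thesis .
  qed
  have dj: "disjoint_family_on (\<lambda>i. ball i (r i)) C"
    using C(3) by (auto simp: disjoint_family_on_def pairwise_def disjnt_def)
  have "emeasure sphere_measure K \<le> emeasure sphere_measure (\<Union>i\<in>C. ball i (5 * r i))"
    using C by (intro emeasure_mono) auto
  also have "\<dots> \<le> (\<integral>\<^sup>+ i. emeasure sphere_measure (ball i (5 * r i)) \<partial>count_space C)"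
  proof -
    have "emeasure sphere_measure (\<Union>i\<in>C. ball i (5 * r i))
        = (\<integral>\<^sup>+ w. indicator (\<Union>i\<in>C. ball i (5 * r i)) w \<partial>sphere_measure)"
      by (subst nn_integral_indicator) (auto intro!: borel_open)
    also have "\<dots> \<le> (\<integral>\<^sup>+ w. \<integral>\<^sup>+ i. indicator (ball i (5 * r i)) w \<partial>count_space C \<partial>sphere_measure)"
    proof (rule nn_integral_mono)
      fix w show "indicator (\<Union>i\<in>C. ball i (5 * r i)) w \<le> (\<integral>\<^sup>+ i. indicator (ball i (5 * r i)) w \<partial>count_space C :: ennreal)"
      proof (cases "w \<in> (\<Union>i\<in>C. ball i (5 * r i))")
        case True
        then obtain i where "i \<in> C" "w \<in> ball i (5 * r i)" by blast
        then show ?thesis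
          using nn_integral_ge_point[of i C "\<lambda>i. indicator (ball i (5 * r i)) w"] True by simp
      qed simp
    qed
    also have "\<dots> = (\<integral>\<^sup>+ i. \<integral>\<^sup>+ w. indicator (ball i (5 * r i)) w \<partial>sphere_measure \<partial>count_space C)"
      by (rule nn_integral_count_space_nn_integral) (use C in \<open>auto intro: borel_measurable_indicator\<close>)
    finally show ?thesis by simp
  qed
  also have "\<dots> \<le> (\<integral>\<^sup>+ i. ennreal (9600 / l) * (\<integral>\<^sup>+ w. f w * indicator (ball i (r i)) w \<partial>sphere_measure) \<partial>count_space C)"
    by (intro nn_integral_mono cap) auto
  also have "\<dots> = ennreal (9600 / l) * (\<integral>\<^sup>+ i. (\<integral>\<^sup>+ w. f w * indicator (ball i (r i)) w \<partial>sphere_measure) \<partial>count_space C)"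
    by (intro nn_integral_cmult) auto
  also have "(\<integral>\<^sup>+ i. (\<integral>\<^sup>+ w. f w * indicator (ball i (r i)) w \<partial>sphere_measure) \<partial>count_space C)
     = (\<integral>\<^sup>+ w. f w * indicator (\<Union>i\<in>C. ball i (r i)) w \<partial>sphere_measure)"
  proof -
    \<comment> \<open>Read as the measure with density \<open>f\<close>, the integrals over the
      disjoint selected balls add up by countable additivity.\<close>
    have "(\<integral>\<^sup>+ w. f w * indicator A w \<partial>sphere_measure) = emeasure (density sphere_measure f) A"
      if "A \<in> sets borel" for A
      using that by (subst emeasure_density) auto
    then show ?thesis
      using C dj by (simp add: emeasure_UN_countable sets.countable_UN'')
  qed
  also have "ennreal (9600 / l) * (\<integral>\<^sup>+ w. f w * indicator (\<Union>i\<in>C. ball i (r i)) w \<partial>sphere_measure)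
      \<le> ennreal (9600 / l) * (\<integral>\<^sup>+ w. f w \<partial>sphere_measure)"
    by (intro mult_left_mono nn_integral_mono) (auto simp: indicator_def)
  finally show ?thesis by (simp add: K_def)
qed

lemma nn_integral_powr_Ioo:
  fixes a t :: real
  assumes "a > -1" "t \<ge> 0"
  shows "(\<integral>\<^sup>+ l. ennreal (l powr a) * indicator {0<..<t} l \<partial>lborel) = ennreal (t powr (a + 1) / (a + 1))"
proof -
  have "((\<lambda>x. x powr a) has_integral (t powr (a + 1) / (a + 1))) {0<..<t}"
    using has_integral_powr_from_0[OF assms] by (simp add: has_integral_Icc_iff_Ioo)
  then have "(\<integral>\<^sup>+ l. ennreal (indicator {0<..<t} l * l powr a) \<partial>lborel) = ennreal (t powr (a + 1) / (a + 1))"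
    by (intro nn_integral_has_integral_lebesgue) auto
  then show ?thesis by (simp add: ennreal_mult ennreal_indicator mult.commute)
qed

text \<open>The part of \<open>f\<close> below \<open>l / 768\<close> has maximal function at most
  \<open>384 * (l / 768) = l / 2\<close>. So the part above that level must have maximal function
  larger than \<open>l / 2\<close>, and the weak type bound at \<open>l / 2\<close> applies to it,
  which doubles 9600.\<close>

lemma sphere_maximal_truncate:
  assumes [measurable]: "f \<in> borel_measurable borel" and f: "\<And>w. 0 \<le> f w" and l: "0 < l"
  shows "emeasure sphere_measure {\<xi>. norm \<xi> = 1 \<and> ennreal l < sphere_maximal (\<lambda>w. ennreal (f w)) \<xi>}
    \<le> ennreal (19200 / l) * (\<integral>\<^sup>+ w. ennreal (f w) * indicator {0<..<768 * f w} l \<partial>sphere_measure)"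
proof -
  define g where "g w = ennreal (f w) * indicator {0<..<768 * f w} l" for w
  have g: "g = (\<lambda>w. if l < 768 * f w then ennreal (f w) else 0)"
    using l by (auto simp: g_def indicator_def fun_eq_iff)
  have [measurable]: "g \<in> borel_measurable borel"
    unfolding g by measurable
  have "ennreal (l / 2) < sphere_maximal g \<xi>"
    if \<xi>: "norm \<xi> = 1" "ennreal l < sphere_maximal (\<lambda>w. ennreal (f w)) \<xi>" for \<xi>
  proof (rule ccontr)
    assume "\<not> ?thesis"
    then have 1: "sphere_maximal g \<xi> \<le> ennreal (l / 2)" by simp
    have 2: "sphere_maximal (\<lambda>w. ennreal (l / 768)) \<xi> \<le> ennreal (384 * (l / 768))"
      using \<xi> l by (intro sphere_maximal_le_const) auto
    have "sphere_maximal (\<lambda>w. ennreal (f w)) \<xi> \<le> sphere_maximal g \<xi> + sphere_maximal (\<lambda>w. ennreal (l / 768)) \<xi>"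
      by (intro sphere_maximal_add_le) (auto simp: g intro!: ennreal_leI)
    also have "\<dots> \<le> ennreal (l / 2) + ennreal (384 * (l / 768))"
      by (intro add_mono 1 2)
    also have "\<dots> = ennreal l"
      using l by (subst ennreal_plus[symmetric]) auto
    finally show False using \<xi> by simp
  qed
  then have "emeasure sphere_measure {\<xi>. norm \<xi> = 1 \<and> ennreal l < sphere_maximal (\<lambda>w. ennreal (f w)) \<xi>}
     \<le> emeasure sphere_measure {\<xi>. norm \<xi> = 1 \<and> ennreal (l / 2) < sphere_maximal g \<xi>}"
    by (intro emeasure_mono) auto
  also have "\<dots> \<le> ennreal (9600 / (l / 2)) * (\<integral>\<^sup>+ w. g w \<partial>sphere_measure)"
    using l by (intro sphere_maximal_weak_type) auto
  finally show ?thesis by (simp add: g_def)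
qed

text \<open>Marcinkiewicz interpolation between the weak L^1 bound and the sup bound: both p-th
  powers are written as integrals over levels \<open>l\<close>, the level sets are estimated by
  \<open>sphere_maximal_truncate\<close>, and Fubini is applied twice. The remaining weight
  \<open>l powr (p - 2)\<close> is integrable at 0 because \<open>p > 1\<close>. The bound
  \<open>b\<close> does not enter the constant.\<close>

lemma sphere_maximal_strong_type:
  assumes [measurable]: "f \<in> borel_measurable borel" and f: "\<And>w. 0 \<le> f w" "\<And>w. f w \<le> b"
    and p: "1 < p"
  shows "(\<integral>\<^sup>+ \<xi>. ennreal (enn2real (sphere_maximal (\<lambda>w. ennreal (f w)) \<xi>) powr p) \<partial>sphere_measure)
     \<le> ennreal (19200 * p * 768 powr (p - 1) / (p - 1)) * (\<integral>\<^sup>+ w. ennreal (f w powr p) \<partial>sphere_measure)"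
proof -
  let ?M = "sphere_maximal (\<lambda>w. ennreal (f w))"
  let ?C = "ennreal (19200 * p * 768 powr (p - 1) / (p - 1))"
  interpret pair_sigma_finite sphere_measure "lborel :: real measure" ..
  define m where "m \<xi> = enn2real (?M \<xi>)" for \<xi>
  let ?a = "\<lambda>\<xi> l. ennreal (p * l powr (p - 1)) * indicator {0<..<m \<xi>} l"
  let ?b = "\<lambda>w l. ennreal (19200 * p) * ennreal (f w) * (ennreal (l powr (p - 2)) * indicator {0<..<768 * f w} l)"
  let ?S = "\<lambda>l. {\<xi>. norm \<xi> = 1 \<and> ennreal l < ?M \<xi>}"
  have [measurable]: "m \<in> borel_measurable borel"
    unfolding m_def[abs_def] by measurable
  \<comment> \<open>Boundedness of \<open>f\<close> keeps the maximal function finite on the sphere,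
    where \<open>enn2real\<close> is then faithful; at infinity it would return 0.\<close>
  have m: "?M \<xi> = ennreal (m \<xi>)" if "norm \<xi> = 1" for \<xi>
  proof -
    have "?M \<xi> \<le> ennreal (384 * b)"
      using f order_trans[OF f] that by (intro sphere_maximal_le_const) (auto intro: ennreal_leI)
    then show ?thesis unfolding m_def by (metis ennreal_enn2real ennreal_less_top order_le_less_trans)
  qed
  have m0: "0 \<le> m \<xi>" for \<xi> by (simp add: m_def)
  have meas1: "(\<lambda>(\<xi>, l). ?a \<xi> l) \<in> borel_measurable (sphere_measure \<Otimes>\<^sub>M lborel)"
  proof -
    have "(\<lambda>(\<xi>, l). ?a \<xi> l)
      = (\<lambda>x. if 0 < snd x \<and> snd x < m (fst x) then ennreal (p * snd x powr (p - 1)) else 0)"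
      by (auto simp: indicator_def)
    then show ?thesis by simp
  qed
  have meas2: "(\<lambda>(w, l). ?b w l) \<in> borel_measurable (sphere_measure \<Otimes>\<^sub>M lborel)"
  proof -
    have "(\<lambda>(w, l). ?b w l)
      = (\<lambda>x. if 0 < snd x \<and> snd x < 768 * f (fst x)
           then ennreal (19200 * p) * ennreal (f (fst x)) * ennreal (snd x powr (p - 2)) else 0)"
      by (auto simp: indicator_def)
    then show ?thesis by simp
  qed
  have "(\<integral>\<^sup>+ \<xi>. ennreal (m \<xi> powr p) \<partial>sphere_measure)
     = (\<integral>\<^sup>+ \<xi>. (\<integral>\<^sup>+ l. ?a \<xi> l \<partial>lborel) \<partial>sphere_measure)"
  proof (rule nn_integral_cong)
    fix \<xi>
    have "(\<integral>\<^sup>+ l. ?a \<xi> l \<partial>lborel)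
       = (\<integral>\<^sup>+ l. ennreal p * (ennreal (l powr (p - 1)) * indicator {0<..<m \<xi>} l) \<partial>lborel)"
      using p by (intro nn_integral_cong) (auto simp: ennreal_mult mult.assoc)
    also have "\<dots> = ennreal p * (\<integral>\<^sup>+ l. ennreal (l powr (p - 1)) * indicator {0<..<m \<xi>} l \<partial>lborel)"
      by (intro nn_integral_cmult) measurable
    also have "\<dots> = ennreal p * ennreal (m \<xi> powr p / p)"
      using nn_integral_powr_Ioo[of "p - 1" "m \<xi>"] p m0 by simp
    also have "\<dots> = ennreal (m \<xi> powr p)"
      using p by (subst ennreal_mult[symmetric]) auto
    finally show "ennreal (m \<xi> powr p) = (\<integral>\<^sup>+ l. ?a \<xi> l \<partial>lborel)"
      by simp
  qed
  also have "\<dots> = (\<integral>\<^sup>+ l. (\<integral>\<^sup>+ \<xi>. ?a \<xi> l \<partial>sphere_measure) \<partial>lborel)"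
    by (rule Fubini'[OF meas1, symmetric])
  also have "\<dots> \<le> (\<integral>\<^sup>+ l. (\<integral>\<^sup>+ w. ?b w l \<partial>sphere_measure) \<partial>lborel)"
  proof (rule nn_integral_mono)
    fix l :: real
    show "(\<integral>\<^sup>+ \<xi>. ?a \<xi> l \<partial>sphere_measure)
      \<le> (\<integral>\<^sup>+ w. ?b w l \<partial>sphere_measure)"
    proof (cases "0 < l")
      case True
      have "(\<integral>\<^sup>+ \<xi>. ?a \<xi> l \<partial>sphere_measure)
         = (\<integral>\<^sup>+ \<xi>. ennreal (p * l powr (p - 1)) * indicator (?S l) \<xi> \<partial>sphere_measure)"
        by (rule nn_integral_cong_AE, rule AE_mp[OF AE_sphere_measure])
           (use True m m0 in \<open>auto simp: indicator_def ennreal_less_iff\<close>)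
      also have "\<dots> = ennreal (p * l powr (p - 1)) * emeasure sphere_measure (?S l)"
        by (subst nn_integral_cmult_indicator) auto
      also have "\<dots> \<le> ennreal (p * l powr (p - 1)) * (ennreal (19200 / l) * (\<integral>\<^sup>+ w. ennreal (f w) * indicator {0<..<768 * f w} l \<partial>sphere_measure))"
        using True f by (intro mult_left_mono sphere_maximal_truncate) auto
      also have "\<dots> = ennreal (19200 * p * l powr (p - 2)) * (\<integral>\<^sup>+ w. ennreal (f w) * indicator {0<..<768 * f w} l \<partial>sphere_measure)"
      proof -
        have "ennreal (p * l powr (p - 1)) * ennreal (19200 / l) = ennreal (p * l powr (p - 1) * (19200 / l))"
          using True p by (subst ennreal_mult) auto
        also have "p * l powr (p - 1) * (19200 / l) = 19200 * p * l powr (p - 2)"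
          using True by (simp add: powr_diff field_simps power2_eq_square)
        finally show ?thesis by (simp add: mult.assoc[symmetric])
      qed
      also have "\<dots> = (\<integral>\<^sup>+ w. ennreal (19200 * p * l powr (p - 2)) * (ennreal (f w) * indicator {0<..<768 * f w} l) \<partial>sphere_measure)"
      proof (rule nn_integral_cmult[symmetric])
        have "(\<lambda>w. ennreal (f w) * indicator {0<..<768 * f w} l) = (\<lambda>w. if l < 768 * f w then ennreal (f w) else 0)"
          using True by (auto simp: indicator_def)
        then show "(\<lambda>w. ennreal (f w) * indicator {0<..<768 * f w} l) \<in> borel_measurable sphere_measure"
          by simp
      qed
      also have "\<dots> = (\<integral>\<^sup>+ w. ?b w l \<partial>sphere_measure)"
        using p by (intro nn_integral_cong) (simp add: ennreal_mult mult_ac)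
      finally show ?thesis .
    qed simp
  qed
  also have "\<dots> = (\<integral>\<^sup>+ w. (\<integral>\<^sup>+ l. ?b w l \<partial>lborel) \<partial>sphere_measure)"
    by (rule Fubini'[OF meas2])
  also have "\<dots> = (\<integral>\<^sup>+ w. ?C * ennreal (f w powr p) \<partial>sphere_measure)"
  proof (rule nn_integral_cong)
    fix w
    have "(\<integral>\<^sup>+ l. ?b w l \<partial>lborel)
      = ennreal (19200 * p) * ennreal (f w) * (\<integral>\<^sup>+ l. ennreal (l powr (p - 2)) * indicator {0<..<768 * f w} l \<partial>lborel)"
      by (rule nn_integral_cmult) measurable
    also have "\<dots> = ennreal (19200 * p) * ennreal (f w) * ennreal ((768 * f w) powr (p - 1) / (p - 1))"
      using nn_integral_powr_Ioo[of "p - 2" "768 * f w"] p f by simp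
    also have "\<dots> = ennreal (19200 * p * f w * ((768 * f w) powr (p - 1) / (p - 1)))"
      using p f by (subst ennreal_mult[symmetric], simp, simp, subst ennreal_mult[symmetric]) auto
    also have "19200 * p * f w * ((768 * f w) powr (p - 1) / (p - 1)) = 19200 * p * 768 powr (p - 1) / (p - 1) * f w powr p"
    proof (cases "f w = 0")
      case False
      then have "f w * f w powr (p - 1) = f w powr p" using f[of w] by (simp add: powr_mult_base)
      then show ?thesis using f[of w] by (simp add: powr_mult)
    qed (use p in simp)
    also have "ennreal \<dots> = ?C * ennreal (f w powr p)"
      using p by (intro ennreal_mult) auto
    finally show "(\<integral>\<^sup>+ l. ?b w l \<partial>lborel)
       = ?C * ennreal (f w powr p)" .
  qed
  also have "\<dots> = ?C * (\<integral>\<^sup>+ w. ennreal (f w powr p) \<partial>sphere_measure)"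
    by (intro nn_integral_cmult) measurable
  finally show ?thesis by (simp add: m_def)
qed

section \<open>The Poisson kernel\<close>

lemma pd_eqI:
  fixes f :: "R3 \<Rightarrow> real"
  assumes "((\<lambda>t. f (x + t *\<^sub>R axis i 1)) has_real_derivative d) (at 0)"
  shows "has_pd f i x" "pd f i x = d"
  using assms
  by (auto simp: has_pd_def pd_def has_real_derivative_iff_has_vector_derivative vector_derivative_at
      intro: differentiableI_vector)

lemma has_pd_DERIV:
  fixes f :: "R3 \<Rightarrow> real"
  assumes "has_pd f i x"
  shows "((\<lambda>t. f (x + t *\<^sub>R axis i 1)) has_real_derivative pd f i x) (at 0)"
  using assms
  by (simp add: has_pd_def pd_def has_real_derivative_iff_has_vector_derivative vector_derivative_works)

lemma has_pd_DERIV_line: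
  fixes f :: "R3 \<Rightarrow> real"
  assumes "has_pd f i (x + s *\<^sub>R axis i 1)"
  shows "((\<lambda>t. f (x + t *\<^sub>R axis i 1)) has_real_derivative pd f i (x + s *\<^sub>R axis i 1)) (at s)"
proof -
  have "((\<lambda>t. f (x + (t + s) *\<^sub>R axis i 1)) has_real_derivative pd f i (x + s *\<^sub>R axis i 1)) (at 0)"
    using has_pd_DERIV[OF assms] by (simp add: algebra_simps)
  then show ?thesis
    using DERIV_shift[of "\<lambda>t. f (x + t *\<^sub>R axis i 1)" _ 0 s] by simp
qed

text \<open>If \<open>c\<close> were positive, \<open>a'\<close> would be positive just to the right
  of its zero at 0, and by the mean value theorem \<open>a\<close> would exceed \<open>a 0\<close>
  there.\<close>

lemma second_derivative_test_local_max:
  fixes a a' :: "real \<Rightarrow> real"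
  assumes d: "0 < d" and a: "\<And>t. \<bar>t\<bar> < d \<Longrightarrow> (a has_real_derivative a' t) (at t)"
    and max: "\<And>t. \<bar>t\<bar> < d \<Longrightarrow> a t \<le> a 0" and c: "(a' has_real_derivative c) (at 0)"
  shows "c \<le> 0"
proof (rule ccontr)
  assume "\<not> ?thesis"
  then have "0 < c" by simp
  have 0: "a' 0 = 0"
    using DERIV_local_max[OF a[of 0] d] max d by simp
  obtain e where e: "0 < e" "\<And>h. 0 < h \<Longrightarrow> h < e \<Longrightarrow> a' 0 < a' (0 + h)"
    using DERIV_pos_inc_right[OF c \<open>0 < c\<close>] by blast
  define h where "h = min d e / 2"
  have h: "0 < h" "h < d" "h < e" using d e by (auto simp: h_def)
  obtain z where z: "0 < z" "z < h" "a h - a 0 = (h - 0) * a' z"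
    using MVT2[of 0 h a a'] a h by (auto simp: abs_if)
  have "0 < h * a' z" using e(2)[of z] z h 0 by auto
  then have "a 0 < a h" using z by simp
  then show False using max[of h] h by simp
qed

lemma norm_line_power2:
  fixes x :: R3
  shows "(norm (x + t *\<^sub>R axis i 1))\<^sup>2 = (norm x)\<^sup>2 + 2 * t * x $ i + t\<^sup>2"
  unfolding power2_norm_eq_inner
  by (simp add: inner_add_left inner_add_right inner_axis inner_axis' power2_eq_square[of t] algebra_simps)

lemma DERIV_norm_power2_line:
  fixes x :: R3
  shows "((\<lambda>t. (norm (x + t *\<^sub>R axis i 1))\<^sup>2) has_real_derivative 2 * x $ i) (at 0)"
  unfolding norm_line_power2 by (rule derivative_eq_intros refl | simp)+

text \<open>Adding \<open>e * |y|^2\<close> makes the Laplacian equal to \<open>6 * e > 0\<close>.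
  At an interior maximum of the perturbed function every pure second derivative is at most 0, a
  contradiction; so the maximum is on the boundary.\<close>

lemma maximum_principle:
  fixes g :: "R3 \<Rightarrow> real"
  assumes cont: "continuous_on (cball 0 r) g"
    and pd: "\<And>x i. norm x < r \<Longrightarrow> has_pd g i x" "\<And>x i. norm x < r \<Longrightarrow> has_pd (pd g i) i x"
    and lap: "\<And>x. norm x < r \<Longrightarrow> (\<Sum>i\<in>UNIV. pd (pd g i) i x) = 0"
    and bd: "\<And>x. norm x = r \<Longrightarrow> g x \<le> B"
    and x: "norm x \<le> r"
  shows "g x \<le> B"
proof (rule ccontr)
  assume "\<not> ?thesis"
  then have less: "B < g x" by simp
  \<comment> \<open>The perturbation must stay below the gap \<open>g x - B\<close> on the whole
    boundary sphere.\<close>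
  obtain e where e: "0 < e" "e * r\<^sup>2 < g x - B"
  proof -
    define e where "e = (g x - B) / (2 * (r\<^sup>2 + 1))"
    have "0 < e" using less by (auto simp: e_def intro!: divide_pos_pos add_nonneg_pos)
    moreover have "e * (2 * (r\<^sup>2 + 1)) = g x - B"
      using zero_le_power2[of r] by (simp add: e_def add_nonneg_eq_0_iff)
    then have "e * r\<^sup>2 < g x - B" using \<open>0 < e\<close> zero_le_power2[of r]
      by (smt (verit, best) mult_less_cancel_left_pos)
    ultimately show ?thesis using that by blast
  qed
  define k where "k y = g y + e * (norm y)\<^sup>2" for y
  have "continuous_on (cball 0 r) k" unfolding k_def by (intro continuous_intros cont)
  moreover have "cball (0::R3) r \<noteq> {}" using x by (metis empty_iff mem_cball_0)
  ultimately obtain z where z: "norm z \<le> r" "\<And>y. norm y \<le> r \<Longrightarrow> k y \<le> k z"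
    using continuous_attains_sup[of "cball 0 r" k] by auto
  have "norm z \<noteq> r"
  proof
    assume "norm z = r"
    then have "k z \<le> B + e * r\<^sup>2" using bd by (simp add: k_def)
    moreover have "g x \<le> k x" using e by (simp add: k_def)
    ultimately show False using z(2)[OF x] e by simp
  qed
  then have zr: "norm z < r" using z by simp
  have "pd (pd g i) i z + 2 * e \<le> 0" for i
  proof (rule second_derivative_test_local_max)
    show "0 < r - norm z" using zr by simp
    fix t :: real assume t: "\<bar>t\<bar> < r - norm z"
    have n: "norm (z + t *\<^sub>R axis i 1) < r"
      using norm_triangle_ineq[of z "t *\<^sub>R axis i 1"] t by simp
    show "k (z + t *\<^sub>R axis i 1) \<le> k (z + 0 *\<^sub>R axis i 1)"
      using z(2)[of "z + t *\<^sub>R axis i 1"] n by simp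
    show "((\<lambda>t. k (z + t *\<^sub>R axis i 1)) has_real_derivative
       pd g i (z + t *\<^sub>R axis i 1) + e * (2 * z $ i + 2 * t)) (at t)"
      unfolding k_def norm_line_power2
      by (rule derivative_eq_intros has_pd_DERIV_line pd n refl | simp)+
  next
    show "((\<lambda>t. pd g i (z + t *\<^sub>R axis i 1) + e * (2 * z $ i + 2 * t)) has_real_derivative
       pd (pd g i) i z + 2 * e) (at 0)"
      by (rule derivative_eq_intros has_pd_DERIV pd zr refl | simp)+
  qed
  then have "(\<Sum>i\<in>(UNIV::3 set). pd (pd g i) i z + 2 * e) \<le> 0"
    by (intro sum_nonpos) auto
  then show False using lap[OF zr] e by (simp add: sum.distrib)
qed

section \<open>The kernel, its derivatives and their size\<close>

lemma measurable_vec_nth [measurable]: "(\<lambda>x::R3. x $ i) \<in> borel_measurable borel"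
  by (intro borel_measurable_continuous_onI continuous_intros)

text \<open>The Poisson kernel of the unit ball of \<open>R3\<close> without the normalising factor,
  so the total mass of \<open>sphere_measure\<close> appears in the representation formula. Powers
  of \<open>inverse (norm (x - w))\<close> instead of quotients make \<open>poisson1\<close> and
  \<open>poisson2\<close>, its first and second partial derivatives in \<open>x\<close>, polynomial
  expressions.\<close>

definition poisson :: "R3 \<Rightarrow> R3 \<Rightarrow> real" where
  "poisson x w = (1 - (norm x)\<^sup>2) * inverse (norm (x - w)) ^ 3"

definition poisson1 :: "3 \<Rightarrow> R3 \<Rightarrow> R3 \<Rightarrow> real" where
  "poisson1 i x w = - 2 * x $ i * inverse (norm (x - w)) ^ 3
     - 3 * (1 - (norm x)\<^sup>2) * (x - w) $ i * inverse (norm (x - w)) ^ 5"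

definition poisson2 :: "3 \<Rightarrow> 3 \<Rightarrow> R3 \<Rightarrow> R3 \<Rightarrow> real" where
  "poisson2 i j x w =
     (if i = j then 1 else 0) *
       (- 2 * inverse (norm (x - w)) ^ 3 - 3 * (1 - (norm x)\<^sup>2) * inverse (norm (x - w)) ^ 5)
     + 6 * (x $ i * (x - w) $ j + x $ j * (x - w) $ i) * inverse (norm (x - w)) ^ 5
     + 15 * (1 - (norm x)\<^sup>2) * (x - w) $ i * (x - w) $ j * inverse (norm (x - w)) ^ 7"

lemma measurable_poisson [measurable]:
  "poisson x \<in> borel_measurable borel"
  "poisson1 i x \<in> borel_measurable borel"
  "poisson2 i j x \<in> borel_measurable borel"
  unfolding poisson_def[abs_def] poisson1_def[abs_def] poisson2_def[abs_def] by measurable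

lemma DERIV_inverse_norm_line:
  fixes x w :: R3
  assumes "x \<noteq> w"
  shows "((\<lambda>t. inverse (norm (x + t *\<^sub>R axis i 1 - w))) has_real_derivative
    - (x - w) $ i * inverse (norm (x - w)) ^ 3) (at 0)"
proof -
  have *: "((\<lambda>t. inverse (sqrt (q t))) has_real_derivative - d * inverse (sqrt (q 0)) ^ 3) (at 0)"
    if "(q has_real_derivative 2 * d) (at 0)" "0 < q 0" for q d
    using that
    by (auto intro!: derivative_eq_intros simp: power3_eq_cube field_simps)
  have "((\<lambda>t. inverse (sqrt ((norm (x - w + t *\<^sub>R axis i 1))\<^sup>2))) has_real_derivative
      - (x - w) $ i * inverse (sqrt ((norm (x - w + 0 *\<^sub>R axis i 1))\<^sup>2)) ^ 3) (at 0)"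
    by (rule *[OF DERIV_norm_power2_line]) (use assms in auto)
  moreover have "x - w + t *\<^sub>R axis i 1 = x + t *\<^sub>R axis i 1 - w" for t :: real
    by (simp add: algebra_simps)
  ultimately show ?thesis by simp
qed

lemma DERIV_nth_line:
  fixes x :: R3
  shows "((\<lambda>t. (x + t *\<^sub>R axis j 1) $ i) has_real_derivative (if i = j then 1 else 0)) (at 0)"
  by (auto simp: axis_def intro!: derivative_eq_intros)

lemma DERIV_poisson:
  assumes "x \<noteq> w"
  shows "((\<lambda>t. poisson (x + t *\<^sub>R axis i 1) w) has_real_derivative poisson1 i x w) (at 0)"
proof -
  have *: "((\<lambda>t. (1 - n t) * u t ^ 3) has_real_derivative
      - n' * u 0 ^ 3 + (1 - n 0) * (3 * u 0 ^ 2 * u')) (at 0)"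
    if "(n has_real_derivative n') (at 0)" "(u has_real_derivative u') (at 0)"
    for n u :: "real \<Rightarrow> real" and n' u'
    using that by (auto intro!: derivative_eq_intros)
  show ?thesis
    unfolding poisson_def poisson1_def
    by (rule DERIV_cong[OF *[OF DERIV_norm_power2_line DERIV_inverse_norm_line[OF assms]]]) (simp, algebra)
qed

lemma DERIV_poisson1:
  assumes "x \<noteq> w"
  shows "((\<lambda>t. poisson1 i (x + t *\<^sub>R axis j 1) w) has_real_derivative poisson2 i j x w) (at 0)"
proof -
  define c where "c = (if i = j then 1 else 0 :: real)"
  have y: "((\<lambda>t. (x + t *\<^sub>R axis j 1 - w) $ i) has_real_derivative c) (at 0)"
    using DERIV_nth_line[of "x - w" j i] by (simp add: algebra_simps c_def)
  have *: "((\<lambda>t. - 2 * a t * u t ^ 3 - 3 * (1 - n t) * b t * u t ^ 5) has_real_derivative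
      - 2 * (c * u 0 ^ 3 + a 0 * (3 * u 0 ^ 2 * u'))
      - 3 * (- n' * b 0 * u 0 ^ 5 + (1 - n 0) * (c * u 0 ^ 5 + b 0 * (5 * u 0 ^ 4 * u')))) (at 0)"
    if "(n has_real_derivative n') (at 0)" "(u has_real_derivative u') (at 0)"
      "(a has_real_derivative c) (at 0)" "(b has_real_derivative c) (at 0)"
    for n u a b :: "real \<Rightarrow> real" and n' u'
    using that by (auto intro!: derivative_eq_intros) algebra
  show ?thesis
    unfolding poisson1_def poisson2_def c_def[symmetric]
    by (rule DERIV_cong[OF *[OF DERIV_norm_power2_line DERIV_inverse_norm_line[OF assms]
      DERIV_nth_line[of x j i, folded c_def] y]]) (simp, algebra)
qed

text \<open>With \<open>y = x - w\<close> and \<open>u = inverse (norm y)\<close> the claim is a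
  polynomial identity modulo the two relations \<open>u^2 * |y|^2 = 1\<close> and
  \<open>|x - y|^2 = 1\<close>, the latter expressing that \<open>w\<close> lies on the
  sphere.\<close>

lemma laplace_poisson:
  assumes "x \<noteq> w" "norm w = 1"
  shows "(\<Sum>i\<in>UNIV. poisson2 i i x w) = 0"
proof -
  define u where "u = inverse (norm (x - w))"
  define y where "y = x - w"
  have 1: "u\<^sup>2 * ((y$1)\<^sup>2 + (y$2)\<^sup>2 + (y$3)\<^sup>2) = 1"
  proof -
    have "(y$1)\<^sup>2 + (y$2)\<^sup>2 + (y$3)\<^sup>2 = (norm (x - w))\<^sup>2"
      unfolding y_def power2_norm_eq_inner by (simp add: inner_vec_def sum_3 power2_eq_square)
    then show ?thesis using assms by (simp add: u_def flip: power_mult_distrib)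
  qed
  have 2: "(x$1 - y$1)\<^sup>2 + (x$2 - y$2)\<^sup>2 + (x$3 - y$3)\<^sup>2 = 1"
  proof -
    have "(w$1)\<^sup>2 + (w$2)\<^sup>2 + (w$3)\<^sup>2 = (norm w)\<^sup>2"
      unfolding power2_norm_eq_inner by (simp add: inner_vec_def sum_3 power2_eq_square)
    then show ?thesis using assms by (simp add: y_def)
  qed
  have 3: "(norm x)\<^sup>2 = (x$1)\<^sup>2 + (x$2)\<^sup>2 + (x$3)\<^sup>2"
    unfolding power2_norm_eq_inner by (simp add: inner_vec_def sum_3 power2_eq_square)
  show ?thesis
    unfolding poisson2_def sum_3 3
    unfolding u_def[symmetric] unfolding y_def[symmetric]
    using 1 2 by simp algebra
qed

text \<open>The key is \<open>1 - |x|^2 \<le> 2 * (1 - |x|) \<le> 2 * s\<close>: this factor, like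
  every component of \<open>x - w\<close>, pays for one power of \<open>inverse s\<close>. The four
  groups of terms of \<open>poisson2\<close> contribute \<open>4 + 6 + 12 + 30 = 52\<close>, where
  \<open>inverse s ^ 3 \<le> 2 * inverse s ^ 4\<close> is used because
  \<open>s \<le> 2\<close>.\<close>

lemma poisson_bounds:
  assumes x: "norm x < 1" and w: "norm w = 1"
  defines "s \<equiv> norm (x - w)"
  shows "1 - norm x \<le> s" "0 < s" "s \<le> 2"
    and "0 \<le> poisson x w" "poisson x w \<le> 2 * (1 - norm x) * inverse s ^ 3"
    and "\<bar>poisson1 i x w\<bar> \<le> 8 * inverse s ^ 3" "\<bar>poisson2 i j x w\<bar> \<le> 52 * inverse s ^ 4"
proof -
  show s1: "1 - norm x \<le> s"
    unfolding s_def using norm_triangle_ineq2[of w x] w by (simp add: norm_minus_commute)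
  then show s0: "0 < s" using x by simp
  show s2: "s \<le> 2" unfolding s_def using norm_triangle_ineq4[of x w] w x by simp
  define N where "N = 1 - (norm x)\<^sup>2"
  have N: "N = (1 - norm x) * (1 + norm x)" by (simp add: N_def power2_eq_square algebra_simps)
  have N0: "0 \<le> N" using x by (simp add: N)
  have N2: "N \<le> 2 * (1 - norm x)"
    unfolding N using x mult_left_mono[of "1 + norm x" 2 "1 - norm x"] by simp
  have Ns: "N \<le> 2 * s" using N2 s1 by simp
  define u where "u = inverse s"
  have u0: "0 < u" using s0 by (simp add: u_def)
  have us: "u * s = 1" using s0 by (simp add: u_def)
  have u1: "1 \<le> 2 * u" using s2 s0 by (simp add: u_def field_simps)
  have yi: "\<bar>(x - w) $ i\<bar> \<le> s" for i unfolding s_def by (rule component_le_norm_cart)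
  have xi: "\<bar>x $ i\<bar> \<le> 1" for i using component_le_norm_cart[of x i] x by linarith
  have powers: "s * u ^ 5 = u ^ 4" "s * s * u ^ 5 = u ^ 3" "s * s * s * u ^ 7 = u ^ 4"
    using us by algebra+
  have powers_le: "u ^ 3 \<le> 2 * u ^ 4"
    using mult_right_mono[OF u1, of "u ^ 3"] u0 by (simp add: power_numeral_reduce mult_ac)
  show "0 \<le> poisson x w" "poisson x w \<le> 2 * (1 - norm x) * inverse s ^ 3"
    unfolding poisson_def s_def[symmetric] u_def[symmetric] N_def[symmetric]
    using N0 N2 u0 by (auto intro: mult_right_mono)
  have a: "\<bar>N * (x - w) $ i\<bar> \<le> 2 * s * s" for i
    unfolding abs_mult using N0 Ns yi[of i] s0 by (intro mult_mono) auto
  have b: "\<bar>N * (x - w) $ i * (x - w) $ j\<bar> \<le> 2 * s * s * s" for i j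
    unfolding abs_mult using N0 Ns yi[of i] yi[of j] s0 by (intro mult_mono) auto
  have c: "\<bar>x $ i * (x - w) $ j\<bar> \<le> s" for i j
    unfolding abs_mult using mult_mono[OF xi[of i] yi[of j]] by simp
  have abs_u: "\<bar>z * u ^ n\<bar> \<le> k * u ^ n" if "\<bar>z\<bar> \<le> k" for z k n
    unfolding abs_mult using u0 that by (simp add: mult_right_mono)
  have "\<bar>poisson1 i x w\<bar> \<le> 2 * u ^ 3 + (3 * (2 * s * s)) * u ^ 5"
  proof -
    have 1: "\<bar>(- 2 * x $ i) * u ^ 3\<bar> \<le> 2 * u ^ 3" using xi[of i] by (intro abs_u) (simp add: abs_mult)
    have 2: "\<bar>(3 * (N * (x - w) $ i)) * u ^ 5\<bar> \<le> (3 * (2 * s * s)) * u ^ 5"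
      using a[of i] by (intro abs_u) (simp add: abs_mult)
    have "poisson1 i x w = (- 2 * x $ i) * u ^ 3 - (3 * (N * (x - w) $ i)) * u ^ 5"
      by (simp add: poisson1_def N_def u_def s_def)
    then show ?thesis using 1 2 by linarith
  qed
  then show "\<bar>poisson1 i x w\<bar> \<le> 8 * inverse s ^ 3"
    using powers(2) by (simp add: u_def[symmetric] mult.assoc)
  have "\<bar>poisson2 i j x w\<bar> \<le> 2 * u ^ 3 + (3 * (2 * s)) * u ^ 5 + (6 * (s + s)) * u ^ 5 + (15 * (2 * s * s * s)) * u ^ 7"
  proof -
    define d where "d = (if i = j then 1 else 0 :: real)"
    have d: "\<bar>d\<bar> \<le> 1" by (simp add: d_def)
    have 1: "\<bar>(- 2 * d) * u ^ 3\<bar> \<le> 2 * u ^ 3" using d by (intro abs_u) (simp add: abs_mult)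
    have 2: "\<bar>(3 * (d * N)) * u ^ 5\<bar> \<le> (3 * (2 * s)) * u ^ 5"
      using Ns N0 s0 by (intro abs_u) (simp add: d_def)
    have 3: "\<bar>(6 * (x $ i * (x - w) $ j + x $ j * (x - w) $ i)) * u ^ 5\<bar> \<le> (6 * (s + s)) * u ^ 5"
    proof (rule abs_u)
      have "\<bar>x $ i * (x - w) $ j + x $ j * (x - w) $ i\<bar> \<le> s + s"
        using c[of i j] c[of j i] by linarith
      then show "\<bar>6 * (x $ i * (x - w) $ j + x $ j * (x - w) $ i)\<bar> \<le> 6 * (s + s)"
        by (subst abs_mult) simp
    qed
    have 4: "\<bar>(15 * (N * (x - w) $ i * (x - w) $ j)) * u ^ 7\<bar> \<le> (15 * (2 * s * s * s)) * u ^ 7"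
      using b[of i j] by (intro abs_u, subst abs_mult) simp
    have "poisson2 i j x w = (- 2 * d) * u ^ 3 - (3 * (d * N)) * u ^ 5
      + (6 * (x $ i * (x - w) $ j + x $ j * (x - w) $ i)) * u ^ 5 + (15 * (N * (x - w) $ i * (x - w) $ j)) * u ^ 7"
      by (simp add: poisson2_def N_def u_def s_def d_def)
    then show ?thesis using 1 2 3 4 by linarith
  qed
  also have "\<dots> = 2 * u ^ 3 + 6 * u ^ 4 + 12 * u ^ 4 + 30 * u ^ 4"
    using powers by (simp add: mult.assoc distrib_left distrib_right)
  also have "\<dots> \<le> 52 * u ^ 4" using powers_le by simp
  finally show "\<bar>poisson2 i j x w\<bar> \<le> 52 * inverse s ^ 4" by (simp add: u_def)
qed

text \<open>Dominated convergence for sequences, carried over to the filter \<open>at x0\<close> by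
  sequential characterisation. The measure is finite, so a constant serves as majorant, and the
  conditions are imposed on unit vectors only.\<close>

lemma tendsto_sphere_integral:
  fixes K :: "'a::first_countable_topology \<Rightarrow> R3 \<Rightarrow> real"
  assumes K [measurable]: "\<And>x. K x \<in> borel_measurable borel"
    and L [measurable]: "L \<in> borel_measurable borel"
    and bd: "\<forall>\<^sub>F x in at x0. \<forall>w. norm w = 1 \<longrightarrow> \<bar>K x w\<bar> \<le> B"
    and lim: "\<And>w. norm w = 1 \<Longrightarrow> ((\<lambda>x. K x w) \<longlongrightarrow> L w) (at x0)"
  shows "((\<lambda>x. \<integral>w. K x w \<partial>sphere_measure) \<longlongrightarrow> (\<integral>w. L w \<partial>sphere_measure)) (at x0)"
  unfolding tendsto_at_iff_sequentially comp_def
proof (intro allI impI)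
  fix X assume X: "\<forall>i. X i \<in> UNIV - {x0}" "X \<longlonglongrightarrow> x0"
  then have fX: "filterlim X (at x0) sequentially"
    by (auto simp: filterlim_at)
  obtain N where N: "\<And>n w. N \<le> n \<Longrightarrow> norm w = 1 \<Longrightarrow> \<bar>K (X n) w\<bar> \<le> B"
    using filterlim_iff[THEN iffD1, OF fX, rule_format, OF bd]
    by (auto simp: eventually_sequentially)
  show "(\<lambda>n. \<integral>w. K (X n) w \<partial>sphere_measure) \<longlonglongrightarrow> (\<integral>w. L w \<partial>sphere_measure)"
  proof (rule LIMSEQ_offset[of _ N], rule integral_dominated_convergence[where w="\<lambda>_. B"])
    show "AE w in sphere_measure. (\<lambda>n. K (X (n + N)) w) \<longlonglongrightarrow> L w"
      using AE_sphere_measure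
      by eventually_elim (intro LIMSEQ_ignore_initial_segment filterlim_compose[OF lim fX], auto)
    show "AE w in sphere_measure. norm (K (X (n + N)) w) \<le> B" for n
      using AE_sphere_measure by eventually_elim (use N in auto)
  qed auto
qed

text \<open>By the mean value inequality the bound on \<open>K'\<close> also bounds the difference
  quotients, which are then passed to the limit under the integral.\<close>

lemma DERIV_sphere_integral:
  fixes K K' :: "real \<Rightarrow> R3 \<Rightarrow> real"
  assumes [measurable]: "\<And>t. K t \<in> borel_measurable borel" "\<And>t. K' t \<in> borel_measurable borel"
    and e: "0 < e"
    and der: "\<And>t w. \<bar>t\<bar> < e \<Longrightarrow> norm w = 1 \<Longrightarrow> ((\<lambda>t. K t w) has_real_derivative K' t w) (at t)"
    and bd0: "\<And>t w. \<bar>t\<bar> < e \<Longrightarrow> norm w = 1 \<Longrightarrow> \<bar>K t w\<bar> \<le> B"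
    and bd: "\<And>t w. \<bar>t\<bar> < e \<Longrightarrow> norm w = 1 \<Longrightarrow> \<bar>K' t w\<bar> \<le> B"
  shows "((\<lambda>t. \<integral>w. K t w \<partial>sphere_measure) has_real_derivative (\<integral>w. K' 0 w \<partial>sphere_measure)) (at 0)"
proof -
  have int: "integrable sphere_measure (K t)" if "\<bar>t\<bar> < e" for t
    by (rule sphere.integrable_const_bound[of _ B])
       (use AE_sphere_measure bd0 that in \<open>auto elim!: eventually_mono\<close>)
  have ev: "\<forall>\<^sub>F h in at 0. \<bar>h\<bar> < e"
    using e by (auto simp: eventually_at dist_norm intro!: exI[of _ e])
  have "((\<lambda>h. \<integral>w. (K h w - K 0 w) / h \<partial>sphere_measure) \<longlongrightarrow> (\<integral>w. K' 0 w \<partial>sphere_measure)) (at 0)"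
  proof (rule tendsto_sphere_integral)
    show "\<forall>\<^sub>F h in at 0. \<forall>w. norm w = 1 \<longrightarrow> \<bar>(K h w - K 0 w) / h\<bar> \<le> B"
      using ev
    proof eventually_elim
      case (elim h)
      show ?case
      proof (intro allI impI)
        fix w :: R3 assume w: "norm w = 1"
        have B: "0 \<le> B" using bd[of 0 w] w e by (auto intro: order_trans[OF abs_ge_zero])
        have "norm (K h w - K 0 w) \<le> B * norm (h - 0)"
        proof (rule field_differentiable_bound[where S="{-e<..<e}" and f="\<lambda>t. K t w" and f'="\<lambda>t. K' t w"])
          fix t assume "t \<in> {-e<..<e}"
          then have t: "\<bar>t\<bar> < e" by auto
          show "((\<lambda>t. K t w) has_field_derivative K' t w) (at t within {-e<..<e})"
            by (rule has_field_derivative_at_within[OF der[OF t w]])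
          show "norm (K' t w) \<le> B" using bd[OF t w] by simp
        qed (use elim e in auto)
        then show "\<bar>(K h w - K 0 w) / h\<bar> \<le> B"
          using B by (cases "h = 0") (auto simp: abs_divide divide_le_eq)
      qed
    qed
    show "((\<lambda>h. (K h w - K 0 w) / h) \<longlongrightarrow> K' 0 w) (at 0)" if "norm w = 1" for w
      using der[of 0 w] e that by (simp add: DERIV_def)
  qed measurable
  then have "((\<lambda>h. ((\<integral>w. K h w \<partial>sphere_measure) - (\<integral>w. K 0 w \<partial>sphere_measure)) / h)
      \<longlongrightarrow> (\<integral>w. K' 0 w \<partial>sphere_measure)) (at 0)"
  proof (rule Lim_transform_eventually)
    show "\<forall>\<^sub>F h in at 0. (\<integral>w. (K h w - K 0 w) / h \<partial>sphere_measure) =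
        ((\<integral>w. K h w \<partial>sphere_measure) - (\<integral>w. K 0 w \<partial>sphere_measure)) / h"
      using ev by eventually_elim (use int e in simp)
  qed
  then show ?thesis by (simp add: DERIV_def)
qed

section \<open>Poisson integrals of bounded boundary data\<close>

definition poisson_integral :: "(R3 \<Rightarrow> real) \<Rightarrow> R3 \<Rightarrow> real" where
  "poisson_integral f x = (\<integral>w. poisson x w * f w \<partial>sphere_measure)"

context
  fixes f :: "R3 \<Rightarrow> real" and b :: real
  assumes f [measurable]: "f \<in> borel_measurable borel" and b: "\<And>w. \<bar>f w\<bar> \<le> b"
begin

text \<open>One common majorant for the kernel and both orders of derivatives, uniform at distance
  \<open>e\<close> from the sphere; it feeds the domination hypotheses of all differentiations under
  the integral.\<close>

lemma poisson_kernel_bounds_near: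
  assumes x: "norm x \<le> 1 - e" and e: "0 < e" "e \<le> 1" and w: "norm w = 1"
  shows "\<bar>poisson x w * f w\<bar> \<le> 52 * inverse e ^ 4 * b"
    "\<bar>poisson1 i x w * f w\<bar> \<le> 52 * inverse e ^ 4 * b"
    "\<bar>poisson2 i j x w * f w\<bar> \<le> 52 * inverse e ^ 4 * b"
proof -
  have x1: "norm x < 1" using x e by simp
  note pb = poisson_bounds[OF x1 w]
  have es: "e \<le> norm (x - w)" using pb(1) x by simp
  have ie: "inverse (norm (x - w)) \<le> inverse e" using es e by (intro le_imp_inverse_le)
  have i1: "1 \<le> inverse e" using e by (simp add: one_le_inverse)
  have i3: "inverse (norm (x - w)) ^ 3 \<le> inverse e ^ 3" "inverse (norm (x - w)) ^ 4 \<le> inverse e ^ 4"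
    using ie by (intro power_mono; simp)+
  have i34: "inverse e ^ 3 \<le> inverse e ^ 4" using i1 by (intro power_increasing) auto
  have "\<bar>poisson x w\<bar> \<le> 52 * inverse e ^ 4"
  proof -
    have "poisson x w \<le> 2 * 1 * inverse (norm (x - w)) ^ 3"
      using pb(4,5) by (elim order_trans) (intro mult_right_mono, auto)
    then show ?thesis using pb(4) i3 i34 by simp
  qed
  moreover have "\<bar>poisson1 i x w\<bar> \<le> 52 * inverse e ^ 4" "\<bar>poisson2 i j x w\<bar> \<le> 52 * inverse e ^ 4"
    using pb(6)[of i] pb(7)[of i j] i3 i34 zero_le_power[of "inverse e" 4] e
    by (linarith | simp)+
  ultimately show "\<bar>poisson x w * f w\<bar> \<le> 52 * inverse e ^ 4 * b"
    "\<bar>poisson1 i x w * f w\<bar> \<le> 52 * inverse e ^ 4 * b"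
    "\<bar>poisson2 i j x w * f w\<bar> \<le> 52 * inverse e ^ 4 * b"
    unfolding abs_mult using b[of w] by (auto intro!: mult_mono)
qed

lemma integrable_poisson_kernels:
  assumes x: "norm x < 1"
  shows "integrable sphere_measure (\<lambda>w. poisson x w * f w)"
    "integrable sphere_measure (\<lambda>w. poisson1 i x w * f w)"
    "integrable sphere_measure (\<lambda>w. poisson2 i j x w * f w)"
proof -
  have e: "norm x \<le> 1 - (1 - norm x)" "0 < 1 - norm x" "1 - norm x \<le> 1" using x by auto
  have *: "integrable sphere_measure g" if "\<And>w. norm w = 1 \<Longrightarrow> \<bar>g w\<bar> \<le> B" "g \<in> borel_measurable borel" for g :: "R3 \<Rightarrow> real" and B
    by (rule sphere.integrable_const_bound[of _ B])
       (use AE_sphere_measure that in \<open>auto elim!: eventually_mono\<close>)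
  show "integrable sphere_measure (\<lambda>w. poisson x w * f w)"
    "integrable sphere_measure (\<lambda>w. poisson1 i x w * f w)"
    "integrable sphere_measure (\<lambda>w. poisson2 i j x w * f w)"
    by (rule *, rule poisson_kernel_bounds_near[OF e], assumption, measurable)+
qed

lemma line_in_ball:
  assumes "2 * e = 1 - norm (x::R3)" "\<bar>t\<bar> < e"
  shows "norm (x + t *\<^sub>R axis i 1) \<le> 1 - e"
proof -
  have "norm (t *\<^sub>R axis i 1 :: R3) = \<bar>t\<bar>" by simp
  then show ?thesis using norm_triangle_ineq[of x "t *\<^sub>R axis i 1"] assms by linarith
qed

lemma DERIV_line_shift:
  assumes "((\<lambda>h. g (x + t *\<^sub>R axis i 1 + h *\<^sub>R axis i 1)) has_real_derivative d) (at 0)"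
  shows "((\<lambda>h. g (x + h *\<^sub>R axis i 1)) has_real_derivative d) (at t)"
proof -
  have "((\<lambda>h. g (x + (h + t) *\<^sub>R axis i 1)) has_real_derivative d) (at 0)"
    using assms by (simp add: algebra_simps)
  then show ?thesis
    using DERIV_shift[of "\<lambda>h. g (x + h *\<^sub>R axis i 1)" _ 0 t] by simp
qed

lemma pd_poisson_integral:
  assumes x: "norm x < 1"
  shows "has_pd (poisson_integral f) i x"
    "pd (poisson_integral f) i x = (\<integral>w. poisson1 i x w * f w \<partial>sphere_measure)"
proof -
  define e where "e = (1 - norm x) / 2"
  have e2: "2 * e = 1 - norm x" by (simp add: e_def)
  then have e: "0 < e" "e \<le> 1" using x norm_ge_zero[of x] by linarith+
  have ne: "x + t *\<^sub>R axis i 1 \<noteq> w" if "\<bar>t\<bar> < e" "norm w = 1" for t w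
    using line_in_ball[OF e2, of t i] that e by auto
  have "((\<lambda>t. \<integral>w. poisson (x + t *\<^sub>R axis i 1) w * f w \<partial>sphere_measure) has_real_derivative
     (\<integral>w. poisson1 i (x + 0 *\<^sub>R axis i 1) w * f w \<partial>sphere_measure)) (at 0)"
  proof (rule DERIV_sphere_integral[where B="52 * inverse e ^ 4 * b", OF _ _ e(1)])
    fix t w assume t: "\<bar>t\<bar> < e" and w: "norm (w::R3) = 1"
    show "((\<lambda>t. poisson (x + t *\<^sub>R axis i 1) w * f w) has_real_derivative
        poisson1 i (x + t *\<^sub>R axis i 1) w * f w) (at t)"
      by (rule DERIV_cmult_right, rule DERIV_line_shift, rule DERIV_poisson, rule ne[OF t w])
    show "\<bar>poisson (x + t *\<^sub>R axis i 1) w * f w\<bar> \<le> 52 * inverse e ^ 4 * b"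
      "\<bar>poisson1 i (x + t *\<^sub>R axis i 1) w * f w\<bar> \<le> 52 * inverse e ^ 4 * b"
      using line_in_ball[OF e2, of t i] t w e by (auto intro!: poisson_kernel_bounds_near)
  qed measurable
  then have "((\<lambda>t. poisson_integral f (x + t *\<^sub>R axis i 1)) has_real_derivative
     (\<integral>w. poisson1 i x w * f w \<partial>sphere_measure)) (at 0)"
    by (simp add: poisson_integral_def)
  from pd_eqI[OF this] show "has_pd (poisson_integral f) i x"
    "pd (poisson_integral f) i x = (\<integral>w. poisson1 i x w * f w \<partial>sphere_measure)" by auto
qed

lemma pd2_poisson_integral:
  assumes x: "norm x < 1"
  shows "has_pd (pd (poisson_integral f) i) j x"
    "pd (pd (poisson_integral f) i) j x = (\<integral>w. poisson2 i j x w * f w \<partial>sphere_measure)"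
proof -
  define e where "e = (1 - norm x) / 2"
  have e2: "2 * e = 1 - norm x" by (simp add: e_def)
  then have e: "0 < e" "e \<le> 1" using x norm_ge_zero[of x] by linarith+
  have ne: "x + t *\<^sub>R axis j 1 \<noteq> w" if "\<bar>t\<bar> < e" "norm w = 1" for t w
    using line_in_ball[OF e2, of t j] that e by auto
  have "((\<lambda>t. \<integral>w. poisson1 i (x + t *\<^sub>R axis j 1) w * f w \<partial>sphere_measure) has_real_derivative
     (\<integral>w. poisson2 i j (x + 0 *\<^sub>R axis j 1) w * f w \<partial>sphere_measure)) (at 0)"
  proof (rule DERIV_sphere_integral[where B="52 * inverse e ^ 4 * b", OF _ _ e(1)])
    fix t w assume t: "\<bar>t\<bar> < e" and w: "norm (w::R3) = 1"
    show "((\<lambda>t. poisson1 i (x + t *\<^sub>R axis j 1) w * f w) has_real_derivative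
        poisson2 i j (x + t *\<^sub>R axis j 1) w * f w) (at t)"
      by (rule DERIV_cmult_right, rule DERIV_line_shift, rule DERIV_poisson1, rule ne[OF t w])
    show "\<bar>poisson1 i (x + t *\<^sub>R axis j 1) w * f w\<bar> \<le> 52 * inverse e ^ 4 * b"
      "\<bar>poisson2 i j (x + t *\<^sub>R axis j 1) w * f w\<bar> \<le> 52 * inverse e ^ 4 * b"
      using line_in_ball[OF e2, of t j] t w e by (auto intro!: poisson_kernel_bounds_near)
  qed measurable
  then have "((\<lambda>t. pd (poisson_integral f) i (x + t *\<^sub>R axis j 1)) has_real_derivative
     (\<integral>w. poisson2 i j x w * f w \<partial>sphere_measure)) (at 0)"
  \<comment> \<open>The integral formula for the first derivative is known inside the ball only,
    hence for small \<open>t\<close>, which suffices for a derivative at 0.\<close>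
  proof (rule DERIV_cong_ev[THEN iffD1, rotated -1])
    have "\<forall>\<^sub>F t in nhds (0::real). \<bar>t\<bar> < e"
      using e by (auto simp: eventually_nhds_metric dist_norm)
    then show "\<forall>\<^sub>F t in nhds 0. (\<integral>w. poisson1 i (x + t *\<^sub>R axis j 1) w * f w \<partial>sphere_measure)
        = pd (poisson_integral f) i (x + t *\<^sub>R axis j 1)"
    proof eventually_elim
      case (elim t)
      then show ?case
        using line_in_ball[OF e2, of t j] e by (subst pd_poisson_integral(2)) auto
    qed
  qed auto
  from pd_eqI[OF this] show "has_pd (pd (poisson_integral f) i) j x"
    "pd (pd (poisson_integral f) i) j x = (\<integral>w. poisson2 i j x w * f w \<partial>sphere_measure)" by auto
qed

lemma laplace_poisson_integral:
  assumes x: "norm x < 1"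
  shows "(\<Sum>i\<in>UNIV. pd (pd (poisson_integral f) i) i x) = 0"
proof -
  have "(\<Sum>i\<in>UNIV. pd (pd (poisson_integral f) i) i x) = (\<integral>w. (\<Sum>i\<in>UNIV. poisson2 i i x w * f w) \<partial>sphere_measure)"
    by (simp add: pd2_poisson_integral[OF x] integrable_poisson_kernels[OF x] Bochner_Integration.integral_sum)
  also have "\<dots> = (\<integral>w. 0 \<partial>sphere_measure)"
  proof (rule integral_cong_AE)
    show "AE w in sphere_measure. (\<Sum>i\<in>UNIV. poisson2 i i x w * f w) = 0"
      using AE_sphere_measure
    proof eventually_elim
      case (elim w)
      then have "x \<noteq> w" using x by auto
      then show ?case using laplace_poisson[of x w] elim by (simp add: sum_distrib_right[symmetric])
    qed
  qed measurable
  finally show ?thesis by simp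
qed

lemma continuous_on_poisson_integral: "continuous_on unit_ball (poisson_integral f)"
proof (intro continuous_at_imp_continuous_on ballI)
  fix x :: R3 assume "x \<in> unit_ball"
  then have x: "norm x < 1" by simp
  define e where "e = (1 - norm x) / 2"
  have e2: "2 * e = 1 - norm x" by (simp add: e_def)
  then have e: "0 < e" "e \<le> 1" using x norm_ge_zero[of x] by linarith+
  show "isCont (poisson_integral f) x"
    unfolding isCont_def poisson_integral_def
  proof (rule tendsto_sphere_integral)
    have "\<forall>\<^sub>F y in at x. dist y x < e"
      using e by (auto simp: eventually_at)
    then show "\<forall>\<^sub>F y in at x. \<forall>w. norm w = 1 \<longrightarrow> \<bar>poisson y w * f w\<bar> \<le> 52 * inverse e ^ 4 * b"
    proof eventually_elim
      case (elim y)
      have "norm y \<le> 1 - e"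
        using norm_triangle_ineq[of x "y - x"] elim e2 unfolding dist_norm by simp
      then show ?case using e by (auto intro: poisson_kernel_bounds_near)
    qed
    fix w :: R3 assume "norm w = 1"
    then have "x \<noteq> w" using x by auto
    then show "((\<lambda>y. poisson y w * f w) \<longlongrightarrow> poisson x w * f w) (at x)"
      unfolding poisson_def by (intro tendsto_intros) auto
  qed measurable
qed

end

section \<open>Poisson representation of harmonic functions\<close>

text \<open>Partial derivatives are local. This is what allows an identity valid on an open set to
  be differentiated once more.\<close>

lemma pd_cong:
  fixes f g :: "R3 \<Rightarrow> 'b::real_normed_vector"
  assumes "open S" "x \<in> S" "\<And>y. y \<in> S \<Longrightarrow> f y = g y"
  shows "has_pd f i x \<longleftrightarrow> has_pd g i x" "pd f i x = pd g i x"
proof -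
  have "continuous (at 0) (\<lambda>t. x + t *\<^sub>R axis i 1)"
    by (intro continuous_intros)
  then have "((\<lambda>t. x + t *\<^sub>R axis i 1) \<longlongrightarrow> x) (at (0::real))"
    by (simp add: continuous_at)
  then have "((\<lambda>t. x + t *\<^sub>R axis i 1) \<longlongrightarrow> x) (nhds (0::real))"
    by (simp add: tendsto_nhds_iff)
  then have ev: "\<forall>\<^sub>F t in nhds (0::real). x + t *\<^sub>R axis i 1 \<in> S"
    using assms(1,2) by (rule topological_tendstoD)
  then have ev: "\<forall>\<^sub>F t in nhds (0::real). f (x + t *\<^sub>R axis i 1) = g (x + t *\<^sub>R axis i 1)"
    by eventually_elim (use assms in auto)
  have *: "((\<lambda>t. f (x + t *\<^sub>R axis i 1)) has_vector_derivative d) (at 0) \<longleftrightarrow>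
     ((\<lambda>t. g (x + t *\<^sub>R axis i 1)) has_vector_derivative d) (at 0)" for d
    by (rule has_vector_derivative_cong_ev) (use ev in \<open>auto simp: assms(2,3) elim: eventually_mono\<close>)
  show "has_pd f i x \<longleftrightarrow> has_pd g i x"
    unfolding has_pd_def by (metis * differentiableI_vector vector_derivative_works)
  show "pd f i x = pd g i x"
    unfolding pd_def vector_derivative_def * ..
qed

lemma pd_lincomb:
  fixes f g :: "R3 \<Rightarrow> real"
  assumes "has_pd f i x" "has_pd g i x"
  shows "has_pd (\<lambda>x. a * f x + b * g x) i x" "pd (\<lambda>x. a * f x + b * g x) i x = a * pd f i x + b * pd g i x"
proof -
  have "((\<lambda>t. a * f (x + t *\<^sub>R axis i 1) + b * g (x + t *\<^sub>R axis i 1)) has_real_derivative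
      a * pd f i x + b * pd g i x) (at 0)"
    by (intro DERIV_add DERIV_cmult has_pd_DERIV assms)
  from pd_eqI[OF this] show "has_pd (\<lambda>x. a * f x + b * g x) i x"
    "pd (\<lambda>x. a * f x + b * g x) i x = a * pd f i x + b * pd g i x" by auto
qed

text \<open>Tailored to \<open>maximum_principle\<close>: continuity of the function and mere
  existence of the pure second derivatives, without continuity of any derivative.\<close>

definition harmonic_on :: "R3 set \<Rightarrow> (R3 \<Rightarrow> real) \<Rightarrow> bool" where
  "harmonic_on S g \<longleftrightarrow> continuous_on S g \<and>
     (\<forall>x\<in>S. (\<forall>i. has_pd g i x \<and> has_pd (pd g i) i x) \<and> (\<Sum>i\<in>UNIV. pd (pd g i) i x) = 0)"

lemma harmonic_on_lincomb:
  assumes S: "open S" and f: "harmonic_on S f" and g: "harmonic_on S g"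
  shows "harmonic_on S (\<lambda>x. a * f x + b * g x)"
  unfolding harmonic_on_def
proof (intro conjI ballI allI)
  show "continuous_on S (\<lambda>x. a * f x + b * g x)"
    using f g by (intro continuous_intros) (auto simp: harmonic_on_def)
  fix x assume x: "x \<in> S"
  show "has_pd (\<lambda>x. a * f x + b * g x) i x" for i
    using f g x by (intro pd_lincomb) (auto simp: harmonic_on_def)
  have eq: "pd (\<lambda>x. a * f x + b * g x) i y = a * pd f i y + b * pd g i y" if "y \<in> S" for y i
    using f g that by (intro pd_lincomb) (auto simp: harmonic_on_def)
  have h: "has_pd (pd f i) i x" "has_pd (pd g i) i x" for i
    using f g x by (auto simp: harmonic_on_def)
  show "has_pd (pd (\<lambda>x. a * f x + b * g x) i) i x" for i
    using pd_cong(1)[OF S x eq] pd_lincomb(1)[OF h] by simp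
  have "pd (pd (\<lambda>x. a * f x + b * g x) i) i x = a * pd (pd f i) i x + b * pd (pd g i) i x" for i
    using pd_cong(2)[OF S x eq] pd_lincomb(2)[OF h] by simp
  then show "(\<Sum>i\<in>UNIV. pd (pd (\<lambda>x. a * f x + b * g x) i) i x) = 0"
    using f g x by (simp add: sum.distrib sum_distrib_left[symmetric] harmonic_on_def)
qed

lemma maximum_principle_abs:
  assumes g: "harmonic_on unit_ball g" and r: "r < 1"
    and bd: "\<And>x. norm x = r \<Longrightarrow> \<bar>g x\<bar> \<le> B" and x: "norm x \<le> r"
  shows "\<bar>g x\<bar> \<le> B"
proof -
  have "c * g x \<le> B" if c: "c = 1 \<or> c = -1" for c
  proof -
    have h: "harmonic_on unit_ball (\<lambda>x. c * g x + 0 * g x)"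
      by (rule harmonic_on_lincomb[OF open_ball g g])
    have "c * g x + 0 * g x \<le> B"
    proof (rule maximum_principle[where g="\<lambda>x. c * g x + 0 * g x", OF _ _ _ _ _ x])
      show "continuous_on (cball 0 r) (\<lambda>x. c * g x + 0 * g x)"
        using h r unfolding harmonic_on_def by (auto elim!: continuous_on_subset)
      show "c * g x + 0 * g x \<le> B" if "norm x = r" for x
        using bd[OF that] c by (auto simp: abs_le_iff)
    qed (use h r in \<open>auto simp: harmonic_on_def\<close>)
    then show ?thesis by simp
  qed
  from this[of 1] this[of "-1"] show ?thesis by (simp add: abs_le_iff)
qed

lemma harmonic_on_poisson_integral:
  assumes "f \<in> borel_measurable borel" "\<And>w. \<bar>f w\<bar> \<le> b"
  shows "harmonic_on unit_ball (poisson_integral f)"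
  unfolding harmonic_on_def
  using continuous_on_poisson_integral[OF assms] pd_poisson_integral[OF assms]
    pd2_poisson_integral[OF assms] laplace_poisson_integral[OF assms] by auto

lemma poisson_integral_rotate:
  assumes "norm x = norm y"
  shows "poisson_integral (\<lambda>_. 1) x = poisson_integral (\<lambda>_. 1) y"
proof -
  obtain Q where Q: "orthogonal_transformation Q" "Q x = y"
    using orthogonal_transformation_exists[OF assms] by metis
  have [measurable]: "Q \<in> borel_measurable borel"
    using Q by (simp add: borel_measurable_continuous_onI linear_continuous_on linear_linear orthogonal_transformation_linear)
  have "poisson_integral (\<lambda>_. 1) y = (\<integral>w. poisson y w \<partial>distr sphere_measure borel Q)"
    unfolding poisson_integral_def distr_sphere_measure[OF Q(1)] by simp
  also have "\<dots> = (\<integral>w. poisson y (Q w) \<partial>sphere_measure)"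
    by (rule integral_distr) measurable
  also have "\<dots> = poisson_integral (\<lambda>_. 1) x"
  proof -
    have "norm (y - Q w) = norm (x - w)" for w
      using Q unfolding orthogonal_transformation_isometry dist_norm by metis
    then show ?thesis using assms by (simp add: poisson_integral_def poisson_def)
  qed
  finally show ?thesis by simp
qed

text \<open>The integral is harmonic and, by rotation invariance, constant on spheres about 0. The
  maximum principle on the ball of radius \<open>norm x\<close>, applied to it and to its negative,
  shows that its value at \<open>x\<close> is the one at 0, where the kernel is 1.\<close>

lemma poisson_integral_one:
  assumes x: "norm x < 1"
  shows "poisson_integral (\<lambda>_. 1) x = measure sphere_measure UNIV"
proof -
  let ?I = "poisson_integral (\<lambda>_. 1)"
  have h: "harmonic_on unit_ball ?I"
    by (rule harmonic_on_poisson_integral[where b=1]) auto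
  have c: "?I y \<le> ?I x" if "norm y \<le> norm x" for y
  proof (rule maximum_principle[where r="norm x"])
    show "continuous_on (cball 0 (norm x)) ?I"
      using h x unfolding harmonic_on_def by (auto elim!: continuous_on_subset)
    show "?I z \<le> ?I x" if "norm z = norm x" for z
      using poisson_integral_rotate[OF that] by simp
  qed (use h x that in \<open>auto simp: harmonic_on_def\<close>)
  have h': "harmonic_on unit_ball (\<lambda>x. - 1 * ?I x + 0 * ?I x)"
    by (rule harmonic_on_lincomb[OF open_ball h h])
  have "- 1 * ?I 0 + 0 * ?I 0 \<le> - ?I x"
  proof (rule maximum_principle[where r="norm x" and g="\<lambda>x. - 1 * ?I x + 0 * ?I x"])
    show "continuous_on (cball 0 (norm x)) (\<lambda>x. - 1 * ?I x + 0 * ?I x)"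
    proof (rule continuous_on_subset)
      show "cball 0 (norm x) \<subseteq> unit_ball" using x by auto
    qed (use h' in \<open>simp only: harmonic_on_def\<close>)
    show "- 1 * ?I z + 0 * ?I z \<le> - ?I x" if "norm z = norm x" for z
      using poisson_integral_rotate[OF that] by simp
  qed (use h' x in \<open>auto simp: harmonic_on_def\<close>)
  then have "?I x = ?I 0" using c[of 0] by simp
  also have "\<dots> = (\<integral>w. 1 \<partial>sphere_measure)"
    unfolding poisson_integral_def
  proof (rule integral_cong_AE)
    show "AE w in sphere_measure. poisson 0 w * 1 = 1"
      using AE_sphere_measure by eventually_elim (simp add: poisson_def)
  qed measurable
  finally show ?thesis by simp
qed

lemma integral_abs_le_AE:
  fixes g h :: "'a \<Rightarrow> real"
  assumes "integrable M g" "integrable M h" "AE w in M. \<bar>g w\<bar> \<le> h w"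
  shows "\<bar>\<integral>w. g w \<partial>M\<bar> \<le> (\<integral>w. h w \<partial>M)"
  using assms by (intro order_trans[OF integral_abs_bound] integral_mono_AE) auto

text \<open>The Poisson integral says nothing on the unit sphere itself, so the comparison takes
  place on a sphere of radius \<open>r < 1\<close>. There \<open>poisson_integral_one\<close> writes
  \<open>A * v y\<close> as an integral against the kernel, the differences \<open>v y - v w\<close>
  are small near \<open>y\<close> by uniform continuity, and the kernel is small elsewhere; the
  maximum principle carries the bound inwards to \<open>x\<close>.\<close>

lemma poisson_representation:
  fixes v f :: "R3 \<Rightarrow> real"
  assumes cont: "continuous_on (cball 0 1) v" and harm: "harmonic_on unit_ball v"
    and f [measurable]: "f \<in> borel_measurable borel" and b: "\<And>w. \<bar>f w\<bar> \<le> b"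
    and fv: "\<And>w. norm w = 1 \<Longrightarrow> f w = v w" and x: "norm x < 1"
  shows "measure sphere_measure UNIV * v x = poisson_integral f x"
proof -
  define A where "A = measure sphere_measure UNIV"
  have A: "0 < A" unfolding A_def by (rule measure_sphere_measure_pos)
  obtain c where c: "0 < c" "\<And>y. norm y \<le> 1 \<Longrightarrow> \<bar>v y\<bar> \<le> c"
    using compact_continuous_image[OF cont compact_cball, THEN compact_imp_bounded]
    by (auto simp: bounded_pos)
  let ?d = "\<lambda>y. A * v y + (-1) * poisson_integral f y"
  have h: "harmonic_on unit_ball ?d"
    by (intro harmonic_on_lincomb open_ball harm harmonic_on_poisson_integral[OF f b])
  have "\<exists>r<1. norm x \<le> r \<and> (\<forall>y. norm y = r \<longrightarrow> \<bar>?d y\<bar> \<le> 2 * e * A)" if e: "0 < e" for e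
  proof -
    obtain \<eta> where \<eta>: "0 < \<eta>" "\<And>y w. norm y \<le> 1 \<Longrightarrow> norm w \<le> 1 \<Longrightarrow> dist w y < \<eta> \<Longrightarrow> dist (v w) (v y) < e"
      using compact_uniformly_continuous[OF cont compact_cball] e
      unfolding uniformly_continuous_on_def by (metis mem_cball_0)
    \<comment> \<open>With \<open>r = 1 - \<delta>\<close> the kernel is at most
      \<open>2 * \<delta> / \<eta> ^ 3\<close> at distance \<open>\<eta>\<close> or more, while
      \<open>v\<close> varies by at most \<open>2 * c\<close>; the product has to stay below
      \<open>e\<close>.\<close>
    define \<delta> where "\<delta> = min (1 - norm x) (e * \<eta> ^ 3 / (4 * c))"
    have \<delta>: "0 < \<delta>" "\<delta> \<le> 1 - norm x" "4 * c * \<delta> \<le> e * \<eta> ^ 3"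
      using x e \<eta> c by (auto simp: \<delta>_def min_def field_simps)
    define r where "r = 1 - \<delta>"
    have r: "r < 1" "norm x \<le> r" using \<delta> by (auto simp: r_def)
    moreover have "\<bar>?d y\<bar> \<le> 2 * e * A" if y: "norm y = r" for y
    proof -
      have y1: "norm y < 1" using y r by simp
      have i1: "integrable sphere_measure (\<lambda>w. poisson y w * 1)"
        by (rule integrable_poisson_kernels(1)[where b=1]) (use y1 in auto)
      have i2: "integrable sphere_measure (\<lambda>w. poisson y w * f w)"
        by (rule integrable_poisson_kernels(1)[OF f b y1])
      have "A * v y = (\<integral>w. poisson y w * v y \<partial>sphere_measure)"
        using poisson_integral_one[OF y1] i1 by (simp add: A_def poisson_integral_def)
      then have "?d y = (\<integral>w. poisson y w * v y - poisson y w * f w \<partial>sphere_measure)"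
        using i1 i2 by (simp add: poisson_integral_def)
      \<comment> \<open>A single majorant for both regimes: \<open>e\<close> times the kernel for
        \<open>w\<close> near \<open>y\<close>, the constant \<open>e\<close> for \<open>w\<close>
        far away. Each has integral \<open>e * A\<close>.\<close>
      also have "\<bar>\<dots>\<bar> \<le> (\<integral>w. e * (poisson y w * 1) + e \<partial>sphere_measure)"
      proof (rule integral_abs_le_AE)
        show "integrable sphere_measure (\<lambda>w. e * (poisson y w * 1) + e)" using i1 by simp
        show "AE w in sphere_measure. \<bar>poisson y w * v y - poisson y w * f w\<bar> \<le> e * (poisson y w * 1) + e"
          using AE_sphere_measure
        proof eventually_elim
          case (elim w)
          note pb = poisson_bounds[OF y1 elim]
          have eq: "\<bar>poisson y w * v y - poisson y w * f w\<bar> = poisson y w * \<bar>v y - v w\<bar>"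
            using pb(4) fv[OF elim] by (simp add: abs_mult flip: right_diff_distrib)
          show ?case
          proof (cases "dist w y < \<eta>")
            case True
            then have "\<bar>v y - v w\<bar> \<le> e"
              using \<eta>(2)[of y w] y1 elim by (simp add: dist_real_def)
            then have "poisson y w * \<bar>v y - v w\<bar> \<le> poisson y w * e"
              using pb(4) by (rule mult_left_mono)
            then show ?thesis unfolding eq using e by (simp add: mult.commute)
          next
            case False
            have "inverse (norm (y - w)) ^ 3 \<le> inverse \<eta> ^ 3"
              using False \<eta> by (intro power_mono le_imp_inverse_le) (auto simp: dist_norm norm_minus_commute)
            then have "2 * (1 - norm y) * inverse (norm (y - w)) ^ 3 \<le> 2 * (1 - norm y) * inverse \<eta> ^ 3"
              using y1 by (intro mult_left_mono) auto
            then have "poisson y w \<le> 2 * \<delta> * inverse \<eta> ^ 3"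
              using pb(5) y by (simp add: r_def)
            moreover have "\<bar>v y - v w\<bar> \<le> 2 * c"
              using c(2)[of y] c(2)[of w] y1 elim by linarith
            ultimately have "poisson y w * \<bar>v y - v w\<bar> \<le> 2 * \<delta> * inverse \<eta> ^ 3 * (2 * c)"
              using \<delta> \<eta> by (intro mult_mono) auto
            also have "\<dots> = 4 * c * \<delta> * inverse \<eta> ^ 3" by simp
            also have "\<dots> \<le> e * \<eta> ^ 3 * inverse \<eta> ^ 3"
              using \<delta> \<eta> by (intro mult_right_mono) auto
            also have "\<dots> = e" using \<eta> by (simp add: power_inverse)
            finally show ?thesis unfolding eq using e pb(4) by (simp add: add_increasing)
          qed
        qed
      qed (use i1 i2 in auto)
      also have "\<dots> = 2 * e * A"
        using i1 poisson_integral_one[OF y1] by (simp add: poisson_integral_def A_def)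
      finally show ?thesis .
    qed
    ultimately show ?thesis by blast
  qed
  then have "\<bar>?d x\<bar> \<le> 2 * e * A" if "0 < e" for e
    using maximum_principle_abs[OF h] that by metis
  from this[of "e / (2 * A)" for e] have "\<bar>?d x\<bar> \<le> 0 + e" if "0 < e" for e
    using that A by simp
  then have "\<bar>?d x\<bar> \<le> 0" by (rule field_le_epsilon)
  then show ?thesis by (simp add: A_def)
qed

section \<open>Nontangential bounds for harmonic functions\<close>

text \<open>Write \<open>x = s * \<xi> + t * z\<close> with \<open>|z| \<le> 1/2\<close> and
  \<open>s + t = 1\<close>. Then \<open>1 - |x| \<ge> t / 2\<close>, whereas
  \<open>\<xi> - x = t * (\<xi> - z)\<close> has norm at most \<open>3 * t / 2\<close>. This
  quotient 3 is all that the later estimates know of the shape of \<open>Gamma\<close>.\<close>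

lemma Gamma_bounds:
  assumes \<xi>: "norm \<xi> = 1" and x: "x \<in> Gamma \<xi>"
  shows "norm x < 1" "dist \<xi> x \<le> 3 * (1 - norm x)"
proof -
  show "norm x < 1" using x by (simp add: Gamma_def)
  have "x \<in> convex hull (insert \<xi> (cball 0 (1/2)))" using x by (simp add: Gamma_def)
  moreover have "convex hull (cball (0::R3) (1/2)) = cball 0 (1/2)" by (simp add: hull_same convex_cball)
  ultimately obtain s t z where st: "0 \<le> s" "0 \<le> t" "s + t = 1" "norm z \<le> 1/2" "x = s *\<^sub>R \<xi> + t *\<^sub>R z"
    by (subst (asm) convex_hull_insert) auto
  have "norm x \<le> s * norm \<xi> + t * norm z"
    unfolding st(5) using st(1,2) norm_triangle_ineq[of "s *\<^sub>R \<xi>" "t *\<^sub>R z"] by simp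
  also have "\<dots> \<le> s + t * (1/2)" using \<xi> st mult_left_mono[OF st(4) st(2)] by simp
  finally have 1: "norm x \<le> s + t / 2" by simp
  have "\<xi> - x = t *\<^sub>R (\<xi> - z)"
  proof -
    have "\<xi> = (s + t) *\<^sub>R \<xi>" using st by simp
    then show ?thesis unfolding st(5) by (simp add: algebra_simps)
  qed
  then have "dist \<xi> x = t * norm (\<xi> - z)" using st by (simp add: dist_norm)
  also have "\<dots> \<le> t * (3/2)"
    using norm_triangle_ineq4[of \<xi> z] \<xi> st by (intro mult_left_mono) auto
  finally show "dist \<xi> x \<le> 3 * (1 - norm x)" using 1 st by argo
qed

text \<open>With \<open>s = |x - w| \<ge> 1 - |x|\<close> the triangle inequality gives
  \<open>dist \<xi> w \<le> 3 * (1 - |x|) + s \<le> 4 * s\<close>. If \<open>w\<close> leaves the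
  caps between scales \<open>n\<close> and \<open>n + 1\<close>, this forces
  \<open>inverse s \<le> 2 ^ (n + 1)\<close>; if it is still in cap \<open>N\<close>, the hypothesis
  on \<open>N\<close> gives the same bound from \<open>1 - |x| \<le> s\<close>.\<close>

lemma kernel_le_dyadic_caps:
  fixes x w \<xi> :: R3
  assumes x: "norm x < 1" "dist \<xi> x \<le> 3 * (1 - norm x)" and \<xi>: "norm \<xi> = 1" and w: "norm w = 1"
    and N: "1 < 2 ^ (N + 1) * (1 - norm x)"
  shows "\<exists>n\<le>N. w \<in> ball \<xi> (4 / 2 ^ n) \<and> inverse (norm (x - w)) ^ 3 \<le> 8 * 8 ^ n"
proof -
  define s where "s = norm (x - w)"
  have s: "1 - norm x \<le> s" "0 < s" using poisson_bounds(1,2)[OF x(1) w] by (auto simp: s_def)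
  have ds: "dist \<xi> w \<le> 4 * s"
    using dist_triangle[of \<xi> w x] x s by (simp add: dist_norm s_def)
  have "\<exists>n\<le>N. dist \<xi> w < 4 / 2 ^ n \<and> 1 \<le> 2 ^ (n + 1) * s"
  proof (cases "dist \<xi> w < 4 / 2 ^ N")
    case True
    have "2 ^ (N + 1) * (1 - norm x) \<le> 2 ^ (N + 1) * s" using s by (intro mult_left_mono) auto
    then have "1 \<le> 2 ^ (N + 1) * s" using N by linarith
    then show ?thesis using True by blast
  next
    case False
    \<comment> \<open>The first cap missing \<open>w\<close>; the scale sought is the one before. It
      exists because cap 0 has radius 4, more than the diameter of the sphere.\<close>
    define m where "m = (LEAST m. \<not> dist \<xi> w < 4 / 2 ^ m)"
    have m: "\<not> dist \<xi> w < 4 / 2 ^ m" unfolding m_def by (rule LeastI, rule False)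
    have mN: "m \<le> N" unfolding m_def by (rule Least_le, rule False)
    have "dist \<xi> w \<le> 2" using norm_triangle_ineq4[of \<xi> w] \<xi> w by (simp add: dist_norm)
    then have "m \<noteq> 0" using m by (intro notI) simp
    then obtain n where n: "m = Suc n" by (cases m) auto
    have "dist \<xi> w < 4 / 2 ^ n"
      using not_less_Least[of n "\<lambda>m. \<not> dist \<xi> w < 4 / 2 ^ m"] n by (simp add: m_def)
    moreover have "1 \<le> 2 ^ (n + 1) * s"
    proof -
      have "4 / 2 ^ (n + 1) \<le> 4 * s" using m ds n by simp
      then show ?thesis by (simp add: field_simps)
    qed
    ultimately show ?thesis using n mN by (intro exI[of _ n]) auto
  qed
  then obtain n where n: "n \<le> N" "dist \<xi> w < 4 / 2 ^ n" "1 \<le> 2 ^ (n + 1) * s" by blast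
  have "inverse s \<le> 2 ^ (n + 1)" using n(3) s by (simp add: field_simps)
  then have "inverse s ^ 3 \<le> (2 ^ (n + 1)) ^ 3" using s by (intro power_mono) auto
  also have "\<dots> = 8 * 8 ^ n"
    by (simp add: power_mult_distrib power_mult[symmetric] mult.commute[of n] power_mult)
  finally show ?thesis using n by (auto simp: s_def)
qed

text \<open>Summing over caps, scale \<open>n\<close> contributes \<open>8 * 8 ^ n\<close> times an
  integral of at most \<open>4 ^ -n\<close> times the maximal function, that is
  \<open>8 * 2 ^ n\<close>. The geometric sum is comparable to its last term, and stopping at the
  largest \<open>N\<close> with \<open>2 ^ N \<le> 1 / (1 - |x|)\<close> gives the factor
  16.\<close>

lemma kernel_integral_le_maximal:
  assumes F [measurable]: "F \<in> borel_measurable borel" and \<xi>: "norm \<xi> = 1" and x: "x \<in> Gamma \<xi>"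
  shows "(\<integral>\<^sup>+ w. ennreal (inverse (norm (x - w)) ^ 3) * F w \<partial>sphere_measure)
     \<le> ennreal (16 / (1 - norm x)) * sphere_maximal F \<xi>"
proof -
  note G = Gamma_bounds[OF \<xi> x]
  have "1 \<le> 1 / (1 - norm x)" using G(1) by (simp add: field_simps)
  then obtain N :: nat where N: "2 ^ N \<le> 1 / (1 - norm x)" "1 / (1 - norm x) < 2 ^ (N + 1)"
  proof -
    obtain n where n: "1 / (1 - norm x) < 2 ^ n" using real_arch_pow[of 2 "1 / (1 - norm x)"] by auto
    define m where "m = (LEAST m. 1 / (1 - norm x) < 2 ^ m)"
    have m: "1 / (1 - norm x) < 2 ^ m" unfolding m_def by (rule LeastI, rule n)
    have "m \<noteq> 0" using m \<open>1 \<le> 1 / (1 - norm x)\<close> by (intro notI) simp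
    then obtain k where k: "m = Suc k" by (cases m) auto
    have "\<not> 1 / (1 - norm x) < 2 ^ k"
      using not_less_Least[of k "\<lambda>m. 1 / (1 - norm x) < 2 ^ m"] k by (simp add: m_def)
    then show ?thesis using m k by (intro that[of k]) auto
  qed
  have N': "1 < 2 ^ (N + 1) * (1 - norm x)" using N(2) G(1) by (simp add: field_simps)
  let ?I = "\<lambda>n w. indicator (ball \<xi> (4 / 2 ^ n)) w :: ennreal"
  have "(\<integral>\<^sup>+ w. ennreal (inverse (norm (x - w)) ^ 3) * F w \<partial>sphere_measure)
      \<le> (\<integral>\<^sup>+ w. (\<Sum>n\<le>N. 8 * 8 ^ n * (F w * ?I n w)) \<partial>sphere_measure)"
  proof (rule nn_integral_mono_AE)
    show "AE w in sphere_measure. ennreal (inverse (norm (x - w)) ^ 3) * F w \<le> (\<Sum>n\<le>N. 8 * 8 ^ n * (F w * ?I n w))"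
      using AE_sphere_measure
    proof eventually_elim
      case (elim w)
      obtain n where n: "n \<le> N" "w \<in> ball \<xi> (4 / 2 ^ n)" "inverse (norm (x - w)) ^ 3 \<le> 8 * 8 ^ n"
        using kernel_le_dyadic_caps[OF G \<xi> elim N'] by blast
      have "ennreal (inverse (norm (x - w)) ^ 3) \<le> ennreal (8 * 8 ^ n)" using n by (intro ennreal_leI)
      also have "\<dots> = 8 * 8 ^ n" by (simp add: ennreal_mult ennreal_power[symmetric])
      finally have "ennreal (inverse (norm (x - w)) ^ 3) * F w \<le> 8 * 8 ^ n * F w"
        by (rule mult_right_mono) simp
      also have "\<dots> = 8 * 8 ^ n * (F w * ?I n w)" using n by simp
      also have "\<dots> \<le> (\<Sum>n\<le>N. 8 * 8 ^ n * (F w * ?I n w))"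
        using n by (intro member_le_sum) auto
      finally show ?case .
    qed
  qed
  also have "\<dots> = (\<Sum>n\<le>N. 8 * 8 ^ n * (\<integral>\<^sup>+ w. F w * ?I n w \<partial>sphere_measure))"
  proof -
    have m: "(\<lambda>w. F w * ?I n w) \<in> borel_measurable sphere_measure" for n
      by (intro borel_measurable_times_ennreal borel_measurable_indicator) auto
    show ?thesis
      by (subst nn_integral_sum) (use m in \<open>auto simp: nn_integral_cmult intro!: borel_measurable_times_ennreal\<close>)
  qed
  also have "\<dots> \<le> (\<Sum>n\<le>N. ennreal (8 * 2 ^ n) * sphere_maximal F \<xi>)"
  proof (rule sum_mono)
    fix n
    have "8 * 8 ^ n * (\<integral>\<^sup>+ w. F w * ?I n w \<partial>sphere_measure)
        = ennreal (8 * 2 ^ n) * (4 ^ n * (\<integral>\<^sup>+ w. F w * ?I n w \<partial>sphere_measure))"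
      by (simp add: ennreal_mult ennreal_power[symmetric] mult.assoc power_mult_distrib[symmetric])
         (simp add: mult.assoc[symmetric] power_mult_distrib[symmetric])
    also have "\<dots> \<le> ennreal (8 * 2 ^ n) * sphere_maximal F \<xi>"
      unfolding sphere_maximal_def by (intro mult_left_mono SUP_upper) auto
    finally show "8 * 8 ^ n * (\<integral>\<^sup>+ w. F w * ?I n w \<partial>sphere_measure) \<le> ennreal (8 * 2 ^ n) * sphere_maximal F \<xi>" .
  qed
  also have "\<dots> = ennreal (\<Sum>n\<le>N. 8 * 2 ^ n) * sphere_maximal F \<xi>"
    unfolding sum_distrib_right[symmetric] by (subst sum_ennreal) auto
  also have "\<dots> \<le> ennreal (16 / (1 - norm x)) * sphere_maximal F \<xi>"
  proof (intro mult_right_mono ennreal_leI)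
    have "(\<Sum>n\<le>N. 8 * 2 ^ n :: real) = 8 * (2 ^ (N + 1) - 1)"
      by (induction N) (auto simp: algebra_simps)
    also have "\<dots> \<le> 16 * 2 ^ N" by simp
    also have "\<dots> \<le> 16 * (1 / (1 - norm x))" using N(1) by (intro mult_left_mono) auto
    finally show "(\<Sum>n\<le>N. 8 * 2 ^ n :: real) \<le> 16 / (1 - norm x)" by simp
  qed simp
  finally show ?thesis .
qed

lemma kernel_integral_bound:
  fixes K f F :: "R3 \<Rightarrow> real"
  assumes [measurable]: "K \<in> borel_measurable borel" "f \<in> borel_measurable borel" "F \<in> borel_measurable borel"
    and int: "integrable sphere_measure (\<lambda>w. K w * f w)"
    and F: "\<And>w. 0 \<le> F w" "\<And>w. F w \<le> b" and fF: "\<And>w. norm w = 1 \<Longrightarrow> \<bar>f w\<bar> \<le> F w"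
    and \<xi>: "norm \<xi> = 1" and x: "x \<in> Gamma \<xi>"
    and K: "\<And>w. norm w = 1 \<Longrightarrow> \<bar>K w\<bar> \<le> k * inverse (norm (x - w)) ^ 3" and k: "0 \<le> k"
  shows "\<bar>\<integral>w. K w * f w \<partial>sphere_measure\<bar> \<le> k * (16 / (1 - norm x)) * enn2real (sphere_maximal (\<lambda>w. ennreal (F w)) \<xi>)"
proof -
  let ?M = "sphere_maximal (\<lambda>w. ennreal (F w)) \<xi>"
  have x1: "norm x < 1" by (rule Gamma_bounds[OF \<xi> x])
  have "?M \<le> ennreal (384 * b)"
    using F order_trans[OF F] \<xi> by (intro sphere_maximal_le_const) (auto intro: ennreal_leI)
  \<comment> \<open>The bound \<open>b\<close> serves to make the maximal function finite; it leaves
    no trace in the estimate.\<close>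
  then have M: "?M = ennreal (enn2real ?M)"
    by (metis ennreal_enn2real ennreal_less_top order_le_less_trans)
  have "ennreal \<bar>\<integral>w. K w * f w \<partial>sphere_measure\<bar> \<le> (\<integral>\<^sup>+ w. ennreal \<bar>K w * f w\<bar> \<partial>sphere_measure)"
    using integral_norm_bound_ennreal[OF int] by simp
  also have "\<dots> \<le> (\<integral>\<^sup>+ w. ennreal k * (ennreal (inverse (norm (x - w)) ^ 3) * ennreal (F w)) \<partial>sphere_measure)"
  proof (rule nn_integral_mono_AE)
    show "AE w in sphere_measure. ennreal \<bar>K w * f w\<bar> \<le> ennreal k * (ennreal (inverse (norm (x - w)) ^ 3) * ennreal (F w))"
      using AE_sphere_measure
    proof eventually_elim
      case (elim w)
      have "\<bar>K w * f w\<bar> \<le> (k * inverse (norm (x - w)) ^ 3) * F w"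
        unfolding abs_mult using K[OF elim] fF[OF elim] k by (intro mult_mono) auto
      then have "ennreal \<bar>K w * f w\<bar> \<le> ennreal ((k * inverse (norm (x - w)) ^ 3) * F w)" by (rule ennreal_leI)
      also have "\<dots> = ennreal k * (ennreal (inverse (norm (x - w)) ^ 3) * ennreal (F w))"
        using k F by (simp add: ennreal_mult mult.assoc)
      finally show ?case .
    qed
  qed
  also have "\<dots> = ennreal k * (\<integral>\<^sup>+ w. ennreal (inverse (norm (x - w)) ^ 3) * ennreal (F w) \<partial>sphere_measure)"
    by (rule nn_integral_cmult) measurable
  also have "\<dots> \<le> ennreal k * (ennreal (16 / (1 - norm x)) * ?M)"
    by (intro mult_left_mono kernel_integral_le_maximal \<xi> x) auto
  also have "\<dots> = ennreal (k * (16 / (1 - norm x)) * enn2real ?M)"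
    using k x1 by (subst M) (simp add: ennreal_mult[symmetric] mult.assoc)
  finally show ?thesis using k x1 by (subst (asm) ennreal_le_iff) auto
qed

text \<open>For the kernel, its factor \<open>2 * (1 - |x|)\<close> cancels the
  \<open>16 / (1 - |x|)\<close> of \<open>kernel_integral_le_maximal\<close>, leaving 32. For second
  derivatives one of the four powers of \<open>inverse |x - w|\<close> is traded for
  \<open>1 / (1 - |x|)\<close>, which gives \<open>52 * 16 = 832\<close>.\<close>

lemma harmonic_nontangential_bounds:
  fixes v F :: "R3 \<Rightarrow> real"
  assumes cont: "continuous_on (cball 0 1) v" and harm: "harmonic_on unit_ball v"
    and F [measurable]: "F \<in> borel_measurable borel" "\<And>w. 0 \<le> F w" "\<And>w. F w \<le> b"
    and vF: "\<And>w. norm w = 1 \<Longrightarrow> \<bar>v w\<bar> \<le> F w"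
    and \<xi>: "norm \<xi> = 1" and x: "x \<in> Gamma \<xi>"
  defines "A \<equiv> measure sphere_measure UNIV" and "m \<equiv> enn2real (sphere_maximal (\<lambda>w. ennreal (F w)) \<xi>)"
  shows "A * \<bar>v x\<bar> \<le> 32 * m" "A * \<bar>pd (pd v i) j x\<bar> \<le> 832 * m / (1 - norm x)\<^sup>2"
proof -
  have A: "0 < A" unfolding A_def by (rule measure_sphere_measure_pos)
  have x1: "norm x < 1" by (rule Gamma_bounds[OF \<xi> x])
  then have x1': "x \<in> unit_ball" by simp
  \<comment> \<open>Extension by zero turns boundary values continuous on the sphere into a Borel
    function on \<open>R3\<close>.\<close>
  define f where "f w = indicator (sphere 0 1) w * v w" for w
  have f[measurable]: "f \<in> borel_measurable borel"
  proof -
    have "continuous_on (sphere 0 1) v" using cont by (rule continuous_on_subset) auto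
    then show ?thesis
      unfolding f_def[abs_def] using borel_measurable_continuous_on_indicator[of "sphere 0 1" v] by simp
  qed
  have fF: "\<bar>f w\<bar> \<le> F w" for w using vF[of w] F(2)[of w] by (auto simp: f_def indicator_def)
  have fb: "\<bar>f w\<bar> \<le> b" for w using fF F(3) by (rule order_trans)
  \<comment> \<open>The vacuous summand puts the formula into the shape of
    \<open>pd_lincomb\<close>, the rule that differentiates it twice below.\<close>
  have rep: "v y = inverse A * poisson_integral f y + 0 * poisson_integral f y" if "y \<in> unit_ball" for y
  proof -
    have "f w = v w" if "norm w = 1" for w using that by (simp add: f_def)
    from poisson_representation[OF cont harm f fb this, of y] show ?thesis
      using that A by (simp add: A_def[symmetric] field_simps)
  qed
  have "\<bar>\<integral>w. poisson x w * f w \<partial>sphere_measure\<bar> \<le> 2 * (1 - norm x) * (16 / (1 - norm x)) * m"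
    unfolding m_def
  proof (rule kernel_integral_bound[OF _ f F(1) _ F(2,3) fF \<xi> x])
    show "\<bar>poisson x w\<bar> \<le> 2 * (1 - norm x) * inverse (norm (x - w)) ^ 3" if "norm w = 1" for w
      using poisson_bounds(4,5)[OF x1 that] by simp
  qed (use x1 integrable_poisson_kernels[OF f fb x1] in auto)
  also have "\<dots> = 32 * m" using x1 by (simp add: field_simps)
  finally show "A * \<bar>v x\<bar> \<le> 32 * m"
    using rep[of x] x1 A by (simp add: poisson_integral_def abs_mult field_simps)
  have pdv: "pd v i y = inverse A * pd (poisson_integral f) i y + 0 * pd (poisson_integral f) i y"
    if "y \<in> unit_ball" for y i
  proof -
    have h: "has_pd (poisson_integral f) i y" using that by (intro pd_poisson_integral(1)[OF f fb]) simp
    show ?thesis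
      by (rule trans[OF pd_cong(2)[OF open_ball that rep] pd_lincomb(2)[OF h h]])
  qed
  have "pd (pd v i) j x = inverse A * pd (pd (poisson_integral f) i) j x + 0 * pd (pd (poisson_integral f) i) j x"
  proof -
    have h: "has_pd (pd (poisson_integral f) i) j x" by (rule pd2_poisson_integral(1)[OF f fb x1])
    show ?thesis
      by (rule trans[OF pd_cong(2)[OF open_ball x1' pdv] pd_lincomb(2)[OF h h]])
  qed
  then have "A * pd (pd v i) j x = (\<integral>w. poisson2 i j x w * f w \<partial>sphere_measure)"
    using A pd2_poisson_integral(2)[OF f fb x1] by simp
  then have "A * \<bar>pd (pd v i) j x\<bar> = \<bar>\<integral>w. poisson2 i j x w * f w \<partial>sphere_measure\<bar>"
    using A by (metis abs_mult abs_of_pos)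
  also have "\<dots> \<le> 52 / (1 - norm x) * (16 / (1 - norm x)) * m"
    unfolding m_def
  proof (rule kernel_integral_bound[OF _ f F(1) _ F(2,3) fF \<xi> x])
    fix w :: R3 assume w: "norm w = 1"
    note pb = poisson_bounds[OF x1 w]
    have "inverse (norm (x - w)) \<le> inverse (1 - norm x)" using pb(1) x1 by (intro le_imp_inverse_le) auto
    then have "inverse (norm (x - w)) * inverse (norm (x - w)) ^ 3 \<le> inverse (1 - norm x) * inverse (norm (x - w)) ^ 3"
      by (intro mult_right_mono) auto
    then have "inverse (norm (x - w)) ^ 4 \<le> inverse (1 - norm x) * inverse (norm (x - w)) ^ 3"
      by (simp add: power_numeral_reduce)
    then show "\<bar>poisson2 i j x w\<bar> \<le> 52 / (1 - norm x) * inverse (norm (x - w)) ^ 3"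
      using pb(7)[of i j] by (simp add: divide_inverse)
  qed (use x1 integrable_poisson_kernels[OF f fb x1] in auto)
  also have "\<dots> = 832 * m / (1 - norm x)\<^sup>2" by (simp add: power2_eq_square)
  finally show "A * \<bar>pd (pd v i) j x\<bar> \<le> 832 * m / (1 - norm x)\<^sup>2" .
qed

section \<open>Functions with continuous partial derivatives\<close>

text \<open>C^k regularity expressed by \<open>has_pd\<close> and \<open>pd\<close>, the terms in
  which \<open>lame_solution\<close> grants it. Closure under sums, products and parameter integrals
  is then an induction on the order.\<close>

fun Ck :: "nat \<Rightarrow> R3 set \<Rightarrow> (R3 \<Rightarrow> real) \<Rightarrow> bool" where
  "Ck 0 S f \<longleftrightarrow> continuous_on S f"
| "Ck (Suc k) S f \<longleftrightarrow> continuous_on S f \<and> (\<forall>i. (\<forall>x\<in>S. has_pd f i x) \<and> Ck k S (pd f i))"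

lemma Ck_continuous_on: "Ck k S f \<Longrightarrow> continuous_on S f"
  by (cases k) auto

lemma Ck_SucD: "Ck (Suc k) S f \<Longrightarrow> x \<in> S \<Longrightarrow> has_pd f i x" "Ck (Suc k) S f \<Longrightarrow> Ck k S (pd f i)"
  by auto

lemma Ck_mono: "Ck k S f \<Longrightarrow> j \<le> k \<Longrightarrow> Ck j S f"
proof (induction j arbitrary: k f)
  case 0 then show ?case by (simp add: Ck_continuous_on)
next
  case (Suc j)
  then obtain k' where "k = Suc k'" "j \<le> k'" by (cases k) auto
  then show ?case using Suc by auto
qed

lemma Ck_subset: "Ck k S f \<Longrightarrow> T \<subseteq> S \<Longrightarrow> Ck k T f"
  by (induction k arbitrary: f) (auto intro: continuous_on_subset)

lemma Ck_cong:
  assumes "open S" "\<And>x. x \<in> S \<Longrightarrow> f x = g x" "Ck k S f"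
  shows "Ck k S g"
  using assms(2,3)
proof (induction k arbitrary: f g)
  case 0 then show ?case by (auto cong: continuous_on_cong)
next
  case (Suc k)
  have "continuous_on S g" using Suc.prems continuous_on_cong[OF refl, of S f g] by auto
  moreover have "has_pd g i x" if "x \<in> S" for i x
    using pd_cong(1)[OF assms(1) that, of f g i] Suc.prems that by auto
  moreover have "Ck k S (pd g i)" for i
  proof (rule Suc.IH)
    show "pd f i x = pd g i x" if "x \<in> S" for x
      by (rule pd_cong(2)[OF assms(1) that Suc.prems(1)])
    show "Ck k S (pd f i)" using Suc.prems(2) by simp
  qed
  ultimately show ?case by simp
qed

lemma Ck_const: "Ck k S (\<lambda>_. c)"
proof (induction k arbitrary: c)
  case (Suc k)
  have "((\<lambda>t. c) has_real_derivative 0) (at 0)" by simp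
  then have pd: "has_pd (\<lambda>_. c) i x" "pd (\<lambda>_. c) i x = 0" for i x
    using pd_eqI[of "\<lambda>_. c" x i 0] by auto
  have "pd (\<lambda>_. c) i = (\<lambda>_. 0)" for i using pd by auto
  then show ?case using Suc pd by simp
qed simp

lemma Ck_nth: "Ck k S (\<lambda>x. x $ j)"
proof (cases k)
  case (Suc k')
  have pd: "has_pd (\<lambda>x. x $ j) i x" "pd (\<lambda>x. x $ j) i x = (if j = i then 1 else 0)" for i and x :: R3
    using pd_eqI[OF DERIV_nth_line[of x i j]] by auto
  have "pd (\<lambda>x. x $ j) i = (\<lambda>_. if j = i then 1 else 0)" for i using pd by auto
  then show ?thesis using Suc pd Ck_const by (auto intro!: continuous_intros)
qed (auto intro!: continuous_intros)

lemma Ck_lincomb: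
  assumes "open S" "Ck k S f" "Ck k S g"
  shows "Ck k S (\<lambda>x. a * f x + b * g x)"
  using assms(2,3)
proof (induction k arbitrary: f g)
  case 0 then show ?case by (auto intro!: continuous_intros)
next
  case (Suc k)
  have pd: "has_pd (\<lambda>x. a * f x + b * g x) i x" "pd (\<lambda>x. a * f x + b * g x) i x = a * pd f i x + b * pd g i x"
    if "x \<in> S" for x i
    using pd_lincomb[of f i x g a b] Suc.prems that by auto
  have "Ck k S (pd (\<lambda>x. a * f x + b * g x) i)" for i
    by (rule Ck_cong[OF assms(1) _ Suc.IH[of "pd f i" "pd g i"]]) (use pd Suc.prems in auto)
  then show ?case using Suc.prems pd by (auto intro!: continuous_intros)
qed

lemma Ck_add: "open S \<Longrightarrow> Ck k S f \<Longrightarrow> Ck k S g \<Longrightarrow> Ck k S (\<lambda>x. f x + g x)"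
  using Ck_lincomb[of S k f g 1 1] by simp

lemma Ck_cmult: "open S \<Longrightarrow> Ck k S f \<Longrightarrow> Ck k S (\<lambda>x. a * f x)"
  using Ck_lincomb[of S k f f a 0] by simp

lemma Ck_diff: "open S \<Longrightarrow> Ck k S f \<Longrightarrow> Ck k S g \<Longrightarrow> Ck k S (\<lambda>x. f x - g x)"
  using Ck_lincomb[of S k f g 1 "-1"] by simp

lemma Ck_sum: "open S \<Longrightarrow> (\<And>j. j \<in> I \<Longrightarrow> Ck k S (f j)) \<Longrightarrow> Ck k S (\<lambda>x. \<Sum>j\<in>I. f j x)"
  by (induction I rule: infinite_finite_induct) (auto simp: Ck_const intro!: Ck_add)

lemma pd_mult:
  fixes f g :: "R3 \<Rightarrow> real"
  assumes "has_pd f i x" "has_pd g i x"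
  shows "has_pd (\<lambda>x. f x * g x) i x" "pd (\<lambda>x. f x * g x) i x = pd f i x * g x + f x * pd g i x"
proof -
  have "((\<lambda>t. f (x + t *\<^sub>R axis i 1) * g (x + t *\<^sub>R axis i 1)) has_real_derivative
      pd f i x * g x + f x * pd g i x) (at 0)"
    using DERIV_mult[OF has_pd_DERIV[OF assms(1)] has_pd_DERIV[OF assms(2)]] by (simp add: mult.commute)
  from pd_eqI[OF this] show "has_pd (\<lambda>x. f x * g x) i x"
    "pd (\<lambda>x. f x * g x) i x = pd f i x * g x + f x * pd g i x" by auto
qed

lemma Ck_mult:
  assumes "open S" "Ck k S f" "Ck k S g"
  shows "Ck k S (\<lambda>x. f x * g x)"
  using assms(2,3)
proof (induction k arbitrary: f g)
  case 0 then show ?case by (auto intro!: continuous_intros)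
next
  case (Suc k)
  have pd: "has_pd (\<lambda>x. f x * g x) i x" "pd (\<lambda>x. f x * g x) i x = pd f i x * g x + f x * pd g i x"
    if "x \<in> S" for x i
    using pd_mult[of f i x g] Suc.prems that by auto
  have "Ck k S f" "Ck k S g" using Ck_mono[OF Suc.prems(1), of k] Ck_mono[OF Suc.prems(2), of k] by auto
  note ck = this
  have "Ck k S (pd (\<lambda>x. f x * g x) i)" for i
    by (rule Ck_cong[OF assms(1) _ Ck_add[OF assms(1) Suc.IH[of "pd f i" g] Suc.IH[of f "pd g i"]]])
      (use ck pd Suc.prems in auto)
  then show ?case using Suc.prems pd by (auto intro!: continuous_intros)
qed

lemma pd_sum:
  fixes f :: "'i \<Rightarrow> R3 \<Rightarrow> real"
  assumes "\<And>j. j \<in> I \<Longrightarrow> has_pd (f j) i x"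
  shows "has_pd (\<lambda>x. \<Sum>j\<in>I. f j x) i x" "pd (\<lambda>x. \<Sum>j\<in>I. f j x) i x = (\<Sum>j\<in>I. pd (f j) i x)"
proof -
  have "((\<lambda>t. \<Sum>j\<in>I. f j (x + t *\<^sub>R axis i 1)) has_real_derivative (\<Sum>j\<in>I. pd (f j) i x)) (at 0)"
    by (intro DERIV_sum has_pd_DERIV assms)
  from pd_eqI[OF this] show "has_pd (\<lambda>x. \<Sum>j\<in>I. f j x) i x"
    "pd (\<lambda>x. \<Sum>j\<in>I. f j x) i x = (\<Sum>j\<in>I. pd (f j) i x)" by auto
qed

section \<open>Affine substitutions and integrals over them\<close>

lemma pd_affine:
  fixes f :: "R3 \<Rightarrow> real"
  assumes "has_pd f i (a *\<^sub>R x + b)"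
  shows "has_pd (\<lambda>x. f (a *\<^sub>R x + b)) i x" "pd (\<lambda>x. f (a *\<^sub>R x + b)) i x = a * pd f i (a *\<^sub>R x + b)"
proof -
  have "((\<lambda>t. f ((a *\<^sub>R x + b) + (a * t) *\<^sub>R axis i 1)) has_real_derivative pd f i (a *\<^sub>R x + b) * a) (at 0)"
    by (rule DERIV_chain2[where g="\<lambda>t. a * t"]) (auto intro!: derivative_eq_intros has_pd_DERIV assms)
  then have "((\<lambda>t. f (a *\<^sub>R (x + t *\<^sub>R axis i 1) + b)) has_real_derivative a * pd f i (a *\<^sub>R x + b)) (at 0)"
    by (simp add: algebra_simps)
  from pd_eqI[of "\<lambda>x. f (a *\<^sub>R x + b)", OF this] show "has_pd (\<lambda>x. f (a *\<^sub>R x + b)) i x"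
    "pd (\<lambda>x. f (a *\<^sub>R x + b)) i x = a * pd f i (a *\<^sub>R x + b)" by auto
qed

text \<open>Leibniz rule for one family of operators with two uses: \<open>\<alpha> t = t^2\<close>,
  \<open>\<beta> = 0\<close> gives the radial integral \<open>potential\<close>, and
  \<open>\<alpha> = 1\<close>, \<open>\<beta> t = t * axis i 1\<close> gives the segment average
  \<open>steklov\<close>. The terms \<open>1 *\<^sub>R x\<close> and \<open>+ 0\<close> seen later
  keep this common shape visible.\<close>

lemma pd_affine_integral:
  fixes f :: "R3 \<Rightarrow> real" and \<alpha> :: "real \<Rightarrow> real" and \<beta> :: "real \<Rightarrow> R3"
  assumes S: "open S" and T: "open T"
    and maps: "\<And>x t. x \<in> T \<Longrightarrow> t \<in> {0..h} \<Longrightarrow> \<alpha> t *\<^sub>R x + \<beta> t \<in> S"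
    and \<alpha>: "continuous_on {0..h} \<alpha>" and \<beta>: "continuous_on {0..h} \<beta>" and \<gamma>: "continuous_on {0..h} \<gamma>"
    and f: "continuous_on S f" "\<And>x. x \<in> S \<Longrightarrow> has_pd f i x" "continuous_on S (pd f i)"
    and x: "x \<in> T"
  shows "has_pd (\<lambda>x. integral {0..h} (\<lambda>t. \<gamma> t * f (\<alpha> t *\<^sub>R x + \<beta> t))) i x"
    "pd (\<lambda>x. integral {0..h} (\<lambda>t. \<gamma> t * f (\<alpha> t *\<^sub>R x + \<beta> t))) i x
      = integral {0..h} (\<lambda>t. \<gamma> t * \<alpha> t * pd f i (\<alpha> t *\<^sub>R x + \<beta> t))"
proof -
  obtain e where e: "0 < e" "ball x e \<subseteq> T" using T x openE by blast
  have xs: "x + s *\<^sub>R axis i 1 \<in> T" if "s \<in> {-e<..<e}" for s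
    using e(2) that by (auto simp: subset_iff dist_norm)
  have "((\<lambda>s. integral (cbox 0 h) (\<lambda>t. \<gamma> t * f (\<alpha> t *\<^sub>R (x + s *\<^sub>R axis i 1) + \<beta> t))) has_field_derivative
     integral (cbox 0 h) (\<lambda>t. \<gamma> t * \<alpha> t * pd f i (\<alpha> t *\<^sub>R (x + 0 *\<^sub>R axis i 1) + \<beta> t))) (at 0 within {-e<..<e})"
  proof (rule leibniz_rule_field_derivative)
    fix s t assume s: "s \<in> {-e<..<e}" and t: "t \<in> cbox 0 h"
    have "has_pd f i (\<alpha> t *\<^sub>R (x + s *\<^sub>R axis i 1) + \<beta> t)"
      using maps[OF xs[OF s]] t f(2) by simp
    note pd = pd_affine[OF this]
    have "((\<lambda>s. f (\<alpha> t *\<^sub>R (x + s *\<^sub>R axis i 1) + \<beta> t)) has_field_derivative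
        \<alpha> t * pd f i (\<alpha> t *\<^sub>R (x + s *\<^sub>R axis i 1) + \<beta> t)) (at s)"
      using has_pd_DERIV_line[of "\<lambda>x. f (\<alpha> t *\<^sub>R x + \<beta> t)" i x s, OF pd(1)] pd(2) by simp
    from DERIV_cmult[OF this, of "\<gamma> t"]
    show "((\<lambda>s. \<gamma> t * f (\<alpha> t *\<^sub>R (x + s *\<^sub>R axis i 1) + \<beta> t)) has_field_derivative
       \<gamma> t * \<alpha> t * pd f i (\<alpha> t *\<^sub>R (x + s *\<^sub>R axis i 1) + \<beta> t)) (at s within {-e<..<e})"
      by (simp add: mult.assoc has_field_derivative_at_within)
  next
    fix s assume s: "s \<in> {-e<..<e}"
    show "(\<lambda>t. \<gamma> t * f (\<alpha> t *\<^sub>R (x + s *\<^sub>R axis i 1) + \<beta> t)) integrable_on cbox 0 h"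
      using \<alpha> \<beta> \<gamma> maps[OF xs[OF s]]
      by (intro integrable_continuous continuous_intros continuous_on_compose2[OF f(1)]) auto
  next
    show "continuous_on ({-e<..<e} \<times> cbox 0 h)
        (\<lambda>(s, t). \<gamma> t * \<alpha> t * pd f i (\<alpha> t *\<^sub>R (x + s *\<^sub>R axis i 1) + \<beta> t))"
      unfolding split_beta
      by (intro continuous_intros continuous_on_compose2[OF f(3)] continuous_on_compose2[OF \<alpha>]
        continuous_on_compose2[OF \<beta>] continuous_on_compose2[OF \<gamma>])
        (use xs maps in auto)
  qed (use e in auto)
  then have "((\<lambda>s. integral {0..h} (\<lambda>t. \<gamma> t * f (\<alpha> t *\<^sub>R (x + s *\<^sub>R axis i 1) + \<beta> t))) has_field_derivative
     integral {0..h} (\<lambda>t. \<gamma> t * \<alpha> t * pd f i (\<alpha> t *\<^sub>R x + \<beta> t))) (at 0)"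
    using e by (simp add: at_within_open[of 0 "{-e<..<e}"])
  from pd_eqI[of "\<lambda>x. integral {0..h} (\<lambda>t. \<gamma> t * f (\<alpha> t *\<^sub>R x + \<beta> t))", OF this]
  show "has_pd (\<lambda>x. integral {0..h} (\<lambda>t. \<gamma> t * f (\<alpha> t *\<^sub>R x + \<beta> t))) i x"
    "pd (\<lambda>x. integral {0..h} (\<lambda>t. \<gamma> t * f (\<alpha> t *\<^sub>R x + \<beta> t))) i x
      = integral {0..h} (\<lambda>t. \<gamma> t * \<alpha> t * pd f i (\<alpha> t *\<^sub>R x + \<beta> t))" by auto
qed

lemma continuous_on_affine_integral:
  fixes f :: "R3 \<Rightarrow> real" and \<alpha> :: "real \<Rightarrow> real" and \<beta> :: "real \<Rightarrow> R3"
  assumes maps: "\<And>x t. x \<in> T \<Longrightarrow> t \<in> {0..h} \<Longrightarrow> \<alpha> t *\<^sub>R x + \<beta> t \<in> S"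
    and \<alpha>: "continuous_on {0..h} \<alpha>" and \<beta>: "continuous_on {0..h} \<beta>" and \<gamma>: "continuous_on {0..h} \<gamma>"
    and f: "continuous_on S f"
  shows "continuous_on T (\<lambda>x. integral {0..h} (\<lambda>t. \<gamma> t * f (\<alpha> t *\<^sub>R x + \<beta> t)))"
proof -
  have "continuous_on (T \<times> cbox 0 h) (\<lambda>(x, t). \<gamma> t * f (\<alpha> t *\<^sub>R x + \<beta> t))"
    unfolding split_beta
    by (intro continuous_intros continuous_on_compose2[OF f] continuous_on_compose2[OF \<alpha>]
        continuous_on_compose2[OF \<beta>] continuous_on_compose2[OF \<gamma>]) (auto simp: maps)
  from integral_continuous_on_param[OF this] show ?thesis by simp
qed

lemma Ck_affine_integral:
  fixes f :: "R3 \<Rightarrow> real" and \<alpha> :: "real \<Rightarrow> real" and \<beta> :: "real \<Rightarrow> R3"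
  assumes S: "open S" and T: "open T"
    and maps: "\<And>x t. x \<in> T \<Longrightarrow> t \<in> {0..h} \<Longrightarrow> \<alpha> t *\<^sub>R x + \<beta> t \<in> S"
    and \<alpha>: "continuous_on {0..h} \<alpha>" and \<beta>: "continuous_on {0..h} \<beta>" and \<gamma>: "continuous_on {0..h} \<gamma>"
    and f: "Ck k S f"
  shows "Ck k T (\<lambda>x. integral {0..h} (\<lambda>t. \<gamma> t * f (\<alpha> t *\<^sub>R x + \<beta> t)))"
  using f \<gamma>
\<comment> \<open>Each derivative multiplies the weight by \<open>\<alpha>\<close>, so the weight
  must be general in the induction.\<close>
proof (induction k arbitrary: f \<gamma>)
  case 0
  then show ?case using continuous_on_affine_integral[OF maps \<alpha> \<beta>] by simp
next
  case (Suc k)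
  let ?F = "\<lambda>x. integral {0..h} (\<lambda>t. \<gamma> t * f (\<alpha> t *\<^sub>R x + \<beta> t))"
  have c: "continuous_on S f" "continuous_on S (pd f i)" for i
    using Suc.prems by (auto intro: Ck_continuous_on)
  have pd: "has_pd ?F i x" "pd ?F i x = integral {0..h} (\<lambda>t. \<gamma> t * \<alpha> t * pd f i (\<alpha> t *\<^sub>R x + \<beta> t))"
    if "x \<in> T" for i x
    using pd_affine_integral[OF S T maps \<alpha> \<beta> _ c(1) _ c(2) that] Suc.prems by auto
  have "Ck k T (pd ?F i)" for i
    by (rule Ck_cong[OF T _ Suc.IH[of "pd f i" "\<lambda>t. \<gamma> t * \<alpha> t"]])
       (use pd Suc.prems \<alpha> in \<open>auto intro!: continuous_intros\<close>)
  then show ?case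
    using pd continuous_on_affine_integral[OF maps \<alpha> \<beta> Suc.prems(2) c(1)] by simp
qed

lemma Ck_affine:
  fixes f :: "R3 \<Rightarrow> real"
  assumes T: "open T" and maps: "\<And>x. x \<in> T \<Longrightarrow> a *\<^sub>R x + b \<in> S" and f: "Ck k S f"
  shows "Ck k T (\<lambda>x. f (a *\<^sub>R x + b))"
  using f
proof (induction k arbitrary: f)
  case 0
  then have "continuous_on S f" by simp
  then have "continuous_on T (\<lambda>x. f (a *\<^sub>R x + b))"
    by (rule continuous_on_compose2) (auto intro!: continuous_intros simp: maps)
  then show ?case by simp
next
  case (Suc k)
  have pd: "has_pd (\<lambda>x. f (a *\<^sub>R x + b)) i x" "pd (\<lambda>x. f (a *\<^sub>R x + b)) i x = a * pd f i (a *\<^sub>R x + b)"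
    if "x \<in> T" for i x
    using pd_affine[of f i a x b] Suc.prems maps[OF that] by auto
  have "Ck k T (pd (\<lambda>x. f (a *\<^sub>R x + b)) i)" for i
    by (rule Ck_cong[OF T _ Ck_cmult[OF T Suc.IH[of "pd f i"], of a]]) (use pd Suc.prems in auto)
  moreover have "continuous_on T (\<lambda>x. f (a *\<^sub>R x + b))"
    by (rule continuous_on_compose2[of S f]) (use Suc.prems in \<open>auto intro!: continuous_intros simp: maps\<close>)
  ultimately show ?case using pd by simp
qed

text \<open>The increment is split into three moves along the axes, each with error at most
  \<open>e / 3 * |h|\<close> by the mean value inequality. Increments shorter than
  \<open>d / 3\<close> keep the whole path in the ball of radius \<open>d\<close> where the partial
  derivatives vary by less than \<open>e / 3\<close>.\<close>

lemma Ck_has_derivative: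
  fixes f :: "R3 \<Rightarrow> real"
  assumes S: "open S" and f: "Ck 1 S f" and x: "x \<in> S"
  shows "(f has_derivative (\<lambda>h. \<Sum>i\<in>UNIV. h $ i * pd f i x)) (at x)"
proof -
  have cont: "continuous_on S (pd f i)" and has: "y \<in> S \<Longrightarrow> has_pd f i y" for i y
    using f unfolding One_nat_def by auto
  have "\<exists>d>0. \<forall>y. norm (y - x) < d \<longrightarrow>
      norm (f y - f x - (\<Sum>i\<in>UNIV. (y - x) $ i * pd f i x)) \<le> e * norm (y - x)" if e: "0 < e" for e
  proof -
    have "\<exists>d>0. ball x d \<subseteq> S \<and> (\<forall>i. \<forall>y\<in>ball x d. \<bar>pd f i y - pd f i x\<bar> < e / 3)"
    proof -
      have "\<exists>d>0. \<forall>y. dist y x < d \<longrightarrow> \<bar>pd f i y - pd f i x\<bar> < e / 3" for i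
      proof -
        have "isCont (pd f i) x" using cont S x by (simp add: continuous_on_eq_continuous_at)
        then show ?thesis unfolding continuous_at_eps_delta dist_real_def using e by (auto elim!: allE[of _ "e / 3"])
      qed
      then obtain d where d: "\<And>i. 0 < d i" "\<And>i y. dist y x < d i \<Longrightarrow> \<bar>pd f i y - pd f i x\<bar> < e / 3"
        by metis
      obtain d0 where d0: "0 < d0" "ball x d0 \<subseteq> S" using S x openE by blast
      define D where "D = min d0 (Min (range d))"
      have fin: "finite (range d)" "range d \<noteq> {}" by auto
      have "0 < D" using d0 d(1) fin by (auto simp: D_def)
      moreover have "D \<le> d i" for i using fin by (auto simp: D_def min.coboundedI2)
      then have "\<bar>pd f i y - pd f i x\<bar> < e / 3" if "y \<in> ball x D" for y i
        using d(2)[of y i] that by (smt (verit, ccfv_threshold) dist_commute mem_ball)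
      moreover have "ball x D \<subseteq> S" using d0 by (auto simp: D_def)
      ultimately show ?thesis by blast
    qed
    then obtain d where d: "0 < d" "ball x d \<subseteq> S" "\<And>i y. y \<in> ball x d \<Longrightarrow> \<bar>pd f i y - pd f i x\<bar> < e / 3"
      by blast
    have step: "\<bar>f (z + h *\<^sub>R axis i 1) - f z - h * pd f i x\<bar> \<le> e / 3 * \<bar>h\<bar>"
      if seg: "\<And>t. \<bar>t\<bar> \<le> \<bar>h\<bar> \<Longrightarrow> z + t *\<^sub>R axis i 1 \<in> ball x d" for z h i
    proof -
      let ?g = "\<lambda>t. f (z + t *\<^sub>R axis i 1) - t * pd f i x"
      have "norm (?g h - ?g 0) \<le> e / 3 * norm (h - 0)"
      proof (rule field_differentiable_bound[where S="{-\<bar>h\<bar>..\<bar>h\<bar>}" and f="?g"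
            and f'="\<lambda>t. pd f i (z + t *\<^sub>R axis i 1) - pd f i x"])
        fix t assume "t \<in> {-\<bar>h\<bar>..\<bar>h\<bar>}"
        then have t: "z + t *\<^sub>R axis i 1 \<in> ball x d" using seg by auto
        have "((\<lambda>t. f (z + t *\<^sub>R axis i 1)) has_field_derivative pd f i (z + t *\<^sub>R axis i 1)) (at t)"
          by (rule has_pd_DERIV_line, rule has) (use t d in auto)
        then show "(?g has_field_derivative pd f i (z + t *\<^sub>R axis i 1) - pd f i x) (at t within {-\<bar>h\<bar>..\<bar>h\<bar>})"
          by (auto intro!: derivative_eq_intros intro: has_field_derivative_at_within)
        show "norm (pd f i (z + t *\<^sub>R axis i 1) - pd f i x) \<le> e / 3" using d(3)[OF t, of i] by simp
      qed auto
      then show ?thesis by (simp add: algebra_simps)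
    qed
    have "norm (f y - f x - (\<Sum>i\<in>UNIV. (y - x) $ i * pd f i x)) \<le> e * norm (y - x)" if y: "norm (y - x) < d / 3" for y
    proof -
      define h where "h = y - x"
      have h: "\<bar>h $ i\<bar> \<le> norm h" for i by (rule component_le_norm_cart)
      have hd: "norm h < d / 3" using y by (simp add: h_def)
      define z1 where "z1 = x + h $ 1 *\<^sub>R axis 1 1"
      define z2 where "z2 = z1 + h $ 2 *\<^sub>R axis 2 1"
      have y_eq: "y = z2 + h $ 3 *\<^sub>R axis 3 1"
        by (simp add: vec_eq_iff forall_3 z1_def z2_def h_def axis_def)
      have in_ball: "x + a *\<^sub>R axis 1 1 + b *\<^sub>R axis 2 1 + c *\<^sub>R axis 3 1 \<in> ball x d"
        if "\<bar>a\<bar> \<le> norm h" "\<bar>b\<bar> \<le> norm h" "\<bar>c\<bar> \<le> norm h" for a b c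
      proof -
        have "norm (a *\<^sub>R axis 1 1 + b *\<^sub>R axis 2 1 + c *\<^sub>R axis 3 1 :: R3) \<le> \<bar>a\<bar> + \<bar>b\<bar> + \<bar>c\<bar>"
          by (intro norm_triangle_le add_mono) auto
        also have "\<dots> < d" using that hd by simp
        finally have "dist (x + (a *\<^sub>R axis 1 1 + b *\<^sub>R axis 2 1 + c *\<^sub>R axis 3 1)) x < d"
          unfolding dist_norm add_diff_cancel_left' .
        then show ?thesis by (simp add: add.assoc dist_commute)
      qed
      have 1: "\<bar>f z1 - f x - h $ 1 * pd f 1 x\<bar> \<le> e / 3 * \<bar>h $ 1\<bar>"
        unfolding z1_def
      proof (rule step)
        fix t assume "\<bar>t\<bar> \<le> \<bar>h $ 1\<bar>"
        then show "x + t *\<^sub>R axis 1 1 \<in> ball x d" using in_ball[of t 0 0] h[of 1] by simp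
      qed
      have 2: "\<bar>f z2 - f z1 - h $ 2 * pd f 2 x\<bar> \<le> e / 3 * \<bar>h $ 2\<bar>"
        unfolding z2_def
      proof (rule step)
        fix t assume "\<bar>t\<bar> \<le> \<bar>h $ 2\<bar>"
        then show "z1 + t *\<^sub>R axis 2 1 \<in> ball x d" using in_ball[of "h $ 1" t 0] h[of 1] h[of 2] by (simp add: z1_def)
      qed
      have 3: "\<bar>f y - f z2 - h $ 3 * pd f 3 x\<bar> \<le> e / 3 * \<bar>h $ 3\<bar>"
        unfolding y_eq
      proof (rule step)
        fix t assume "\<bar>t\<bar> \<le> \<bar>h $ 3\<bar>"
        then show "z2 + t *\<^sub>R axis 3 1 \<in> ball x d"
          using in_ball[of "h $ 1" "h $ 2" t] h[of 1] h[of 2] h[of 3] by (simp add: z1_def z2_def)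
      qed
      have le: "e / 3 * \<bar>h $ i\<bar> \<le> e / 3 * norm h" for i using h[of i] e by (intro mult_left_mono) auto
      have "\<bar>f y - f x - (h $ 1 * pd f 1 x + h $ 2 * pd f 2 x + h $ 3 * pd f 3 x)\<bar> \<le> e / 3 * norm h + e / 3 * norm h + e / 3 * norm h"
        using 1 2 3 le[of 1] le[of 2] le[of 3] by linarith
      then show ?thesis by (simp add: sum_3 h_def)
    qed
    then show ?thesis using d(1) by (intro exI[of _ "d / 3"]) auto
  qed
  moreover have "bounded_linear (\<lambda>h::R3. \<Sum>i\<in>UNIV. h $ i * pd f i x)"
    by (intro bounded_linear_sum bounded_linear_mult_const bounded_linear_vec_nth)
  ultimately show ?thesis
    unfolding has_derivative_at_alt by blast
qed

lemma Ck_DERIV_ray: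
  assumes S: "open S" and f: "Ck 1 S f" and x: "t *\<^sub>R x \<in> S"
  shows "((\<lambda>t. f (t *\<^sub>R x)) has_real_derivative (\<Sum>i\<in>UNIV. x $ i * pd f i (t *\<^sub>R x))) (at t)"
proof -
  have "((\<lambda>t. f (t *\<^sub>R x)) has_derivative (\<lambda>h. \<Sum>i\<in>UNIV. (h *\<^sub>R x) $ i * pd f i (t *\<^sub>R x))) (at t)"
    by (rule has_derivative_compose[where g=f and f="\<lambda>t. t *\<^sub>R x", OF _ Ck_has_derivative[OF S f x]])
       (auto intro!: derivative_eq_intros)
  moreover have "(\<lambda>h. \<Sum>i\<in>UNIV. (h *\<^sub>R x) $ i * pd f i (t *\<^sub>R x)) = (*) (\<Sum>i\<in>UNIV. x $ i * pd f i (t *\<^sub>R x))"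
    by (simp add: fun_eq_iff sum_distrib_left mult_ac)
  ultimately show ?thesis by (simp add: has_field_derivative_def)
qed

section \<open>Steklov averages\<close>

lemma integral_pd_segment:
  fixes f :: "R3 \<Rightarrow> real"
  assumes "0 \<le> h" "\<And>t. t \<in> {0..h} \<Longrightarrow> has_pd f i (x + t *\<^sub>R axis i 1)"
  shows "integral {0..h} (\<lambda>t. pd f i (x + t *\<^sub>R axis i 1)) = f (x + h *\<^sub>R axis i 1) - f x"
proof -
  have "((\<lambda>t. pd f i (x + t *\<^sub>R axis i 1)) has_integral
      (f (x + h *\<^sub>R axis i 1) - f (x + 0 *\<^sub>R axis i 1))) {0..h}"
    using assms
    by (intro fundamental_theorem_of_calculus)
       (auto simp: has_real_derivative_iff_has_vector_derivative[symmetric]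
         intro!: has_field_derivative_at_within has_pd_DERIV_line)
  then show ?thesis by (simp add: integral_unique)
qed

text \<open>The increment of \<open>f\<close> over a segment in direction \<open>i\<close> is the
  integral of \<open>pd f i\<close>. Differentiating in direction \<open>j\<close> under the
  integral and then in the length \<open>h\<close> of the segment at 0 yields both mixed
  derivatives.\<close>

lemma pd_commute:
  assumes S: "open S" and f: "Ck 2 S f" and x: "x \<in> S"
  shows "pd (pd f i) j x = pd (pd f j) i x"
proof -
  have f2: "Ck (Suc (Suc 0)) S f" using f by (simp add: numeral_2_eq_2)
  obtain e where e: "0 < e" "ball x e \<subseteq> S" using S x openE by blast
  define T where "T = ball x (e / 2)"
  define b where "b = e / 4"
  have b: "0 < b" "2 * b < e" using e by (auto simp: b_def)
  have maps: "1 *\<^sub>R y + t *\<^sub>R axis i 1 \<in> S" if "y \<in> T" "t \<in> {0..b}" for y t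
  proof -
    have "dist x (y + t *\<^sub>R axis i 1) \<le> dist x y + norm (t *\<^sub>R axis i 1 :: R3)"
      using dist_triangle[of x "y + t *\<^sub>R axis i 1" y] by (simp add: dist_norm)
    also have "\<dots> < e" using that e by (simp add: T_def b_def)
    finally show ?thesis using e by auto
  qed
  have TS: "y \<in> S" if "y \<in> T" for y using maps[OF that, of 0] b by simp
  have xT: "x \<in> T" using e by (simp add: T_def)
  let ?q = "\<lambda>t. pd (pd f i) j (x + t *\<^sub>R axis i 1)"
  have psi: "pd f j (x + h *\<^sub>R axis i 1) - pd f j x = integral {0..h} ?q" if h: "h \<in> {0..b}" for h
  proof -
    have eq: "integral {0..h} (\<lambda>t. 1 * pd f i (1 *\<^sub>R y + t *\<^sub>R axis i 1)) =
        1 * f (1 *\<^sub>R y + h *\<^sub>R axis i 1) + (- 1) * f y" if y: "y \<in> T" for y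
      using integral_pd_segment[of h f i y] h maps[OF y] f2 by simp
    have h1: "has_pd f j (1 *\<^sub>R x + h *\<^sub>R axis i 1)" "has_pd f j x"
      using f2 maps[OF xT h] x by auto
    have "pd (\<lambda>y. 1 * f (1 *\<^sub>R y + h *\<^sub>R axis i 1) + (- 1) * f y) j x
        = pd f j (x + h *\<^sub>R axis i 1) - pd f j x"
      using pd_lincomb(2)[OF pd_affine(1)[OF h1(1)] h1(2), of 1 "-1"] pd_affine(2)[OF h1(1)] by simp
    moreover have "pd (\<lambda>y. integral {0..h} (\<lambda>t. 1 * pd f i (1 *\<^sub>R y + t *\<^sub>R axis i 1))) j x
        = integral {0..h} (\<lambda>t. 1 * 1 * pd (pd f i) j (1 *\<^sub>R x + t *\<^sub>R axis i 1))"
      by (rule pd_affine_integral(2)[OF S, of T])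
         (use maps h f2 xT in \<open>auto simp: T_def intro!: continuous_intros\<close>)
    moreover have "pd (\<lambda>y. integral {0..h} (\<lambda>t. 1 * pd f i (1 *\<^sub>R y + t *\<^sub>R axis i 1))) j x
       = pd (\<lambda>y. 1 * f (1 *\<^sub>R y + h *\<^sub>R axis i 1) + (- 1) * f y) j x"
      by (rule pd_cong(2)[OF _ xT eq]) (auto simp: T_def)
    ultimately show ?thesis by simp
  qed
  have "continuous_on {0..b} ?q"
    by (rule continuous_on_compose2[of S "pd (pd f i) j"])
       (use maps[OF xT] f2 in \<open>auto intro!: continuous_intros\<close>)
  then have "((\<lambda>h. integral {0..h} ?q) has_real_derivative ?q 0) (at 0 within {0..b})"
    using b by (intro integral_has_real_derivative) auto
  then have "((\<lambda>h. pd f j (x + h *\<^sub>R axis i 1) - pd f j x) has_real_derivative ?q 0) (at 0 within {0..b})"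
    by (rule has_field_derivative_transform_within[OF _ zero_less_one]) (use psi b in auto)
  moreover have "((\<lambda>h. pd f j (x + h *\<^sub>R axis i 1) - pd f j x) has_real_derivative pd (pd f j) i x) (at 0 within {0..b})"
    using f2 x by (auto intro!: derivative_eq_intros has_field_derivative_at_within[OF has_pd_DERIV])
  \<comment> \<open>The segment has nonnegative length, so both derivatives are compared as
    one-sided ones; these are unique at an end point of a nondegenerate interval.\<close>
  ultimately have "?q 0 = pd (pd f j) i x"
    using b by (intro vector_derivative_unique_within[of 0 "{0..b}"])
      (auto simp: has_real_derivative_iff_has_vector_derivative at_within_Icc_at_right trivial_limit_at_right_real)
  then show ?thesis by simp
qed

text \<open>Average over the segment of length \<open>h\<close> starting at \<open>x\<close> in
  direction \<open>i\<close>. Values on the ball of radius \<open>R\<close> involve the function on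
  radius \<open>R + h\<close>, so every average costs \<open>h\<close> of the domain.\<close>

definition steklov :: "3 \<Rightarrow> real \<Rightarrow> (R3 \<Rightarrow> real) \<Rightarrow> R3 \<Rightarrow> real" where
  "steklov i h f x = integral {0..h} (\<lambda>t. inverse h * f (1 *\<^sub>R x + t *\<^sub>R axis i 1))"

context
  fixes h R :: real
  assumes h: "0 < h"
begin

lemma steklov_maps: "x \<in> ball 0 R \<Longrightarrow> t \<in> {0..h} \<Longrightarrow> 1 *\<^sub>R x + t *\<^sub>R axis i 1 \<in> ball (0::R3) (R + h)"
  using norm_triangle_ineq[of x "t *\<^sub>R axis i 1"] by simp

lemma Ck_steklov:
  "Ck k (ball 0 (R + h)) f \<Longrightarrow> Ck k (ball 0 R) (steklov i h f)"
  unfolding steklov_def[abs_def]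
  by (rule Ck_affine_integral[of "ball 0 (R + h)" _ _ "\<lambda>_. 1"])
     (use steklov_maps in \<open>auto intro!: continuous_intros\<close>)

lemma pd_steklov:
  assumes "continuous_on (ball 0 (R + h)) f" "\<And>x. x \<in> ball 0 (R + h) \<Longrightarrow> has_pd f j x"
    "continuous_on (ball 0 (R + h)) (pd f j)" "x \<in> ball 0 R"
  shows "has_pd (steklov i h f) j x" "pd (steklov i h f) j x = steklov i h (pd f j) x"
proof -
  have c: "continuous_on {0..h} (\<lambda>_. 1 :: real)" "continuous_on {0..h} (\<lambda>t. t *\<^sub>R axis i 1 :: R3)"
      "continuous_on {0..h} (\<lambda>_. inverse h)"
    by (auto intro!: continuous_intros)
  note * = pd_affine_integral[OF open_ball open_ball steklov_maps c assms]
  show "has_pd (steklov i h f) j x" "pd (steklov i h f) j x = steklov i h (pd f j) x"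
    using * unfolding steklov_def[abs_def] mult_1_right by auto
qed

lemma Ck_pd_steklov:
  assumes "continuous_on (ball 0 (R + h)) f" "\<And>x. x \<in> ball 0 (R + h) \<Longrightarrow> has_pd f j x"
    "Ck k (ball 0 (R + h)) (pd f j)"
  shows "Ck k (ball 0 R) (pd (steklov i h f) j)"
  by (rule Ck_cong[OF _ _ Ck_steklov[OF assms(3), of i]])
     (use pd_steklov[OF assms(1,2)] Ck_continuous_on[OF assms(3)] in auto)

text \<open>Along direction \<open>i\<close> the average is a difference of values of a primitive of
  \<open>f\<close>, so it is differentiable for merely continuous \<open>f\<close>. This is the
  source of the gain in smoothness.\<close>

lemma pd_steklov_self:
  assumes f: "continuous_on (ball 0 (R + h)) f" and x: "x \<in> ball 0 R"
  shows "has_pd (steklov i h f) i x"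
    "pd (steklov i h f) i x = inverse h * (f (1 *\<^sub>R x + h *\<^sub>R axis i 1) - f x)"
proof -
  \<comment> \<open>Room on both sides: the primitive starts at \<open>-e\<close> and runs to
    \<open>h + e\<close>, so that 0 and \<open>h\<close> are interior points.\<close>
  define e where "e = (R - norm x) / 2"
  have e: "0 < e" "norm x + e < R" using x by (auto simp: e_def field_simps)
  let ?p = "\<lambda>\<tau>. f (x + \<tau> *\<^sub>R axis i 1)"
  have pc: "continuous_on {-e..h + e} ?p"
  proof (rule continuous_on_compose2[OF f])
    show "(\<lambda>\<tau>. x + \<tau> *\<^sub>R axis i 1) ` {-e..h + e} \<subseteq> ball 0 (R + h)"
    proof clarify
      fix \<tau> assume "\<tau> \<in> {-e..h + e}"
      then have "\<bar>\<tau>\<bar> \<le> h + e" using h by auto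
      moreover have "norm (x + \<tau> *\<^sub>R axis i 1) \<le> norm x + \<bar>\<tau>\<bar>"
        using norm_triangle_ineq[of x "\<tau> *\<^sub>R axis i 1"] by simp
      ultimately show "x + \<tau> *\<^sub>R axis i 1 \<in> ball 0 (R + h)" using e by simp
    qed
  qed (auto intro!: continuous_intros)
  let ?P = "\<lambda>y. integral {-e..y} ?p"
  have P: "(?P has_real_derivative ?p y) (at y)" if "y \<in> {-e<..<h + e}" for y
  proof -
    have "(?P has_real_derivative ?p y) (at y within {-e..h + e})"
      using that by (intro integral_has_real_derivative pc) auto
    then have "(?P has_real_derivative ?p y) (at y within {-e<..<h + e})"
      by (rule DERIV_subset) auto
    then show ?thesis using that at_within_open[of y "{-e<..<h + e}"] by simp
  qed
  have eq: "steklov i h f (x + s *\<^sub>R axis i 1) = inverse h * (?P (s + h) - ?P s)" if s: "s \<in> {-e<..<e}" for s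
  proof -
    have int: "?p integrable_on {-e..s + h}"
      using s by (intro integrable_continuous_interval continuous_on_subset[OF pc]) auto
    have "integral {0..h} (\<lambda>t. ?p (t + s)) = integral {s..s + h} ?p"
      using integral_shift_real_ivl[where a=s and c=s and b="s + h" and f="?p"] by simp
    also have "\<dots> = ?P (s + h) - ?P s"
      using Henstock_Kurzweil_Integration.integral_combine[where a="-e" and c=s and b="s + h" and f="?p"] s h int by simp
    finally have "integral {0..h} (\<lambda>t. ?p (t + s)) = ?P (s + h) - ?P s" .
    moreover have "steklov i h f (x + s *\<^sub>R axis i 1) = inverse h * integral {0..h} (\<lambda>t. ?p (t + s))"
      by (simp add: steklov_def scaleR_left_distrib add_ac)
    ultimately show ?thesis by simp
  qed
  have P1: "((\<lambda>s. ?P (s + h)) has_real_derivative ?p h) (at 0)"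
    using P[of h] DERIV_shift[of ?P "?p h" 0 h] e h by simp
  have P0: "(?P has_real_derivative ?p 0) (at 0)" using P[of 0] e h by simp
  have "((\<lambda>s. inverse h * (?P (s + h) - ?P s)) has_real_derivative inverse h * (?p h - ?p 0)) (at 0)"
    by (rule DERIV_cmult[OF DERIV_diff[OF P1 P0]])
  then have "((\<lambda>s. steklov i h f (x + s *\<^sub>R axis i 1)) has_real_derivative inverse h * (?p h - ?p 0)) (at 0)"
  proof (rule has_field_derivative_transform_within_open[where S="{-e<..<e}"])
    show "inverse h * (?P (s + h) - ?P s) = steklov i h f (x + s *\<^sub>R axis i 1)" if "s \<in> {-e<..<e}" for s
      using eq[OF that] by simp
  qed (use e in auto)
  from pd_eqI[OF this] show "has_pd (steklov i h f) i x"
    "pd (steklov i h f) i x = inverse h * (f (1 *\<^sub>R x + h *\<^sub>R axis i 1) - f x)" by auto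
qed

lemma Ck_pd_steklov_self:
  assumes f: "Ck k (ball 0 (R + h)) f"
  shows "Ck k (ball 0 R) (pd (steklov i h f) i)"
proof (rule Ck_cong[OF open_ball])
  show "inverse h * (f (1 *\<^sub>R x + h *\<^sub>R axis i 1) - f x) = pd (steklov i h f) i x" if "x \<in> ball 0 R" for x
    using pd_steklov_self(2)[OF Ck_continuous_on[OF f] that] by simp
  have "Ck k (ball 0 R) f" by (rule Ck_subset[OF f]) (use h in auto)
  then show "Ck k (ball 0 R) (\<lambda>x. inverse h * (f (1 *\<^sub>R x + h *\<^sub>R axis i 1) - f x))"
    by (intro Ck_cmult Ck_diff open_ball Ck_affine[OF open_ball _ f] steklov_maps) (use h in auto)
qed

lemma steklov_near:
  assumes f: "continuous_on (ball 0 (R + h)) f" and x: "x \<in> ball 0 R"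
    and c: "\<And>t. t \<in> {0..h} \<Longrightarrow> \<bar>f (x + t *\<^sub>R axis i 1) - c\<bar> \<le> e"
  shows "\<bar>steklov i h f x - c\<bar> \<le> e"
proof -
  have cont: "continuous_on {0..h} (\<lambda>t. f (x + t *\<^sub>R axis i 1))"
    by (rule continuous_on_compose2[OF f]) (use steklov_maps[OF x, of _ i] in \<open>auto intro!: continuous_intros\<close>)
  have int: "(\<lambda>t. inverse h * f (x + t *\<^sub>R axis i 1)) integrable_on {0..h}"
    by (intro integrable_continuous_interval continuous_intros cont)
  have "integral {0..h} (\<lambda>t. inverse h * (f (x + t *\<^sub>R axis i 1) - c))
     = integral {0..h} (\<lambda>t. inverse h * f (x + t *\<^sub>R axis i 1)) - integral {0..h} (\<lambda>t. inverse h * c)"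
    unfolding right_diff_distrib by (rule integral_diff[OF int]) (rule integrable_const_ivl)
  also have "\<dots> = steklov i h f x - c" using h by (simp add: steklov_def)
  finally have eq: "steklov i h f x - c = integral {0..h} (\<lambda>t. inverse h * (f (x + t *\<^sub>R axis i 1) - c))" by simp
  have "norm (integral {0..h} (\<lambda>t. inverse h * (f (x + t *\<^sub>R axis i 1) - c))) \<le> (inverse h * e) * (h - 0)"
  proof (rule integral_bound)
    show "continuous_on {0..h} (\<lambda>t. inverse h * (f (x + t *\<^sub>R axis i 1) - c))" by (intro continuous_intros cont)
    show "norm (inverse h * (f (x + t *\<^sub>R axis i 1) - c)) \<le> inverse h * e" if "t \<in> {0..h}" for t
      using c[OF that] h by (simp add: abs_mult)
  qed (use h in auto)
  then show ?thesis unfolding eq using h by (simp add: field_simps)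
qed

end

context
  fixes h R :: real
  assumes h: "0 < h"
begin

lemma steklov_integrable:
  fixes x :: R3
  assumes f: "continuous_on (ball 0 (R + h)) f" and x: "x \<in> ball 0 R"
  shows "(\<lambda>t. inverse h * f (1 *\<^sub>R x + t *\<^sub>R axis i 1)) integrable_on {0..h}"
proof -
  have cont: "continuous_on {0..h} (\<lambda>t. f (1 *\<^sub>R x + t *\<^sub>R axis i 1))"
    by (rule continuous_on_compose2[OF f]) (use steklov_maps[OF h x, of _ i] in \<open>auto intro!: continuous_intros\<close>)
  then show ?thesis by (intro integrable_continuous_interval continuous_intros)
qed

lemma steklov_lincomb:
  assumes "continuous_on (ball 0 (R + h)) f" "continuous_on (ball 0 (R + h)) g" "x \<in> ball 0 R"
  shows "steklov i h (\<lambda>x. a * f x + b * g x) x = a * steklov i h f x + b * steklov i h g x"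
proof -
  let ?z = "\<lambda>t. 1 *\<^sub>R x + t *\<^sub>R axis i 1"
  have "steklov i h (\<lambda>x. a * f x + b * g x) x
      = integral {0..h} (\<lambda>t. a * (inverse h * f (?z t)) + b * (inverse h * g (?z t)))"
    by (simp add: steklov_def algebra_simps)
  also have "\<dots> = integral {0..h} (\<lambda>t. a * (inverse h * f (?z t))) + integral {0..h} (\<lambda>t. b * (inverse h * g (?z t)))"
    by (intro integral_add integrable_on_mult_right steklov_integrable assms)
  also have "\<dots> = a * steklov i h f x + b * steklov i h g x"
    unfolding steklov_def integral_mult_right ..
  finally show ?thesis .
qed

lemma steklov_sum:
  assumes "finite I" "\<And>j. j \<in> I \<Longrightarrow> continuous_on (ball 0 (R + h)) (f j)" "x \<in> ball 0 R"
  shows "steklov i h (\<lambda>x. \<Sum>j\<in>I. f j x) x = (\<Sum>j\<in>I. steklov i h (f j) x)"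
  unfolding steklov_def sum_distrib_left
  by (rule integral_sum[OF assms(1)], rule steklov_integrable) (use assms in auto)

lemma pd2_steklov:
  assumes f: "Ck 2 (ball 0 (R + h)) f" and x: "x \<in> ball 0 R"
  shows "pd (pd (steklov a h f) i) j x = steklov a h (pd (pd f i) j) x"
proof -
  have f2: "Ck (Suc (Suc 0)) (ball 0 (R + h)) f" using f by (simp add: numeral_2_eq_2)
  have "pd (pd (steklov a h f) i) j x = pd (steklov a h (pd f i)) j x"
    by (rule pd_cong(2)[OF open_ball x], rule pd_steklov(2)[OF h]) (use f2 in auto)
  also have "\<dots> = steklov a h (pd (pd f i) j) x"
    by (rule pd_steklov(2)[OF h _ _ _ x]) (use f2 in auto)
  finally show ?thesis .
qed

end

text \<open>The equation by components, as a pure identity between second derivatives; regularity is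
  carried separately by \<open>Ck\<close>, which suits operations that alter it.\<close>

definition lame_system :: "real \<Rightarrow> real \<Rightarrow> R3 set \<Rightarrow> (3 \<Rightarrow> R3 \<Rightarrow> real) \<Rightarrow> bool" where
  "lame_system \<mu> lam S u \<longleftrightarrow> (\<forall>k. \<forall>x\<in>S.
     \<mu> * (\<Sum>i\<in>UNIV. pd (pd (u k) i) i x) + (lam + \<mu>) * (\<Sum>j\<in>UNIV. pd (pd (u j) j) k x) = 0)"

text \<open>The coefficients are constant and averaging is linear and commutes with second
  derivatives, so the average of the left-hand side is the left-hand side of the average.\<close>

lemma lame_system_steklov:
  assumes h: "0 < h" and u: "\<And>k. Ck 2 (ball 0 (R + h)) (u k)" and lame: "lame_system \<mu> lam (ball 0 (R + h)) u"
  shows "lame_system \<mu> lam (ball 0 R) (\<lambda>k. steklov a h (u k))"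
  unfolding lame_system_def
proof (intro allI ballI)
  fix k and x :: R3 assume x: "x \<in> ball 0 R"
  have c: "continuous_on (ball 0 (R + h)) (pd (pd (u k) i) j)" for i j k
    using u[of k] by (auto simp: numeral_2_eq_2)
  have "\<mu> * (\<Sum>i\<in>UNIV. pd (pd (steklov a h (u k)) i) i x)
      + (lam + \<mu>) * (\<Sum>j\<in>UNIV. pd (pd (steklov a h (u j)) j) k x)
    = \<mu> * (\<Sum>i\<in>UNIV. steklov a h (pd (pd (u k) i) i) x)
      + (lam + \<mu>) * (\<Sum>j\<in>UNIV. steklov a h (pd (pd (u j) j) k) x)"
    by (simp add: pd2_steklov[OF h u x])
  also have "\<dots> = \<mu> * steklov a h (\<lambda>x. \<Sum>i\<in>UNIV. pd (pd (u k) i) i x) x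
      + (lam + \<mu>) * steklov a h (\<lambda>x. \<Sum>j\<in>UNIV. pd (pd (u j) j) k x) x"
    by (simp add: steklov_sum[OF h _ c x])
  also have "\<dots> = steklov a h (\<lambda>x. \<mu> * (\<Sum>i\<in>UNIV. pd (pd (u k) i) i x)
      + (lam + \<mu>) * (\<Sum>j\<in>UNIV. pd (pd (u j) j) k x)) x"
    by (rule steklov_lincomb[OF h _ _ x, symmetric]) (intro continuous_on_sum c)+
  also have "\<dots> = integral {0..h} (\<lambda>t. inverse h * 0)"
    unfolding steklov_def
  proof (rule integral_cong)
    fix t assume "t \<in> {0..h}"
    from steklov_maps[OF h x this, of a] lame
    have "\<mu> * (\<Sum>i\<in>UNIV. pd (pd (u k) i) i (1 *\<^sub>R x + t *\<^sub>R axis a 1)) +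
        (lam + \<mu>) * (\<Sum>j\<in>UNIV. pd (pd (u j) j) k (1 *\<^sub>R x + t *\<^sub>R axis a 1)) = 0"
      unfolding lame_system_def by blast
    then show "inverse h * (\<mu> * (\<Sum>i\<in>UNIV. pd (pd (u k) i) i (1 *\<^sub>R x + t *\<^sub>R axis a 1)) +
        (lam + \<mu>) * (\<Sum>j\<in>UNIV. pd (pd (u j) j) k (1 *\<^sub>R x + t *\<^sub>R axis a 1))) = inverse h * 0"
      by (simp only:)
  qed
  finally show "\<mu> * (\<Sum>i\<in>UNIV. pd (pd (steklov a h (u k)) i) i x)
      + (lam + \<mu>) * (\<Sum>j\<in>UNIV. pd (pd (steklov a h (u j)) j) k x) = 0" by simp
qed

definition mollify :: "real \<Rightarrow> (R3 \<Rightarrow> real) \<Rightarrow> R3 \<Rightarrow> real" where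
  "mollify h f = steklov 1 h (steklov 2 h (steklov 3 h f))"

text \<open>The derivative in each direction is supplied by the average in that same direction; for
  directions 2 and 3 the derivative is first moved inside the outer averages, which preserve C^k.
  Thus three averages gain one full order.\<close>

lemma Ck_mollify:
  assumes h: "0 < h" and f: "Ck k (ball 0 (R + h + h + h)) f"
  shows "Ck (Suc k) (ball 0 R) (mollify h f)"
proof -
  define g3 where "g3 = steklov 3 h f"
  define g2 where "g2 = steklov 2 h g3"
  define g1 where "g1 = steklov 1 h g2"
  have k3: "Ck k (ball 0 (R + h + h)) g3" unfolding g3_def by (rule Ck_steklov[OF h f])
  have k2: "Ck k (ball 0 (R + h)) g2" unfolding g2_def by (rule Ck_steklov[OF h k3])
  have k1: "Ck k (ball 0 R) g1" unfolding g1_def by (rule Ck_steklov[OF h k2])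
  note c = Ck_continuous_on
  have d1: "\<forall>x\<in>ball 0 R. has_pd g1 1 x" "Ck k (ball 0 R) (pd g1 1)"
    unfolding g1_def using pd_steklov_self(1)[OF h c[OF k2]] Ck_pd_steklov_self[OF h k2] by auto
  have p2: "has_pd g2 2 x" if "x \<in> ball 0 (R + h)" for x
    unfolding g2_def using pd_steklov_self(1)[OF h c[OF k3] that] .
  have q2: "Ck k (ball 0 (R + h)) (pd g2 2)"
    unfolding g2_def by (rule Ck_pd_steklov_self[OF h k3])
  have d2: "\<forall>x\<in>ball 0 R. has_pd g1 2 x" "Ck k (ball 0 R) (pd g1 2)"
    unfolding g1_def using pd_steklov(1)[OF h c[OF k2] p2 c[OF q2]] Ck_pd_steklov[OF h c[OF k2] p2 q2] by auto
  have p3: "has_pd g3 3 x" if "x \<in> ball 0 (R + h + h)" for x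
    unfolding g3_def using pd_steklov_self(1)[OF h c[OF f] that] .
  have q3: "Ck k (ball 0 (R + h + h)) (pd g3 3)"
    unfolding g3_def by (rule Ck_pd_steklov_self[OF h f])
  have p23: "has_pd g2 3 x" if "x \<in> ball 0 (R + h)" for x
    unfolding g2_def using pd_steklov(1)[OF h c[OF k3] p3 c[OF q3] that] .
  have q23: "Ck k (ball 0 (R + h)) (pd g2 3)"
    unfolding g2_def by (rule Ck_pd_steklov[OF h c[OF k3] p3 q3])
  have d3: "\<forall>x\<in>ball 0 R. has_pd g1 3 x" "Ck k (ball 0 R) (pd g1 3)"
    unfolding g1_def using pd_steklov(1)[OF h c[OF k2] p23 c[OF q23]] Ck_pd_steklov[OF h c[OF k2] p23 q23] by auto
  have "mollify h f = g1" by (simp add: mollify_def g1_def g2_def g3_def)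
  then show ?thesis using d1 d2 d3 c[OF k1] by (simp add: forall_3)
qed

lemma mollify_near:
  assumes h: "0 < h" and f: "continuous_on (ball 0 (R + h + h + h)) f" and x: "x \<in> ball 0 R"
    and c: "\<And>y. norm (y - x) \<le> 3 * h \<Longrightarrow> \<bar>f y - c\<bar> \<le> e"
  shows "\<bar>mollify h f x - c\<bar> \<le> e"
proof -
  note Ck0 = Ck_steklov[OF h, of 0, unfolded Ck.simps]
  note f3 = Ck0[OF f, of 3] and f2 = Ck0[OF Ck0[OF f, of 3], of 2]
  have b: "y + t *\<^sub>R axis i 1 \<in> ball 0 (S + h)" if "y \<in> ball 0 S" "t \<in> {0..h}" for y :: R3 and t S i
    using steklov_maps[OF h that, of i] by simp
  show ?thesis
    unfolding mollify_def
  proof (rule steklov_near[OF h f2 x])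
    fix t1 assume t1: "t1 \<in> {0..h}"
    show "\<bar>steklov 2 h (steklov 3 h f) (x + t1 *\<^sub>R axis 1 1) - c\<bar> \<le> e"
    proof (rule steklov_near[OF h f3 b[OF x t1]])
      fix t2 assume t2: "t2 \<in> {0..h}"
      show "\<bar>steklov 3 h f (x + t1 *\<^sub>R axis 1 1 + t2 *\<^sub>R axis 2 1) - c\<bar> \<le> e"
      proof (rule steklov_near[OF h f b[OF b[OF x t1] t2]])
        fix t3 assume t3: "t3 \<in> {0..h}"
        have "norm (t1 *\<^sub>R axis 1 1 + t2 *\<^sub>R axis 2 1 + t3 *\<^sub>R axis 3 1 :: R3) \<le> \<bar>t1\<bar> + \<bar>t2\<bar> + \<bar>t3\<bar>"
          by (intro norm_triangle_le add_mono) auto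
        also have "\<dots> \<le> 3 * h" using t1 t2 t3 by auto
        finally show "\<bar>f (x + t1 *\<^sub>R axis 1 1 + t2 *\<^sub>R axis 2 1 + t3 *\<^sub>R axis 3 1) - c\<bar> \<le> e"
          by (intro c) (simp add: add.assoc)
      qed
    qed
  qed
qed

lemma lame_system_mollify:
  assumes h: "0 < h" and u: "\<And>k. Ck 2 (ball 0 (R + h + h + h)) (u k)"
    and lame: "lame_system \<mu> lam (ball 0 (R + h + h + h)) u"
  shows "lame_system \<mu> lam (ball 0 R) (\<lambda>k. mollify h (u k))"
  unfolding mollify_def
  by (intro lame_system_steklov[OF h] Ck_steklov[OF h] u lame)

section \<open>Splitting a solution into a harmonic field and a potential\<close>

text \<open>The region is convex and contains 0, so it contains the whole ray segment along which
  the equation for the gradient of \<open>\<psi>\<close> is integrated.\<close>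

lemma Gamma_scale:
  assumes x: "x \<in> Gamma \<xi>" and t: "0 \<le> t" "t \<le> 1"
  shows "t *\<^sub>R x \<in> Gamma \<xi>"
proof -
  have "convex (Gamma \<xi>)" unfolding Gamma_def by (intro convex_Int convex_ball convex_convex_hull)
  moreover have "0 \<in> Gamma \<xi>" unfolding Gamma_def by (auto intro!: hull_inc)
  ultimately have "(1 - t) *\<^sub>R 0 + t *\<^sub>R x \<in> Gamma \<xi>"
    using x t by (intro convexD) auto
  then show ?thesis by simp
qed

lemma pd_one_minus_norm2:
  "has_pd (\<lambda>x. 1 - (norm x)\<^sup>2) i x" "pd (\<lambda>x. 1 - (norm x)\<^sup>2) i x = - 2 * x $ i"
proof -
  have "((\<lambda>t. 1 - (norm (x + t *\<^sub>R axis i 1))\<^sup>2) has_real_derivative - 2 * x $ i) (at 0)"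
    using DERIV_diff[OF DERIV_const DERIV_norm_power2_line, of 1 x i] by simp
  from pd_eqI[of "\<lambda>x. 1 - (norm x)\<^sup>2", OF this]
  show "has_pd (\<lambda>x. 1 - (norm x)\<^sup>2) i x" "pd (\<lambda>x. 1 - (norm x)\<^sup>2) i x = - 2 * x $ i" by auto
qed

lemma Ck_one_minus_norm2: "Ck k UNIV (\<lambda>x::R3. 1 - (norm x)\<^sup>2)"
proof (rule Ck_cong[OF open_UNIV])
  show "Ck k UNIV (\<lambda>x::R3. 1 - (\<Sum>i\<in>UNIV. x $ i * x $ i))"
    by (intro Ck_diff Ck_const Ck_sum Ck_mult Ck_nth open_UNIV)
  show "1 - (\<Sum>i\<in>UNIV. x $ i * x $ i) = 1 - (norm x)\<^sup>2" for x :: R3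
    unfolding power2_norm_eq_inner by (simp add: inner_vec_def)
qed

lemma pd_nth: "has_pd (\<lambda>x::R3. x $ j) i x" "pd (\<lambda>x::R3. x $ j) i x = (if j = i then 1 else 0)"
  using pd_eqI[OF DERIV_nth_line[of x i j]] by auto

text \<open>Summed over \<open>i\<close>, this says that the Laplacian commutes with
  \<open>pd k\<close> (left form) and that it equals the k-th derivative of a divergence-type sum
  (right form).\<close>

lemma pd3_commute:
  assumes S: "open S" and f: "Ck 3 S f" and x: "x \<in> S"
  shows "pd (pd (pd f k) i) i x = pd (pd (pd f i) i) k x"
proof -
  have f3: "Ck (Suc 2) S f" using f by (simp add: eval_nat_numeral)
  have f2: "Ck 2 S f" using f by (rule Ck_mono) simp
  have "pd (pd (pd f k) i) i x = pd (pd (pd f i) k) i x"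
    by (rule pd_cong(2)[OF S x], rule pd_commute[OF S f2])
  also have "\<dots> = pd (pd (pd f i) i) k x"
    by (rule pd_commute[OF S Ck_SucD(2)[OF f3] x])
  finally show ?thesis .
qed

definition euler :: "(R3 \<Rightarrow> real) \<Rightarrow> R3 \<Rightarrow> real" where
  "euler f x = (\<Sum>i\<in>UNIV. x $ i * pd f i x)"

text \<open>The commutator relation of \<open>pd k\<close> with the radial derivative. It turns
  \<open>2 * \<psi> + 4 * euler \<psi>\<close> into
  \<open>6 * pd \<psi> k + 4 * euler (pd \<psi> k)\<close>.\<close>

lemma pd_euler:
  assumes S: "open S" and f: "Ck 2 S f" and x: "x \<in> S"
  shows "has_pd (euler f) k x" "pd (euler f) k x = pd f k x + euler (pd f k) x"
proof -
  have f2: "Ck (Suc (Suc 0)) S f" using f by (simp add: numeral_2_eq_2)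
  have h: "has_pd (\<lambda>x. x $ i * pd f i x) k x"
    "pd (\<lambda>x. x $ i * pd f i x) k x = (if i = k then 1 else 0) * pd f i x + x $ i * pd (pd f i) k x" for i
    using pd_mult[OF pd_nth(1), of "pd f i" k x i] f2 x pd_nth(2)[of i k x] by auto
  show "has_pd (euler f) k x"
    unfolding euler_def[abs_def] by (rule pd_sum(1)) (rule h(1))
  have "pd (euler f) k x = (\<Sum>i\<in>UNIV. (if i = k then 1 else 0) * pd f i x + x $ i * pd (pd f i) k x)"
    unfolding euler_def[abs_def] by (subst pd_sum(2)) (auto simp: h)
  also have "\<dots> = pd f k x + (\<Sum>i\<in>UNIV. x $ i * pd (pd f i) k x)"
    by (simp add: sum.distrib if_distrib[of "\<lambda>z. z * _"] sum.delta cong: if_cong)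
  also have "(\<Sum>i\<in>UNIV. x $ i * pd (pd f i) k x) = euler (pd f k) x"
    unfolding euler_def using pd_commute[OF S f x] by simp
  finally show "pd (euler f) k x = pd f k x + euler (pd f k) x" .
qed

text \<open>Solves \<open>2 f + 4 euler f = c D\<close>: the substitution \<open>t = s\<^sup>2\<close> removes the weight \<open>t\<^sup>-\<^sup>1\<^sup>/\<^sup>2\<close> of the
  variation of constants formula.\<close>

definition potential :: "real \<Rightarrow> (R3 \<Rightarrow> real) \<Rightarrow> R3 \<Rightarrow> real" where
  "potential c D x = integral {0..1} (\<lambda>s. c / 2 * D (s\<^sup>2 *\<^sub>R x + 0))"

context
  fixes R c :: real and D :: "R3 \<Rightarrow> real"
  assumes D: "Ck 3 (ball 0 R) D"
begin

lemma potential_maps: "x \<in> ball 0 R \<Longrightarrow> s \<in> {0..1} \<Longrightarrow> s\<^sup>2 *\<^sub>R x + 0 \<in> ball (0::R3) R"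
proof -
  assume "x \<in> ball 0 R" and s: "s \<in> {0..1}"
  moreover have "s\<^sup>2 * norm x \<le> 1 * norm x"
    using s by (intro mult_right_mono) (auto simp: power_le_one)
  ultimately show ?thesis by simp
qed

lemma Ck_potential: "Ck 3 (ball 0 R) (potential c D)"
  unfolding potential_def[abs_def]
  by (rule Ck_affine_integral[OF open_ball open_ball potential_maps _ _ _ D])
     (auto intro!: continuous_intros)

lemma pd_weighted_integral:
  assumes g: "Ck 1 (ball 0 R) g" and x: "x \<in> ball 0 R" and w: "continuous_on {0..1} w"
  shows "pd (\<lambda>x. integral {0..1} (\<lambda>s. w s * g (s\<^sup>2 *\<^sub>R x + 0))) i x
    = integral {0..1} (\<lambda>s. w s * s\<^sup>2 * pd g i (s\<^sup>2 *\<^sub>R x + 0))"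
  by (rule pd_affine_integral(2)[OF open_ball open_ball potential_maps _ _ w _ _ _ x])
     (use g in \<open>auto intro!: continuous_intros simp: Ck_continuous_on\<close>)

lemma pd_potential:
  assumes x: "x \<in> ball 0 R"
  shows "pd (potential c D) i x = integral {0..1} (\<lambda>s. c / 2 * s\<^sup>2 * pd D i (s\<^sup>2 *\<^sub>R x + 0))"
  unfolding potential_def[abs_def]
  by (rule pd_weighted_integral[OF Ck_mono[OF D] x]) (auto intro!: continuous_intros)

text \<open>Dilations preserve harmonicity: under the integral, each second derivative of
  \<open>D\<close> acquires the same factor \<open>s^4\<close>.\<close>

lemma laplace_potential:
  assumes lap: "\<And>x. x \<in> ball 0 R \<Longrightarrow> (\<Sum>i\<in>UNIV. pd (pd D i) i x) = 0" and x: "x \<in> ball 0 R"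
  shows "(\<Sum>i\<in>UNIV. pd (pd (potential c D) i) i x) = 0"
proof -
  have D3: "Ck (Suc 2) (ball 0 R) D" using D by (simp add: eval_nat_numeral)
  have 1: "pd (pd (potential c D) i) i x
     = integral {0..1} (\<lambda>s. c / 2 * s\<^sup>2 * s\<^sup>2 * pd (pd D i) i (s\<^sup>2 *\<^sub>R x + 0))" for i
  proof -
    have "pd (pd (potential c D) i) i x = pd (\<lambda>x. integral {0..1} (\<lambda>s. c / 2 * s\<^sup>2 * pd D i (s\<^sup>2 *\<^sub>R x + 0))) i x"
      by (rule pd_cong(2)[OF open_ball x], rule pd_potential)
    also have "\<dots> = integral {0..1} (\<lambda>s. c / 2 * s\<^sup>2 * s\<^sup>2 * pd (pd D i) i (s\<^sup>2 *\<^sub>R x + 0))"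
      by (rule pd_weighted_integral[OF Ck_mono[OF Ck_SucD(2)[OF D3]] x]) (auto intro!: continuous_intros)
    finally show ?thesis .
  qed
  have "continuous_on {0..1} (\<lambda>s. pd (pd D i) i (s\<^sup>2 *\<^sub>R x + 0))" for i
    by (rule continuous_on_compose2[OF Ck_continuous_on[OF Ck_SucD(2)[OF Ck_SucD(2)[OF D3, unfolded numeral_2_eq_2]]]])
       (use potential_maps[OF x] in \<open>auto intro!: continuous_intros\<close>)
  then have int: "(\<lambda>s. c / 2 * s\<^sup>2 * s\<^sup>2 * pd (pd D i) i (s\<^sup>2 *\<^sub>R x + 0)) integrable_on {0..1}" for i
    by (intro integrable_continuous_interval continuous_intros)
  have "(\<Sum>i\<in>UNIV. pd (pd (potential c D) i) i x)
     = integral {0..1} (\<lambda>s. \<Sum>i\<in>UNIV. c / 2 * s\<^sup>2 * s\<^sup>2 * pd (pd D i) i (s\<^sup>2 *\<^sub>R x + 0))"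
    unfolding 1 by (rule integral_sum[symmetric]) (use int in auto)
  also have "\<dots> = integral {0..1::real} (\<lambda>s. 0 :: real)"
  proof (rule integral_cong)
    fix s :: real assume "s \<in> {0..1}"
    from lap[OF potential_maps[OF x this]]
    show "(\<Sum>i\<in>UNIV. c / 2 * s\<^sup>2 * s\<^sup>2 * pd (pd D i) i (s\<^sup>2 *\<^sub>R x + 0)) = 0"
      unfolding sum_distrib_left[symmetric] by (simp only: mult_zero_right)
  qed
  finally show ?thesis by simp
qed

text \<open>The derivative of \<open>s * D (s^2 * x)\<close> in \<open>s\<close> is
  \<open>D + 2 * s^2 * (sum of x_i * pd D i)\<close> at \<open>s^2 * x\<close>, exactly the
  integrand of the left-hand side up to \<open>c\<close>; the boundary term at \<open>s = 0\<close>
  vanishes.\<close>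

lemma euler_potential:
  assumes x: "x \<in> ball 0 R"
  shows "2 * potential c D x + 4 * euler (potential c D) x = c * D x"
proof -
  let ?z = "\<lambda>s. s\<^sup>2 *\<^sub>R x + (0::R3)"
  have D3: "Ck (Suc 2) (ball 0 R) D" using D by (simp add: eval_nat_numeral)
  have D1: "Ck 1 (ball 0 R) D" using D by (rule Ck_mono) simp
  have contD: "continuous_on {0..1} (\<lambda>s. D (?z s))"
    by (rule continuous_on_compose2[OF Ck_continuous_on[OF D]])
       (use potential_maps[OF x] in \<open>auto intro!: continuous_intros\<close>)
  have contE: "continuous_on {0..1} (\<lambda>s. pd D i (?z s))" for i
    by (rule continuous_on_compose2[OF Ck_continuous_on[OF Ck_SucD(2)[OF D3]]])
       (use potential_maps[OF x] in \<open>auto intro!: continuous_intros\<close>)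
  have intE: "(\<lambda>s. x $ i * (c / 2 * s\<^sup>2 * pd D i (?z s))) integrable_on {0..1}" for i
    by (intro integrable_continuous_interval continuous_intros contE)
  have ftc: "((\<lambda>s. D (?z s) + 2 * s\<^sup>2 * (\<Sum>i\<in>UNIV. x $ i * pd D i (?z s))) has_integral 1 * D (?z 1) - 0 * D (?z 0)) {0..1}"
  proof (rule fundamental_theorem_of_calculus)
    fix s :: real assume s: "s \<in> {0..1}"
    have "((\<lambda>t. D (t *\<^sub>R x)) has_real_derivative (\<Sum>i\<in>UNIV. x $ i * pd D i (s\<^sup>2 *\<^sub>R x))) (at (s\<^sup>2))"
      by (rule Ck_DERIV_ray[OF open_ball D1]) (use potential_maps[OF x s] in simp)
    then have "((\<lambda>s. D (s\<^sup>2 *\<^sub>R x)) has_real_derivative (\<Sum>i\<in>UNIV. x $ i * pd D i (s\<^sup>2 *\<^sub>R x)) * (2 * s)) (at s)"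
      by (rule DERIV_chain2) (auto intro!: derivative_eq_intros)
    then have "((\<lambda>s. s * D (?z s)) has_real_derivative D (?z s) + 2 * s\<^sup>2 * (\<Sum>i\<in>UNIV. x $ i * pd D i (?z s))) (at s)"
      by (auto intro!: derivative_eq_intros simp: power2_eq_square)
    then show "((\<lambda>s. s * D (?z s)) has_vector_derivative D (?z s) + 2 * s\<^sup>2 * (\<Sum>i\<in>UNIV. x $ i * pd D i (?z s))) (at s within {0..1})"
      by (simp add: has_real_derivative_iff_has_vector_derivative has_vector_derivative_at_within)
  qed simp
  have "euler (potential c D) x = (\<Sum>i\<in>UNIV. integral {0..1} (\<lambda>s. x $ i * (c / 2 * s\<^sup>2 * pd D i (?z s))))"
    unfolding euler_def pd_potential[OF x] integral_mult_right ..
  also have "\<dots> = integral {0..1} (\<lambda>s. \<Sum>i\<in>UNIV. x $ i * (c / 2 * s\<^sup>2 * pd D i (?z s)))"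
    by (rule integral_sum[symmetric]) (use intE in auto)
  finally have e: "4 * euler (potential c D) x = integral {0..1} (\<lambda>s. 4 * (\<Sum>i\<in>UNIV. x $ i * (c / 2 * s\<^sup>2 * pd D i (?z s))))"
    by simp
  have p: "2 * potential c D x = integral {0..1} (\<lambda>s. 2 * (c / 2 * D (?z s)))"
    unfolding potential_def by simp
  have "2 * potential c D x + 4 * euler (potential c D) x
     = integral {0..1} (\<lambda>s. 2 * (c / 2 * D (?z s)) + 4 * (\<Sum>i\<in>UNIV. x $ i * (c / 2 * s\<^sup>2 * pd D i (?z s))))"
    unfolding p e
    by (rule integral_add[symmetric])
       (intro integrable_continuous_interval continuous_intros contD contE continuous_on_sum)+
  also have "\<dots> = integral {0..1} (\<lambda>s. c * (D (?z s) + 2 * s\<^sup>2 * (\<Sum>i\<in>UNIV. x $ i * pd D i (?z s))))"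
    by (rule integral_cong) (simp add: sum_distrib_left algebra_simps)
  also have "\<dots> = c * D x"
    using integral_unique[OF ftc] by simp
  finally show ?thesis .
qed

end

text \<open>The integrating factor is \<open>t powr a\<close> with
  \<open>a = 1 + 2 / \<kappa>\<close>: the derivative of \<open>t powr a * g t\<close> is
  \<open>t powr (a - 1) * F t / \<kappa>\<close>, and the power is at most 1. The majorant
  \<open>B / \<kappa> / (1 - t * \<rho>)^2\<close> has the primitive
  \<open>B / \<kappa> * (t / (1 - t * \<rho>))\<close>, so one power of the singularity is
  gained.\<close>

lemma weighted_ray_bound:
  fixes g g' F :: "real \<Rightarrow> real"
  assumes \<kappa>: "0 < \<kappa>" and B: "0 \<le> B" and \<rho>: "0 \<le> \<rho>" "\<rho> < 1"
    and g: "\<And>t. t \<in> {0..1} \<Longrightarrow> (g has_real_derivative g' t) (at t)"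
    and ode: "\<And>t. t \<in> {0..1} \<Longrightarrow> \<kappa> * t * g' t + (\<kappa> + 2) * g t = F t"
    and F: "\<And>t. t \<in> {0..1} \<Longrightarrow> \<bar>F t\<bar> \<le> B / (1 - t * \<rho>)\<^sup>2"
  shows "\<bar>g 1\<bar> \<le> B / \<kappa> / (1 - \<rho>)"
proof -
  \<comment> \<open>Since \<open>a > 0\<close>, \<open>0 powr a = 0\<close> removes the unknown
    value of \<open>g\<close> at the centre; since \<open>a > 1\<close>, the factor
    \<open>t powr (a - 1)\<close> stays bounded.\<close>
  define a where "a = 1 + 2 / \<kappa>"
  have a: "1 < a" "a * \<kappa> = \<kappa> + 2" using \<kappa> by (auto simp: a_def field_simps)
  let ?f = "\<lambda>t. t powr a * g t" and ?p = "\<lambda>t. B / \<kappa> * (t / (1 - t * \<rho>))"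
  have pos: "0 < 1 - t * \<rho>" if "t \<in> {0..1}" for t
  proof -
    have "t * \<rho> \<le> 1 * \<rho>" using that \<rho> by (intro mult_right_mono) auto
    then show ?thesis using \<rho> by simp
  qed
  have "norm (?f 1 - ?f 0) \<le> ?p 1 - ?p 0"
  proof (rule differentiable_bound_general[where f="?f" and \<phi>="?p"
        and f'="\<lambda>t. t powr (a - 1) / \<kappa> * F t" and \<phi>'="\<lambda>t. B / \<kappa> / (1 - t * \<rho>)\<^sup>2"])
    show "continuous_on {0..1} ?f"
    proof (rule continuous_on_mult)
      show "continuous_on {0..1} (\<lambda>t. t powr a)"
        using a by (intro continuous_on_powr') (auto intro!: continuous_intros)
      show "continuous_on {0..1} g"
        using g by (intro continuous_at_imp_continuous_on ballI DERIV_isCont)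
    qed
    show "continuous_on {0..1} ?p"
      using pos by (intro continuous_intros) force
    fix t :: real assume t: "0 < t" "t < 1"
    then have t01: "t \<in> {0..1}" by auto
    have "(?f has_real_derivative (a * t powr (a - 1)) * g t + t powr a * g' t) (at t)"
      using t by (auto intro!: derivative_eq_intros g[OF t01])
    moreover have "(a * t powr (a - 1)) * g t + t powr a * g' t = t powr (a - 1) / \<kappa> * F t"
    proof -
      have "t powr a = t powr (a - 1) * t" using t by (simp add: powr_diff)
      then have "(a * t powr (a - 1)) * g t + t powr a * g' t = t powr (a - 1) * (a * g t + t * g' t)"
        by (simp add: algebra_simps)
      also have "a * g t + t * g' t = F t / \<kappa>"
      proof -
        have "F t = \<kappa> * (a * g t + t * g' t)"
          unfolding ode[OF t01, symmetric] a(2)[symmetric] by (simp add: algebra_simps)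
        then show ?thesis using \<kappa> by simp
      qed
      finally show ?thesis by simp
    qed
    ultimately show "(?f has_vector_derivative t powr (a - 1) / \<kappa> * F t) (at t)"
      by (simp add: has_real_derivative_iff_has_vector_derivative)
    have "((\<lambda>t. t / (1 - t * \<rho>)) has_real_derivative 1 / (1 - t * \<rho>)\<^sup>2) (at t)"
      using pos[OF t01] by (auto intro!: derivative_eq_intros simp: power2_eq_square)
    then have "(?p has_real_derivative B / \<kappa> * (1 / (1 - t * \<rho>)\<^sup>2)) (at t)"
      by (rule DERIV_cmult)
    then show "(?p has_vector_derivative B / \<kappa> / (1 - t * \<rho>)\<^sup>2) (at t)"
      by (simp add: has_real_derivative_iff_has_vector_derivative)
    have "norm (t powr (a - 1) / \<kappa> * F t) \<le> 1 / \<kappa> * (B / (1 - t * \<rho>)\<^sup>2)"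
      unfolding real_norm_def abs_mult
    proof (rule mult_mono)
      have "t powr (a - 1) \<le> 1 powr (a - 1)" using t a by (intro powr_mono2) auto
      then show "\<bar>t powr (a - 1) / \<kappa>\<bar> \<le> 1 / \<kappa>" using \<kappa> by (simp add: divide_right_mono)
    qed (use F[OF t01] \<kappa> in auto)
    then show "norm (t powr (a - 1) / \<kappa> * F t) \<le> B / \<kappa> / (1 - t * \<rho>)\<^sup>2" by simp
  qed simp
  then show ?thesis using a by simp
qed

text \<open>Applied to smooth approximations. In the constant, 32 is the share of the harmonic field
  \<open>v\<close>; \<open>4992 = 2 * 3 * 832\<close> comes from
  \<open>1 - |x|^2 \<le> 2 * (1 - |x|)\<close>, the three terms of \<open>div v\<close>, and the
  bound on second derivatives; \<open>4 + 2 * c\<close> is the leading coefficient of the equation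
  on the ray.\<close>

lemma lame_nontangential_bound:
  fixes U :: "3 \<Rightarrow> R3 \<Rightarrow> real" and F :: "R3 \<Rightarrow> real"
  assumes mu: "\<mu> > 0" "2 * \<mu> + lam > 0" and R: "1 < R"
    and U: "\<And>k. Ck 4 (ball 0 R) (U k)" and lame: "lame_system \<mu> lam (ball 0 R) U"
    and F: "F \<in> borel_measurable borel" "\<And>w. 0 \<le> F w" "\<And>w. F w \<le> b"
    and UF: "\<And>k w. norm w = 1 \<Longrightarrow> \<bar>U k w\<bar> \<le> F w"
    and \<xi>: "norm \<xi> = 1" and x: "x \<in> Gamma \<xi>"
  defines "c \<equiv> (lam + \<mu>) / \<mu>"
  shows "\<bar>U k x\<bar> \<le> (32 + 4992 * \<bar>c\<bar> / (4 + 2 * c)) / measure sphere_measure UNIV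
     * enn2real (sphere_maximal (\<lambda>w. ennreal (F w)) \<xi>)"
proof -
  define S where "S = ball (0::R3) R"
  have S: "open S" by (simp add: S_def)
  \<comment> \<open>Here ellipticity enters:
    \<open>c + 1 = (2 * \<mu> + lam) / \<mu>\<close>.\<close>
  have c: "c + 1 > 0" using mu by (simp add: c_def field_simps)
  define D where "D y = (\<Sum>j\<in>UNIV. pd (U j) j y)" for y
  have U4: "Ck (Suc 3) S (U k)" for k using U[of k] by (simp add: eval_nat_numeral S_def)
  have U3: "Ck 3 S (pd (U k) i)" for k i using U4 by (rule Ck_SucD)
  have U3': "Ck 3 S (U k)" for k using U4 by (rule Ck_mono) simp
  have U2: "Ck 2 S (pd (pd (U k) i) j)" for k i j
    using U3[of k i] Ck_SucD(2)[of 2] by (simp add: eval_nat_numeral del: Ck.simps)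
  have D3: "Ck 3 S D" unfolding D_def[abs_def] by (intro Ck_sum S U3)
  have D3': "Ck 3 (ball 0 R) D" using D3 by (simp add: S_def)
  have pdD: "pd D k y = (\<Sum>j\<in>UNIV. pd (pd (U j) j) k y)" if "y \<in> S" for k y
    unfolding D_def[abs_def] by (rule pd_sum(2)) (use U4 that in \<open>auto simp: eval_nat_numeral\<close>)
  have eq: "(\<Sum>i\<in>UNIV. pd (pd (U k) i) i y) = - c * pd D k y" if y: "y \<in> S" for k y
  proof -
    have "\<mu> * (\<Sum>i\<in>UNIV. pd (pd (U k) i) i y) + (lam + \<mu>) * pd D k y = 0"
      using lame y pdD[OF y] unfolding lame_system_def S_def by simp
    then show ?thesis using mu by (simp add: c_def field_simps)
  qed
  \<comment> \<open>Taking the divergence of the previous equation shows that the Laplacian of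
    \<open>D\<close> is \<open>- c\<close> times itself, and \<open>c + 1\<close> is not 0.\<close>
  have lapD: "(\<Sum>i\<in>UNIV. pd (pd D i) i y) = 0" if y: "y \<in> S" for y
  proof -
    have h2: "has_pd (pd (pd (U k) i) j) l y" for k i j l
      using U2[of k i j] y by (auto simp: numeral_2_eq_2)
    have h3: "has_pd (pd D k) i y" for k i
      using D3 y by (auto simp: eval_nat_numeral)
    have "pd (pd D i) i y = (\<Sum>k\<in>UNIV. pd (pd (pd (U k) i) i) k y)" for i
    proof -
      have "pd (pd D i) i y = pd (\<lambda>y. \<Sum>j\<in>UNIV. pd (pd (U j) j) i y) i y"
        by (rule pd_cong(2)[OF S y pdD])
      also have "\<dots> = (\<Sum>k\<in>UNIV. pd (pd (pd (U k) k) i) i y)"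
        by (rule pd_sum(2)) (rule h2)
      also have "\<dots> = (\<Sum>k\<in>UNIV. pd (pd (pd (U k) i) i) k y)"
        by (rule sum.cong[OF refl], rule pd3_commute[OF S U3' y])
      finally show ?thesis .
    qed
    then have "(\<Sum>i\<in>UNIV. pd (pd D i) i y) = (\<Sum>k\<in>UNIV. \<Sum>i\<in>UNIV. pd (pd (pd (U k) i) i) k y)"
      by (simp only:) (rule sum.swap)
    also have "\<dots> = (\<Sum>k\<in>UNIV. - c * pd (pd D k) k y)"
    proof (rule sum.cong[OF refl])
      fix k
      have "(\<Sum>i\<in>UNIV. pd (pd (pd (U k) i) i) k y) = pd (\<lambda>y. \<Sum>i\<in>UNIV. pd (pd (U k) i) i y) k y"
        by (rule pd_sum(2)[symmetric]) (rule h2)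
      also have "\<dots> = pd (\<lambda>y. - c * pd D k y + 0 * pd D k y) k y"
        by (rule pd_cong(2)[OF S y]) (simp add: eq)
      also have "\<dots> = - c * pd (pd D k) k y" using pd_lincomb(2)[where f="pd D k" and g="pd D k" and a="- c" and b=0, OF h3 h3] by simp
      finally show "(\<Sum>i\<in>UNIV. pd (pd (pd (U k) i) i) k y) = - c * pd (pd D k) k y" .
    qed
    also have "\<dots> = - c * (\<Sum>i\<in>UNIV. pd (pd D i) i y)" by (rule sum_distrib_left[symmetric])
    finally have "(c + 1) * (\<Sum>i\<in>UNIV. pd (pd D i) i y) = 0" unfolding distrib_right by linarith
    then show ?thesis using c by simp
  qed
  define \<psi> where "\<psi> = potential c D"
  have P3: "Ck 3 S \<psi>" using Ck_potential[OF D3'] by (simp add: \<psi>_def S_def)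
  have P2: "Ck 2 S \<psi>" using P3 by (rule Ck_mono) simp
  have P3s: "Ck (Suc 2) S \<psi>" using P3 by (simp add: eval_nat_numeral)
  have G2: "Ck 2 S (pd \<psi> k)" for k using P3s by (rule Ck_SucD)
  have G2s: "Ck (Suc (Suc 0)) S (pd \<psi> k)" for k using G2 by (simp add: numeral_2_eq_2)
  have lapP: "(\<Sum>i\<in>UNIV. pd (pd \<psi> i) i y) = 0" if "y \<in> S" for y
    unfolding \<psi>_def using laplace_potential[OF D3', of y c] lapD that by (simp add: S_def)
  have eul: "2 * \<psi> y + 4 * euler \<psi> y = c * D y" if "y \<in> S" for y
    unfolding \<psi>_def using euler_potential[OF D3', of y c] that by (simp add: S_def)
  have hP: "has_pd \<psi> k y" "has_pd (pd \<psi> k) i y" "has_pd (pd (pd \<psi> k) i) j y" "has_pd D k y" "has_pd (pd D k) i y"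
    "has_pd (U l) k y" "has_pd (pd (U l) k) i y" if "y \<in> S" for y i j k l
    using P3 D3 U3'[of l] that by (auto simp: eval_nat_numeral)
  have eul': "6 * pd \<psi> k y + 4 * euler (pd \<psi> k) y = c * pd D k y" if y: "y \<in> S" for k y
  proof -
    have "pd (\<lambda>y. 2 * \<psi> y + 4 * euler \<psi> y) k y = pd (\<lambda>y. c * D y + 0 * D y) k y"
      by (rule pd_cong(2)[OF S y]) (simp add: eul)
    then show ?thesis
      using pd_lincomb(2)[where f=\<psi> and g="euler \<psi>" and a=2 and b=4 and i=k, OF hP(1)[OF y] pd_euler(1)[OF S P2 y]] pd_euler(2)[OF S P2 y, of k]
        pd_lincomb(2)[where f=D and g=D and a=c and b=0 and i=k, OF hP(4)[OF y] hP(4)[OF y]] by simp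
  qed
  define N where "N y = 1 - (norm y)\<^sup>2" for y :: R3
  have pdN: "has_pd N i y" "pd N i y = - 2 * y $ i" for i y
    unfolding N_def[abs_def] by (rule pd_one_minus_norm2)+
  have NCk: "Ck j S N" for j unfolding N_def[abs_def] by (rule Ck_subset[OF Ck_one_minus_norm2]) simp
  \<comment> \<open>On the sphere \<open>N\<close> vanishes, so \<open>v\<close> and
    \<open>U\<close> have the same boundary values. The explicit coefficients match
    \<open>pd_lincomb\<close>.\<close>
  define v where "v k y = 1 * U k y + (- 1) * (N y * pd \<psi> k y)" for k y
  have v2: "Ck 2 S (v k)" for k
    unfolding v_def[abs_def] by (intro Ck_lincomb S Ck_mult NCk G2 Ck_mono[OF U3']) simp
  have v2s: "Ck (Suc (Suc 0)) S (v k)" for k using v2 by (simp add: numeral_2_eq_2)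
  have pdv: "pd (v k) i y = 1 * pd (U k) i y + (- 1) * ((- 2) * (y $ i * pd \<psi> k y) + 1 * (N y * pd (pd \<psi> k) i y))"
    if y: "y \<in> S" for k i y
    unfolding v_def[abs_def]
    using pd_lincomb(2)[where f="U k" and g="\<lambda>y. N y * pd \<psi> k y" and a=1 and b="-1" and i=i, OF hP(6)[OF y] pd_mult(1)[OF pdN(1) hP(2)[OF y]]]
      pd_mult(2)[where f=N and g="pd \<psi> k" and i=i, OF pdN(1) hP(2)[OF y]] pdN(2)[of i y] by simp
  have pdvv: "pd (pd (v k) i) i y = pd (pd (U k) i) i y + 2 * pd \<psi> k y + 4 * (y $ i * pd (pd \<psi> k) i y)
      - N y * pd (pd (pd \<psi> k) i) i y" if y: "y \<in> S" for k i y
  proof -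
    note m1 = pd_mult[where f="\<lambda>y. y $ i" and g="pd \<psi> k" and i=i, OF pd_nth(1) hP(2)[OF y]] and m2 = pd_mult[where f=N and g="pd (pd \<psi> k) i" and i=i, OF pdN(1) hP(3)[OF y]]
    note l1 = pd_lincomb[where a="-2" and b=1, OF m1(1) m2(1)]
    have "pd (pd (v k) i) i y = pd (\<lambda>y. 1 * pd (U k) i y + (- 1) * ((- 2) * (y $ i * pd \<psi> k y) + 1 * (N y * pd (pd \<psi> k) i y))) i y"
      by (rule pd_cong(2)[OF S y pdv])
    also have "\<dots> = 1 * pd (pd (U k) i) i y + (- 1) * ((- 2) * ((if i = i then 1 else 0) * pd \<psi> k y + y $ i * pd (pd \<psi> k) i y)
        + 1 * ((- 2 * y $ i) * pd (pd \<psi> k) i y + N y * pd (pd (pd \<psi> k) i) i y))"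
      using pd_lincomb(2)[where f="pd (U k) i" and a=1 and b="-1" and i=i, OF hP(7)[OF y] l1(1)] l1(2) m1(2) m2(2) pdN(2)[of i y] pd_nth(2)[of i i y] by simp
    finally show ?thesis by (simp add: algebra_simps)
  qed
  \<comment> \<open>The Laplacian of \<open>N\<close> contributes 6 and its gradient the term with
    \<open>euler\<close>; by \<open>eq\<close> and \<open>eul'\<close> they cancel the Laplacian of
    \<open>U k\<close>, while \<open>\<psi>\<close> being harmonic removes the term with the factor
    \<open>N\<close>.\<close>
  have lapv: "(\<Sum>i\<in>UNIV. pd (pd (v k) i) i y) = 0" if y: "y \<in> S" for k y
  proof -
    have "(\<Sum>i\<in>UNIV. pd (pd (pd \<psi> k) i) i y) = (\<Sum>i\<in>UNIV. pd (pd (pd \<psi> i) i) k y)"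
      by (rule sum.cong[OF refl], rule pd3_commute[OF S P3 y])
    also have "\<dots> = pd (\<lambda>y. \<Sum>i\<in>UNIV. pd (pd \<psi> i) i y) k y"
      by (rule pd_sum(2)[symmetric]) (rule hP(3)[OF y])
    also have "\<dots> = pd (\<lambda>y. 0) k y" by (rule pd_cong(2)[OF S y lapP])
    also have "\<dots> = 0" using pd_eqI(2)[of "\<lambda>y. 0" y k 0] by simp
    finally have 0: "(\<Sum>i\<in>UNIV. pd (pd (pd \<psi> k) i) i y) = 0" .
    have "(\<Sum>i\<in>UNIV. pd (pd (v k) i) i y) = (\<Sum>i\<in>UNIV. pd (pd (U k) i) i y) + 6 * pd \<psi> k y
        + 4 * euler (pd \<psi> k) y - N y * (\<Sum>i\<in>UNIV. pd (pd (pd \<psi> k) i) i y)"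
      by (simp add: pdvv[OF y] sum.distrib sum_subtractf sum_distrib_left euler_def)
    then show ?thesis using 0 eq[OF y, of k] eul'[OF y, of k] by simp
  qed
  have divv: "(\<Sum>j\<in>UNIV. pd (v j) j y) = D y + 2 * euler \<psi> y" if y: "y \<in> S" for y
  proof -
    have "(\<Sum>j\<in>UNIV. pd (v j) j y) = D y + 2 * euler \<psi> y - N y * (\<Sum>j\<in>UNIV. pd (pd \<psi> j) j y)"
      by (simp add: pdv[OF y] sum.distrib sum_subtractf sum_distrib_left euler_def D_def)
    then show ?thesis using lapP[OF y] by simp
  qed
  \<comment> \<open>\<open>c\<close> times the derivative of \<open>divv\<close>, with
    \<open>c * pd D k\<close> replaced by means of \<open>eul'\<close>: the right-hand side now
    involves \<open>v\<close> alone.\<close>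
  have ode: "(4 + 2 * c) * euler (pd \<psi> k) y + (4 + 2 * c + 2) * pd \<psi> k y = c * (\<Sum>j\<in>UNIV. pd (pd (v j) j) k y)"
    if y: "y \<in> S" for k y
  proof -
    have "(\<Sum>j\<in>UNIV. pd (pd (v j) j) k y) = pd (\<lambda>y. \<Sum>j\<in>UNIV. pd (v j) j y) k y"
      by (rule pd_sum(2)[symmetric]) (use v2s y in auto)
    also have "\<dots> = pd (\<lambda>y. 1 * D y + 2 * euler \<psi> y) k y"
      by (rule pd_cong(2)[OF S y]) (simp add: divv)
    also have "\<dots> = pd D k y + 2 * (pd \<psi> k y + euler (pd \<psi> k) y)"
      using pd_lincomb(2)[where f=D and g="euler \<psi>" and a=1 and b=2 and i=k, OF hP(4)[OF y] pd_euler(1)[OF S P2 y]] pd_euler(2)[OF S P2 y, of k] by simp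
    finally show ?thesis using eul'[OF y, of k] by (simp add: algebra_simps)
  qed
  have cb: "cball 0 1 \<subseteq> S" "unit_ball \<subseteq> S" using R by (auto simp: S_def)
  have vc: "continuous_on (cball 0 1) (v k)" for k
    by (rule continuous_on_subset[OF Ck_continuous_on[OF v2] cb(1)])
  have vh: "harmonic_on unit_ball (v k)" for k
    unfolding harmonic_on_def
    using continuous_on_subset[OF Ck_continuous_on[OF v2] cb(2)] v2s lapv cb by (auto simp: subset_iff)
  have vF: "\<bar>v k w\<bar> \<le> F w" if "norm w = 1" for k w
    using UF[OF that, of k] that by (simp add: v_def N_def)
  define A where "A = measure sphere_measure UNIV"
  have A: "0 < A" unfolding A_def by (rule measure_sphere_measure_pos)
  define m where "m = enn2real (sphere_maximal (\<lambda>w. ennreal (F w)) \<xi>)"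
  have m: "0 \<le> m" by (simp add: m_def)
  have hb: "A * \<bar>v k y\<bar> \<le> 32 * m" "A * \<bar>pd (pd (v k) i) j y\<bar> \<le> 832 * m / (1 - norm y)\<^sup>2"
    if "y \<in> Gamma \<xi>" for y k i j
    unfolding A_def m_def by (rule harmonic_nontangential_bounds[OF vc vh F _ \<xi> that], erule vF)+
  have x1: "norm x < 1" by (rule Gamma_bounds[OF \<xi> x])
  \<comment> \<open>\<open>2496 = 3 * 832\<close>, one second-derivative bound for each term of the
    divergence.\<close>
  define B where "B = \<bar>c\<bar> * (2496 * m / A)"
  have Gb: "\<bar>pd \<psi> k x\<bar> \<le> B / (4 + 2 * c) / (1 - norm x)"
  proof -
    have "\<bar>(\<lambda>t. pd \<psi> k (t *\<^sub>R x)) 1\<bar> \<le> B / (4 + 2 * c) / (1 - norm x)"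
    proof (rule weighted_ray_bound[where g'="\<lambda>t. \<Sum>i\<in>UNIV. x $ i * pd (pd \<psi> k) i (t *\<^sub>R x)"
          and F="\<lambda>t. c * (\<Sum>j\<in>UNIV. pd (pd (v j) j) k (t *\<^sub>R x))"])
      show "0 \<le> B" using m A by (simp add: B_def)
      fix t :: real assume t: "t \<in> {0..1}"
      have tx: "t *\<^sub>R x \<in> Gamma \<xi>" using t by (intro Gamma_scale[OF x]) auto
      then have tS: "t *\<^sub>R x \<in> S" using Gamma_bounds(1)[OF \<xi>, of "t *\<^sub>R x"] R by (simp add: S_def)
      show "((\<lambda>t. pd \<psi> k (t *\<^sub>R x)) has_real_derivative (\<Sum>i\<in>UNIV. x $ i * pd (pd \<psi> k) i (t *\<^sub>R x))) (at t)"
        by (rule Ck_DERIV_ray[OF S Ck_mono[OF G2] tS]) simp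
      show "(4 + 2 * c) * t * (\<Sum>i\<in>UNIV. x $ i * pd (pd \<psi> k) i (t *\<^sub>R x)) + (4 + 2 * c + 2) * pd \<psi> k (t *\<^sub>R x)
          = c * (\<Sum>j\<in>UNIV. pd (pd (v j) j) k (t *\<^sub>R x))"
        using ode[OF tS, of k] by (simp add: euler_def sum_distrib_left mult.assoc)
      have "\<bar>pd (pd (v j) j) k (t *\<^sub>R x)\<bar> \<le> 832 * m / A / (1 - t * norm x)\<^sup>2" for j
      proof -
        have "A * \<bar>pd (pd (v j) j) k (t *\<^sub>R x)\<bar> \<le> 832 * m / (1 - t * norm x)\<^sup>2"
          using hb(2)[OF tx, of j j k] t by simp
        then have "\<bar>pd (pd (v j) j) k (t *\<^sub>R x)\<bar> \<le> (832 * m / (1 - t * norm x)\<^sup>2) / A"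
          using A by (subst pos_le_divide_eq) (auto simp: mult.commute)
        then show ?thesis by (simp add: mult.commute)
      qed
      then have "\<bar>\<Sum>j\<in>UNIV. pd (pd (v j) j) k (t *\<^sub>R x)\<bar> \<le> (\<Sum>j\<in>(UNIV::3 set). 832 * m / A / (1 - t * norm x)\<^sup>2)"
        by (intro order_trans[OF sum_abs] sum_mono)
      then have "\<bar>c\<bar> * \<bar>\<Sum>j\<in>UNIV. pd (pd (v j) j) k (t *\<^sub>R x)\<bar> \<le> \<bar>c\<bar> * (2496 * m / A / (1 - t * norm x)\<^sup>2)"
        by (intro mult_left_mono) auto
      then show "\<bar>c * (\<Sum>j\<in>UNIV. pd (pd (v j) j) k (t *\<^sub>R x))\<bar> \<le> B / (1 - t * norm x)\<^sup>2"
        by (simp add: abs_mult B_def)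
    qed (use c x1 in auto)
    then show ?thesis by simp
  qed
  have N2: "N x \<le> 2 * (1 - norm x)" "0 \<le> N x"
  proof -
    have "N x = (1 + norm x) * (1 - norm x)" by (simp add: N_def power2_eq_square algebra_simps)
    then show "N x \<le> 2 * (1 - norm x)" "0 \<le> N x" using x1 mult_right_mono[of "1 + norm x" 2 "1 - norm x"] by auto
  qed
  have "N x * \<bar>pd \<psi> k x\<bar> \<le> 2 * (1 - norm x) * (B / (4 + 2 * c) / (1 - norm x))"
    using N2 Gb x1 by (intro mult_mono) auto
  also have "\<dots> = 2 * B / (4 + 2 * c)"
  proof -
    have "2 * d * (q / d) = 2 * q" if "d \<noteq> 0" for d q :: real using that by simp
    from this[of "1 - norm x" "B / (4 + 2 * c)"] x1
    have "2 * (1 - norm x) * (B / (4 + 2 * c) / (1 - norm x)) = 2 * (B / (4 + 2 * c))" by linarith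
    then show ?thesis by linarith
  qed
  finally have "\<bar>N x * pd \<psi> k x\<bar> \<le> 2 * B / (4 + 2 * c)" using N2 by (simp add: abs_mult)
  moreover have "U k x = v k x + N x * pd \<psi> k x" by (simp add: v_def)
  ultimately have "\<bar>U k x\<bar> \<le> \<bar>v k x\<bar> + 2 * B / (4 + 2 * c)" by linarith
  also have "\<bar>v k x\<bar> \<le> 32 * m / A" using hb(1)[OF x, of k] A by (simp add: pos_le_divide_eq mult.commute)
  also have "32 * m / A + 2 * B / (4 + 2 * c) = (32 + 4992 * \<bar>c\<bar> / (4 + 2 * c)) / A * m"
    by (simp add: B_def add_divide_distrib distrib_left mult_ac)
  finally show ?thesis by (simp add: A_def m_def)
qed

section \<open>Smooth approximation\<close>

lemma pd_vec_nth:
  fixes u :: "R3 \<Rightarrow> R3"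
  assumes "has_pd u i x"
  shows "has_pd (\<lambda>x. u x $ k) i x" "pd (\<lambda>x. u x $ k) i x = pd u i x $ k"
proof -
  have "((\<lambda>t. u (x + t *\<^sub>R axis i 1)) has_vector_derivative pd u i x) (at 0)"
    using assms unfolding has_pd_def pd_def by (simp add: vector_derivative_works)
  then have "((\<lambda>t. u (x + t *\<^sub>R axis i 1) $ k) has_real_derivative pd u i x $ k) (at 0)"
    unfolding has_real_derivative_iff_has_vector_derivative
    by (rule bounded_linear.has_vector_derivative[OF bounded_linear_vec_nth])
  from pd_eqI[of "\<lambda>x. u x $ k", OF this]
  show "has_pd (\<lambda>x. u x $ k) i x" "pd (\<lambda>x. u x $ k) i x = pd u i x $ k" by auto
qed

text \<open>The passage from the vector-valued definition to scalar components, where the calculus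
  of \<open>Ck\<close> is available; the derivative of \<open>divg u\<close> becomes a sum of second
  derivatives.\<close>

lemma lame_solution_components:
  fixes u :: "R3 \<Rightarrow> R3"
  assumes u: "lame_solution \<mu> lam S u" and S: "open S"
  shows "Ck 2 S (\<lambda>x. u x $ k)" "lame_system \<mu> lam S (\<lambda>k x. u x $ k)"
proof -
  have h1: "has_pd u i x" and h2: "has_pd (pd u i) j x" if "x \<in> S" for i j x
    using u that by (auto simp: lame_solution_def)
  have c0: "continuous_on S u" and c1: "continuous_on S (pd u i)" and c2: "continuous_on S (pd (pd u i) j)" for i j
    using u by (auto simp: lame_solution_def)
  have p1: "pd (\<lambda>x. u x $ k) i x = pd u i x $ k" if "x \<in> S" for i k x
    by (rule pd_vec_nth(2)[OF h1[OF that]])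
  have q2: "has_pd (pd (\<lambda>x. u x $ k) i) j x" "pd (pd (\<lambda>x. u x $ k) i) j x = pd (pd u i) j x $ k"
    if x: "x \<in> S" for i j k x
  proof -
    have "has_pd (pd (\<lambda>x. u x $ k) i) j x \<longleftrightarrow> has_pd (\<lambda>x. pd u i x $ k) j x"
      "pd (pd (\<lambda>x. u x $ k) i) j x = pd (\<lambda>x. pd u i x $ k) j x"
      by (rule pd_cong[OF S x p1], assumption)+
    then show "has_pd (pd (\<lambda>x. u x $ k) i) j x" "pd (pd (\<lambda>x. u x $ k) i) j x = pd (pd u i) j x $ k"
      using pd_vec_nth[OF h2[OF x], where k=k] by auto
  qed
  have "continuous_on S (pd (\<lambda>x. u x $ k) i)" "continuous_on S (pd (pd (\<lambda>x. u x $ k) i) j)" for i j k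
  proof -
    show "continuous_on S (pd (\<lambda>x. u x $ k) i)"
      by (rule continuous_on_cong[THEN iffD2, OF refl p1 continuous_on_component[OF c1]])
    show "continuous_on S (pd (pd (\<lambda>x. u x $ k) i) j)"
      by (rule continuous_on_cong[THEN iffD2, OF refl q2(2) continuous_on_component[OF c2]])
  qed
  then show "Ck 2 S (\<lambda>x. u x $ k)" for k
    using pd_vec_nth(1)[OF h1] q2(1) continuous_on_component[OF c0] by (simp add: numeral_2_eq_2)
  show "lame_system \<mu> lam S (\<lambda>k x. u x $ k)"
    unfolding lame_system_def
  proof (intro allI ballI)
    fix k x assume x: "x \<in> S"
    have "pd (divg u) k x = (\<Sum>j\<in>UNIV. pd (pd (\<lambda>x. u x $ j) j) k x)"
    proof -
      have "pd (divg u) k x = pd (\<lambda>y. \<Sum>j\<in>UNIV. pd (\<lambda>x. u x $ j) j y) k x"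
        by (rule pd_cong(2)[OF S x]) (simp add: divg_def p1)
      also have "\<dots> = (\<Sum>j\<in>UNIV. pd (pd (\<lambda>x. u x $ j) j) k x)"
        by (rule pd_sum(2)) (rule q2(1)[OF x])
      finally show ?thesis .
    qed
    moreover have "lame_op \<mu> lam u x $ k = 0" using u x by (simp add: lame_solution_def)
    ultimately show "\<mu> * (\<Sum>i\<in>UNIV. pd (pd (\<lambda>x. u x $ k) i) i x) +
        (lam + \<mu>) * (\<Sum>j\<in>UNIV. pd (pd (\<lambda>x. u x $ j) j) k x) = 0"
      by (simp add: lame_op_def q2(2)[OF x])
  qed
qed

text \<open>The dilate of \<open>u\<close> solves the system on the ball of radius
  \<open>1 / r > 1\<close>, which leaves room around the closed unit ball for averaging. Two
  mollifications raise C^2 to C^4, and each moves points by at most \<open>3 * h\<close>.\<close>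

lemma lame_smooth_approximation:
  assumes u: "lame_solution \<mu> lam unit_ball u" and r: "0 < r" "r < 1" and e: "0 < e"
  obtains R U where "1 < R" "\<And>k. Ck 4 (ball 0 R) (U k)" "lame_system \<mu> lam (ball 0 R) U"
    "\<And>k x. norm x \<le> 1 \<Longrightarrow> \<bar>U k x - u (r *\<^sub>R x) $ k\<bar> \<le> e"
proof -
  define R0 where "R0 = 1 / r"
  have R0: "1 < R0" using r by (simp add: R0_def)
  have maps: "r *\<^sub>R x + 0 \<in> unit_ball" if "x \<in> ball 0 R0" for x :: R3
    using that r by (simp add: R0_def field_simps)
  define w where "w k x = u (r *\<^sub>R x + 0) $ k" for k x
  note comp = lame_solution_components[OF u open_ball]
  have w2: "Ck 2 (ball 0 R0) (w k)" for k
    unfolding w_def[abs_def] by (rule Ck_affine[OF open_ball maps comp(1)])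
  have comp2: "Ck (Suc (Suc 0)) unit_ball (\<lambda>x. u x $ k)" for k using comp(1)[of k] by (simp add: numeral_2_eq_2)
  have pdw: "pd (w k) i x = r * pd (\<lambda>x. u x $ k) i (r *\<^sub>R x + 0)" if "x \<in> ball 0 R0" for k i x
    unfolding w_def[abs_def] by (rule pd_affine(2)) (use comp2[of k] maps[OF that] in auto)
  have pdww: "pd (pd (w k) i) j x = r * (r * pd (pd (\<lambda>x. u x $ k) i) j (r *\<^sub>R x + 0))" if x: "x \<in> ball 0 R0" for k i j x
  proof -
    have h: "has_pd (pd (\<lambda>x. u x $ k) i) j (r *\<^sub>R x + 0)" using comp2[of k] maps[OF x] by auto
    have "pd (pd (w k) i) j x = pd (\<lambda>x. r * pd (\<lambda>x. u x $ k) i (r *\<^sub>R x + 0) + 0 * pd (\<lambda>x. u x $ k) i (r *\<^sub>R x + 0)) j x"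
      by (rule pd_cong(2)[OF open_ball x]) (simp add: pdw del: add_0_right)
    also have "\<dots> = r * pd (\<lambda>x. pd (\<lambda>x. u x $ k) i (r *\<^sub>R x + 0)) j x + 0 * pd (\<lambda>x. pd (\<lambda>x. u x $ k) i (r *\<^sub>R x + 0)) j x"
      by (rule pd_lincomb(2)[OF pd_affine(1)[OF h] pd_affine(1)[OF h]])
    finally show ?thesis using pd_affine(2)[OF h] by simp
  qed
  have wl: "lame_system \<mu> lam (ball 0 R0) w"
    unfolding lame_system_def
  proof (intro allI ballI)
    fix k and x :: R3 assume x: "x \<in> ball 0 R0"
    let ?h = "\<lambda>k i j. pd (pd (\<lambda>x. u x $ k) i) j (r *\<^sub>R x + 0)"
    have 0: "\<mu> * (\<Sum>i\<in>UNIV. ?h k i i) + (lam + \<mu>) * (\<Sum>j\<in>UNIV. ?h j j k) = 0"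
      using comp(2) maps[OF x] unfolding lame_system_def by blast
    have "\<mu> * (\<Sum>i\<in>UNIV. pd (pd (w k) i) i x) + (lam + \<mu>) * (\<Sum>j\<in>UNIV. pd (pd (w j) j) k x)
       = r * (r * (\<mu> * (\<Sum>i\<in>UNIV. ?h k i i) + (lam + \<mu>) * (\<Sum>j\<in>UNIV. ?h j j k)))"
      unfolding pdww[OF x] sum_distrib_left[symmetric] by (simp only: algebra_simps)
    then show "\<mu> * (\<Sum>i\<in>UNIV. pd (pd (w k) i) i x) + (lam + \<mu>) * (\<Sum>j\<in>UNIV. pd (pd (w j) j) k x) = 0"
      unfolding 0 by simp
  qed
  define R1 where "R1 = (1 + R0) / 2"
  have R1: "1 < R1" "R1 < R0" using R0 by (auto simp: R1_def)
  have uc: "continuous_on unit_ball u" using u by (simp add: lame_solution_def)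
  have "continuous_on (cball 0 R1) (\<lambda>x. u (r *\<^sub>R x + 0))"
    by (rule continuous_on_compose2[OF uc]) (use maps R1 in \<open>auto intro!: continuous_intros\<close>)
  from compact_uniformly_continuous[OF this compact_cball] e
  obtain \<eta> where \<eta>: "0 < \<eta>" "\<And>y z. norm y \<le> R1 \<Longrightarrow> norm z \<le> R1 \<Longrightarrow> dist z y < \<eta> \<Longrightarrow>
      dist (u (r *\<^sub>R z + 0)) (u (r *\<^sub>R y + 0)) < e"
    unfolding uniformly_continuous_on_def by (metis mem_cball_0)
  \<comment> \<open>Six averages per mollified function shift points by at most
    \<open>6 * h < \<eta>\<close>. They shrink the radius \<open>R + 6 * h = 1 + 12 * h\<close>, at
    most \<open>R1\<close>, to \<open>R = 1 + 6 * h\<close>.\<close>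
  define h where "h = min ((R1 - 1) / 12) (\<eta> / 12)"
  have h: "0 < h" "12 * h \<le> R1 - 1" "12 * h \<le> \<eta>" using R1 \<eta> by (auto simp: h_def min_def)
  define R where "R = 1 + 6 * h"
  have R: "1 < R" using h by (simp add: R_def)
  have sub: "ball 0 (R + h + h + h + h + h + h) \<subseteq> ball (0::R3) R0"
    using h R1 by (intro subset_ball) (simp add: R_def)
  define g where "g k = mollify h (w k)" for k
  define U where "U k = mollify h (g k)" for k
  have w2': "Ck 2 (ball 0 (R + h + h + h + h + h + h)) (w k)" for k by (rule Ck_subset[OF w2 sub])
  have g3: "Ck (Suc 2) (ball 0 (R + h + h + h)) (g k)" for k
    unfolding g_def by (rule Ck_mollify[OF h(1) w2'])
  have g2: "Ck 2 (ball 0 (R + h + h + h)) (g k)" for k using g3 by (rule Ck_mono) simp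
  have "Ck (Suc (Suc 2)) (ball 0 R) (U k)" for k
    unfolding U_def by (rule Ck_mollify[OF h(1) g3])
  then have U4: "Ck 4 (ball 0 R) (U k)" for k by (simp add: eval_nat_numeral)
  have wl': "lame_system \<mu> lam (ball 0 (R + h + h + h + h + h + h)) w"
    using wl sub unfolding lame_system_def by blast
  have gl: "lame_system \<mu> lam (ball 0 (R + h + h + h)) g"
    unfolding g_def[abs_def] by (rule lame_system_mollify[OF h(1) w2' wl'])
  have Ul: "lame_system \<mu> lam (ball 0 R) U"
    unfolding U_def[abs_def] by (rule lame_system_mollify[OF h(1) g2 gl])
  have "\<bar>U k x - u (r *\<^sub>R x) $ k\<bar> \<le> e" if x: "norm x \<le> 1" for k x
  proof -
    have "\<bar>U k x - w k x\<bar> \<le> e"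
      unfolding U_def
    proof (rule mollify_near[OF h(1) Ck_continuous_on[OF g2]])
      show "x \<in> ball 0 R" using x R by simp
      fix y assume y: "norm (y - x) \<le> 3 * h"
      have ny: "norm y \<le> 1 + 3 * h" using norm_triangle_ineq[of x "y - x"] x y by simp
      show "\<bar>g k y - w k x\<bar> \<le> e"
        unfolding g_def
      proof (rule mollify_near[OF h(1) Ck_continuous_on[OF w2']])
        show "y \<in> ball 0 (R + h + h + h)" using ny h by (simp add: R_def)
        fix z assume z: "norm (z - y) \<le> 3 * h"
        have nz: "norm z \<le> R1" using norm_triangle_ineq[of y "z - y"] ny z h by simp
        have "dist z x \<le> 6 * h"
          using norm_triangle_ineq[of "z - y" "y - x"] y z by (simp add: dist_norm)
        then have "dist (u (r *\<^sub>R z + 0)) (u (r *\<^sub>R x + 0)) < e"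
          using nz x R1 h by (intro \<eta>(2)) auto
        then have "norm (u (r *\<^sub>R z + 0) - u (r *\<^sub>R x + 0)) \<le> e" by (simp add: dist_norm)
        moreover have "\<bar>w k z - w k x\<bar> = \<bar>(u (r *\<^sub>R z + 0) - u (r *\<^sub>R x + 0)) $ k\<bar>" by (simp add: w_def)
        ultimately show "\<bar>w k z - w k x\<bar> \<le> e"
          using component_le_norm_cart[of "u (r *\<^sub>R z + 0) - u (r *\<^sub>R x + 0)" k] by linarith
      qed
    qed
    then show ?thesis by (simp add: w_def)
  qed
  then show ?thesis using that R U4 Ul by blast
qed

section \<open>The two inclusions\<close>

text \<open>The case \<open>w = 0\<close> is included because \<open>sphere_nn_integral\<close>
  evaluates its integrand there when the origin is normalised.\<close>

lemma scaleR_mem_Gamma: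
  assumes "norm w = 1 \<or> w = 0" "0 \<le> r" "r < 1"
  shows "r *\<^sub>R w \<in> Gamma w"
proof -
  have "r *\<^sub>R w + (1 - r) *\<^sub>R 0 \<in> convex hull (insert w (cball 0 (1/2)))"
    using assms by (intro convexD[OF convex_convex_hull] hull_inc) auto
  then show ?thesis using assms by (auto simp: Gamma_def)
qed

lemma ennpow_mono: "0 \<le> p \<Longrightarrow> a \<le> b \<Longrightarrow> ennpow a p \<le> ennpow b p"
  by (cases a; cases b) (auto simp: ennpow_def top_unique intro!: ennreal_leI powr_mono2)

lemma ennpow_ennreal: "0 \<le> a \<Longrightarrow> ennpow (ennreal a) p = ennreal (a powr p)"
  by (simp add: ennpow_def)

lemma normalize_cases: "norm (x /\<^sub>R norm x) = 1 \<or> x /\<^sub>R norm x = (0::R3)"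
  by (cases "x = 0") auto

text \<open>Pointwise domination of the integrands by \<open>ntmax\<close>, integrated by the
  monotonicity of \<open>nn_integral\<close>.\<close>

lemma Hp_e_subset_hp_e:
  assumes p: "1 < p"
  shows "Hp_e \<mu> lam p \<subseteq> hp_e \<mu> lam p"
proof
  fix u assume u: "u \<in> Hp_e \<mu> lam p"
  have "sphere_nn_integral (\<lambda>w. ennreal (norm (u (r *\<^sub>R w)) powr p)) \<le> sphere_nn_integral (\<lambda>\<xi>. ennpow (ntmax u \<xi>) p)"
    if r: "r \<in> {0..<1}" for r
    unfolding sphere_nn_integral_def
  proof (intro mult_left_mono nn_integral_mono)
    fix x :: R3
    let ?w = "x /\<^sub>R norm x"
    have "ennreal (norm (u (r *\<^sub>R ?w))) \<le> ntmax u ?w"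
      unfolding ntmax_def using r by (intro SUP_upper scaleR_mem_Gamma normalize_cases) auto
    then have "ennpow (ennreal (norm (u (r *\<^sub>R ?w)))) p \<le> ennpow (ntmax u ?w) p"
      using p by (intro ennpow_mono) auto
    then show "ennreal (norm (u (r *\<^sub>R ?w)) powr p) \<le> ennpow (ntmax u ?w) p"
      by (simp add: ennpow_ennreal)
  qed auto
  then have "(SUP r\<in>{0..<1}. sphere_nn_integral (\<lambda>w. ennreal (norm (u (r *\<^sub>R w)) powr p)))
      \<le> sphere_nn_integral (\<lambda>\<xi>. ennpow (ntmax u \<xi>) p)"
    by (rule SUP_least)
  then show "u \<in> hp_e \<mu> lam p" using u by (auto simp: Hp_e_def hp_e_def)
qed

section \<open>From bounded means to the nontangential maximal function\<close>

lemma powr_add_le: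
  fixes a b p :: real
  assumes "0 \<le> a" "0 \<le> b" "0 \<le> p"
  shows "(a + b) powr p \<le> 2 powr p * (a powr p + b powr p)"
proof -
  have "(a + b) powr p \<le> (2 * max a b) powr p" using assms by (intro powr_mono2) auto
  also have "\<dots> = 2 powr p * (max a b) powr p" using assms by (simp add: powr_mult)
  also have "(max a b) powr p \<le> a powr p + b powr p" by (simp add: max_def)
  finally show ?thesis by simp
qed

text \<open>Lets the supremum be taken after the p-th power, so that bounds can be proved one point
  of \<open>Gamma \<xi>\<close> at a time.\<close>

lemma ennpow_ntmax_le:
  assumes p: "0 < p" and le: "\<And>x. x \<in> Gamma \<xi> \<Longrightarrow> ennreal (norm (u x) powr p) \<le> L"
  shows "ennpow (ntmax u \<xi>) p \<le> L"
proof (cases L)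
  case (real l)
  have "ntmax u \<xi> \<le> ennreal (l powr (1 / p))"
    unfolding ntmax_def
  proof (rule SUP_least, rule ennreal_leI)
    fix x assume "x \<in> Gamma \<xi>"
    from le[OF this] have "norm (u x) powr p \<le> l" using real by simp
    then have "(norm (u x) powr p) powr (1 / p) \<le> l powr (1 / p)" using p by (intro powr_mono2) auto
    then show "norm (u x) \<le> l powr (1 / p)" using p by (simp add: powr_powr)
  qed
  then have "ennpow (ntmax u \<xi>) p \<le> ennpow (ennreal (l powr (1 / p))) p"
    using p by (intro ennpow_mono) auto
  also have "\<dots> = L" using p real by (simp add: ennpow_ennreal powr_powr)
  finally show ?thesis .
qed auto

text \<open>A Borel majorant of the nontangential maximal function of the dilate. The slack
  \<open>3 * e\<close> is the smoothing error: \<open>e\<close> in each of three components.\<close>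

definition nt_majorant :: "(R3 \<Rightarrow> R3) \<Rightarrow> real \<Rightarrow> real \<Rightarrow> (R3 \<Rightarrow> real) \<Rightarrow> bool" where
  "nt_majorant u r e m \<longleftrightarrow> m \<in> borel_measurable borel \<and> (\<forall>\<xi>. 0 \<le> m \<xi>) \<and>
     (\<forall>\<xi> x. norm \<xi> = 1 \<longrightarrow> x \<in> Gamma \<xi> \<longrightarrow> norm (u (r *\<^sub>R x)) \<le> m \<xi> + 3 * e)"

text \<open>The point is that \<open>C\<close> is chosen before \<open>u\<close>, \<open>r\<close>
  and \<open>e\<close>. The summand 1 on the right absorbs the smoothing error, which is bounded
  because \<open>e \<le> 1\<close> and the sphere has finite measure.\<close>

lemma lame_maximal_bound:
  assumes mu: "\<mu> > 0" "2 * \<mu> + lam > 0" and p: "1 < p"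
  obtains C where "\<And>u r e. lame_solution \<mu> lam unit_ball u \<Longrightarrow> 0 < r \<Longrightarrow> r < 1 \<Longrightarrow> 0 < e \<Longrightarrow> e \<le> 1 \<Longrightarrow>
    \<exists>m. nt_majorant u r e m \<and> (\<integral>\<^sup>+ \<xi>. ennreal (m \<xi> powr p) \<partial>sphere_measure)
      \<le> ennreal C * (1 + sphere_nn_integral (\<lambda>w. ennreal (norm (u (r *\<^sub>R w)) powr p)))"
proof -
  define c where "c = (lam + \<mu>) / \<mu>"
  have c: "c + 1 > 0" using mu by (simp add: c_def field_simps)
  define A where "A = measure sphere_measure UNIV"
  have A: "0 < A" unfolding A_def by (rule measure_sphere_measure_pos)
  define C0 where "C0 = (32 + 4992 * \<bar>c\<bar> / (4 + 2 * c)) / A"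
  \<comment> \<open>The Euclidean norm is estimated by the sum of the three components.\<close>
  define C1 where "C1 = 3 * C0"
  have C1: "0 \<le> C1" using c A by (simp add: C0_def C1_def)
  define C2 where "C2 = 19200 * p * 768 powr (p - 1) / (p - 1)"
  have C2: "0 \<le> C2" using p by (simp add: C2_def)
  define C where "C = C1 powr p * (C2 * (2 powr p * (1 + 3 powr p * A)))"
  show ?thesis
  proof (rule that[of C])
    fix u :: "R3 \<Rightarrow> R3" and r e :: real
    assume u: "lame_solution \<mu> lam unit_ball u" and r: "0 < r" "r < 1" and e: "0 < e" "e \<le> 1"
    obtain R U where U: "1 < R" "\<And>k. Ck 4 (ball 0 R) (U k)" "lame_system \<mu> lam (ball 0 R) U"
      "\<And>k x. norm x \<le> 1 \<Longrightarrow> \<bar>U k x - u (r *\<^sub>R x) $ k\<bar> \<le> e"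
      using lame_smooth_approximation[OF u r e(1)] by metis
    define V where "V x = (\<chi> k. U k x)" for x
    have Vu: "norm (V x - u (r *\<^sub>R x)) \<le> 3 * e" if "norm x \<le> 1" for x
    proof -
      have "norm (V x - u (r *\<^sub>R x)) \<le> (\<Sum>k\<in>UNIV. \<bar>(V x - u (r *\<^sub>R x)) $ k\<bar>)" by (rule norm_le_l1_cart)
      also have "\<dots> \<le> (\<Sum>k\<in>(UNIV::3 set). e)" using U(4)[OF that] by (intro sum_mono) (simp add: V_def)
      finally show ?thesis by simp
    qed
    have Vc: "continuous_on (cball 0 1) V"
    proof -
      have "continuous_on (cball 0 1) (U k)" for k
        by (rule continuous_on_subset[OF Ck_continuous_on[OF U(2)]]) (use U(1) in auto)
      then show ?thesis unfolding V_def[abs_def] by (intro continuous_on_vec_lambda)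
    qed
    define F where "F w = indicator (sphere 0 1) w * norm (V w)" for w
    have F0: "0 \<le> F w" for w by (simp add: F_def)
    have Fm[measurable]: "F \<in> borel_measurable borel"
    proof -
      have "continuous_on (sphere 0 1) (\<lambda>w. norm (V w))"
        by (intro continuous_intros continuous_on_subset[OF Vc]) auto
      then show ?thesis
        unfolding F_def[abs_def] using borel_measurable_continuous_on_indicator[of "sphere 0 1" "\<lambda>w. norm (V w)"] by simp
    qed
    obtain b where b: "\<And>x. norm x \<le> 1 \<Longrightarrow> norm (V x) \<le> b" "0 < b"
    proof -
      obtain b where "0 < b" "\<forall>x\<in>cball 0 1. norm (V x) \<le> b"
        using compact_continuous_image[OF Vc compact_cball, THEN compact_imp_bounded] by (auto simp: bounded_pos)
      then show ?thesis using that[of b] by (simp only: mem_cball_0 Ball_def)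
    qed
    have Fb: "F w \<le> b" for w using b by (auto simp: F_def indicator_def less_imp_le)
    have UF: "\<bar>U k w\<bar> \<le> F w" if "norm w = 1" for k w
      using component_le_norm_cart[of "V w" k] that by (simp add: F_def V_def)
    define m where "m \<xi> = C1 * enn2real (sphere_maximal (\<lambda>w. ennreal (F w)) \<xi>)" for \<xi>
    have m_meas[measurable]: "m \<in> borel_measurable borel" unfolding m_def[abs_def] by measurable
    have m0: "0 \<le> m \<xi>" for \<xi> using C1 by (simp add: m_def)
    have bound: "norm (u (r *\<^sub>R x)) \<le> m \<xi> + 3 * e" if \<xi>: "norm \<xi> = 1" and x: "x \<in> Gamma \<xi>" for \<xi> x
    proof -
      have "\<bar>U k x\<bar> \<le> C0 * enn2real (sphere_maximal (\<lambda>w. ennreal (F w)) \<xi>)" for k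
        unfolding C0_def c_def A_def by (rule lame_nontangential_bound[OF mu U(1-3) Fm F0 Fb _ \<xi> x], erule UF)
      then have "(\<Sum>k\<in>UNIV. \<bar>V x $ k\<bar>) \<le> (\<Sum>k\<in>(UNIV::3 set). C0 * enn2real (sphere_maximal (\<lambda>w. ennreal (F w)) \<xi>))"
        by (intro sum_mono) (simp add: V_def)
      then have "norm (V x) \<le> m \<xi>"
        using norm_le_l1_cart[of "V x"] by (simp add: m_def C1_def)
      moreover have "norm x \<le> 1" using Gamma_bounds(1)[OF \<xi> x] by simp
      ultimately show ?thesis
        using Vu[of x] norm_triangle_ineq2[of "u (r *\<^sub>R x)" "V x"] by (simp add: norm_minus_commute)
    qed
    \<comment> \<open>Cutting off at the closed ball makes the function Borel without altering it at
      unit vectors and at 0, the only values of \<open>x /\<^sub>R norm x\<close>.\<close>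
    define H where "H w = indicator (cball 0 1) w * (norm (u (r *\<^sub>R w)) powr p)" for w
    have Hm[measurable]: "H \<in> borel_measurable borel"
    proof -
      have "continuous_on (cball 0 1) (\<lambda>w. u (r *\<^sub>R w))"
      proof (rule continuous_on_compose2[of unit_ball u])
        have "r * norm w < 1" if "norm w \<le> 1" for w :: R3
          using mult_left_mono[OF that, of r] r by linarith
        then show "(\<lambda>w. r *\<^sub>R w) ` cball 0 1 \<subseteq> unit_ball" using r by auto
      qed (use u in \<open>auto simp: lame_solution_def intro!: continuous_intros\<close>)
      then have "continuous_on (cball 0 1) (\<lambda>w. norm (u (r *\<^sub>R w)) powr p)"
        using p by (intro continuous_on_powr' continuous_intros) auto
      then show ?thesis
        unfolding H_def[abs_def] using borel_measurable_continuous_on_indicator[of "cball 0 1" "\<lambda>w. norm (u (r *\<^sub>R w)) powr p"] by simp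
    qed
    have H_int: "(\<integral>\<^sup>+ w. ennreal (H w) \<partial>sphere_measure) = sphere_nn_integral (\<lambda>w. ennreal (norm (u (r *\<^sub>R w)) powr p))"
    proof -
      have "H (x /\<^sub>R norm x) = norm (u (r *\<^sub>R (x /\<^sub>R norm x))) powr p" for x :: R3
        using normalize_cases[of x] unfolding H_def by (auto simp: indicator_def)
      then show ?thesis
        by (subst nn_integral_sphere_measure) (simp_all add: sphere_nn_integral_def)
    qed
    have "(\<integral>\<^sup>+ w. ennreal (F w powr p) \<partial>sphere_measure) \<le> (\<integral>\<^sup>+ w. ennreal (2 powr p) * (ennreal (H w) + ennreal (3 powr p)) \<partial>sphere_measure)"
    proof (rule nn_integral_mono_AE)
      show "AE w in sphere_measure. ennreal (F w powr p) \<le> ennreal (2 powr p) * (ennreal (H w) + ennreal (3 powr p))"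
        using AE_sphere_measure
      proof eventually_elim
        case (elim w)
        have "F w \<le> norm (u (r *\<^sub>R w)) + 3"
          using Vu[of w] norm_triangle_ineq2[of "V w" "u (r *\<^sub>R w)"] elim e by (simp add: F_def)
        then have "F w powr p \<le> (norm (u (r *\<^sub>R w)) + 3) powr p" using p F0 by (intro powr_mono2) auto
        also have "\<dots> \<le> 2 powr p * (H w + 3 powr p)"
          using powr_add_le[of "norm (u (r *\<^sub>R w))" 3 p] p elim by (simp add: H_def)
        finally have "ennreal (F w powr p) \<le> ennreal (2 powr p * (H w + 3 powr p))" by (rule ennreal_leI)
        also have "\<dots> = ennreal (2 powr p) * (ennreal (H w) + ennreal (3 powr p))"
          by (simp add: ennreal_mult H_def)
        finally show ?case .
      qed
    qed
    also have "\<dots> = ennreal (2 powr p) * ((\<integral>\<^sup>+ w. ennreal (H w) \<partial>sphere_measure) + ennreal (3 powr p * A))"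
      by (simp add: nn_integral_cmult nn_integral_add A_def sphere.emeasure_eq_measure ennreal_mult)
    also have "\<dots> \<le> ennreal (2 powr p) * (ennreal (1 + 3 powr p * A) * (1 + (\<integral>\<^sup>+ w. ennreal (H w) \<partial>sphere_measure)))"
    proof (intro mult_left_mono)
      let ?h = "\<integral>\<^sup>+ w. ennreal (H w) \<partial>sphere_measure"
      have "ennreal (1 + 3 powr p * A) * (1 + ?h) = (1 + ennreal (3 powr p * A)) * (1 + ?h)"
        using A by (subst ennreal_plus) auto
      also have "\<dots> = (?h + ennreal (3 powr p * A)) + (1 + ennreal (3 powr p * A) * ?h)" by (simp add: algebra_simps)
      finally show "?h + ennreal (3 powr p * A) \<le> ennreal (1 + 3 powr p * A) * (1 + ?h)" by simp
    qed simp
    finally have FH: "(\<integral>\<^sup>+ w. ennreal (F w powr p) \<partial>sphere_measure)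
        \<le> ennreal (2 powr p * (1 + 3 powr p * A)) * (1 + (\<integral>\<^sup>+ w. ennreal (H w) \<partial>sphere_measure))"
      using A by (simp add: ennreal_mult mult.assoc)
    have "(\<integral>\<^sup>+ \<xi>. ennreal (m \<xi> powr p) \<partial>sphere_measure)
       = (\<integral>\<^sup>+ \<xi>. ennreal (C1 powr p) * ennreal (enn2real (sphere_maximal (\<lambda>w. ennreal (F w)) \<xi>) powr p) \<partial>sphere_measure)"
      using C1 by (intro nn_integral_cong) (simp add: m_def powr_mult ennreal_mult)
    also have "\<dots> = ennreal (C1 powr p) * (\<integral>\<^sup>+ \<xi>. ennreal (enn2real (sphere_maximal (\<lambda>w. ennreal (F w)) \<xi>) powr p) \<partial>sphere_measure)"
      by (rule nn_integral_cmult) measurable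
    also have "\<dots> \<le> ennreal (C1 powr p) * (ennreal C2 * (\<integral>\<^sup>+ w. ennreal (F w powr p) \<partial>sphere_measure))"
      unfolding C2_def by (intro mult_left_mono sphere_maximal_strong_type[OF Fm F0 Fb p]) simp
    also have "\<dots> \<le> ennreal (C1 powr p) * (ennreal C2 * (ennreal (2 powr p * (1 + 3 powr p * A)) * (1 + (\<integral>\<^sup>+ w. ennreal (H w) \<partial>sphere_measure))))"
      by (intro mult_left_mono FH) auto
    also have "\<dots> = ennreal C * (1 + sphere_nn_integral (\<lambda>w. ennreal (norm (u (r *\<^sub>R w)) powr p)))"
    proof -
      have "ennreal C = ennreal (C1 powr p) * (ennreal C2 * ennreal (2 powr p * (1 + 3 powr p * A)))"
        unfolding C_def using C2 A by (subst ennreal_mult, simp, simp, subst ennreal_mult) auto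
      then show ?thesis unfolding H_int by (simp add: mult.assoc)
    qed
    finally have int: "(\<integral>\<^sup>+ \<xi>. ennreal (m \<xi> powr p) \<partial>sphere_measure)
        \<le> ennreal C * (1 + sphere_nn_integral (\<lambda>w. ennreal (norm (u (r *\<^sub>R w)) powr p)))" .
    have "nt_majorant u r e m" using m_meas bound m0 by (simp add: nt_majorant_def)
    then show "\<exists>m. nt_majorant u r e m \<and> (\<integral>\<^sup>+ \<xi>. ennreal (m \<xi> powr p) \<partial>sphere_measure)
      \<le> ennreal C * (1 + sphere_nn_integral (\<lambda>w. ennreal (norm (u (r *\<^sub>R w)) powr p)))"
      using int by blast
  qed
qed

text \<open>The dilates with \<open>r n\<close> tending to 1 have majorants with uniformly bounded
  p-th moments; Fatou's lemma gives an integrable majorant for \<open>u\<close> itself.\<close>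

lemma hp_e_subset_Hp_e:
  assumes mu: "\<mu> > 0" "2 * \<mu> + lam > 0" and p: "1 < p"
  shows "hp_e \<mu> lam p \<subseteq> Hp_e \<mu> lam p"
proof
  fix u assume "u \<in> hp_e \<mu> lam p"
  then have u: "lame_solution \<mu> lam unit_ball u"
    and fin: "(SUP r\<in>{0..<1}. sphere_nn_integral (\<lambda>w. ennreal (norm (u (r *\<^sub>R w)) powr p))) < \<infinity>"
    by (auto simp: hp_e_def)
  define K where "K = (SUP r\<in>{0..<1}. sphere_nn_integral (\<lambda>w. ennreal (norm (u (r *\<^sub>R w)) powr p)))"
  obtain C where C: "\<And>u r e. lame_solution \<mu> lam unit_ball u \<Longrightarrow> 0 < r \<Longrightarrow> r < 1 \<Longrightarrow> 0 < e \<Longrightarrow> e \<le> 1 \<Longrightarrow>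
    \<exists>m. nt_majorant u r e m \<and> (\<integral>\<^sup>+ \<xi>. ennreal (m \<xi> powr p) \<partial>sphere_measure)
      \<le> ennreal C * (1 + sphere_nn_integral (\<lambda>w. ennreal (norm (u (r *\<^sub>R w)) powr p)))"
  proof (rule lame_maximal_bound[OF mu p])
  qed (rule that)
  \<comment> \<open>One null sequence serves both as smoothing error and as \<open>1 - r n\<close>;
    the factor \<open>1 / 2\<close> keeps \<open>r n\<close> positive already for
    \<open>n = 0\<close>.\<close>
  define e where "e n = 1 / 2 * inverse (real (Suc n))" for n
  define r where "r n = 1 - e n" for n
  have e: "0 < e n" "e n < 1" for n by (auto simp: e_def field_simps)
  have r: "0 < r n" "r n < 1" for n using e by (auto simp: r_def)
  have e_lim: "e \<longlonglongrightarrow> 0" unfolding e_def[abs_def] by (rule tendsto_mult_right_zero[OF LIMSEQ_inverse_real_of_nat])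
  have r_lim: "r \<longlonglongrightarrow> 1" unfolding r_def using tendsto_diff[OF tendsto_const e_lim, of 1] by simp
  have "\<exists>m. nt_majorant u (r n) (e n) m \<and>
      (\<integral>\<^sup>+ \<xi>. ennreal (m \<xi> powr p) \<partial>sphere_measure) \<le> ennreal C * (1 + K)" for n
  proof -
    have "sphere_nn_integral (\<lambda>w. ennreal (norm (u (r n *\<^sub>R w)) powr p)) \<le> K"
      unfolding K_def using r[of n] by (intro SUP_upper) auto
    then have "ennreal C * (1 + sphere_nn_integral (\<lambda>w. ennreal (norm (u (r n *\<^sub>R w)) powr p))) \<le> ennreal C * (1 + K)"
      by (intro mult_left_mono add_left_mono) auto
    then show ?thesis using C[OF u r[of n] e(1)[of n] less_imp_le[OF e(2)[of n]]] by (meson order_trans)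
  qed
  then obtain m where maj: "\<And>n. nt_majorant u (r n) (e n) (m n)"
    and int: "\<And>n. (\<integral>\<^sup>+ \<xi>. ennreal (m n \<xi> powr p) \<partial>sphere_measure) \<le> ennreal C * (1 + K)"
    by metis
  have m[measurable]: "m n \<in> borel_measurable borel" and m0: "0 \<le> m n \<xi>" for n \<xi>
    using maj[of n] by (auto simp: nt_majorant_def)
  have bound: "norm (u (r n *\<^sub>R x)) \<le> m n \<xi> + 3 * e n" if "norm \<xi> = 1" "x \<in> Gamma \<xi>" for n \<xi> x
    using maj[of n] that by (simp add: nt_majorant_def)
  \<comment> \<open>The majorants need not converge, but a lower limit is measurable and suits
    Fatou; it dominates at each fixed \<open>x\<close> because \<open>u (r n *\<^sub>R x)\<close>
    tends to \<open>u x\<close>.\<close>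
  define L where "L \<xi> = liminf (\<lambda>n. ennreal ((m n \<xi> + 3 * e n) powr p))" for \<xi>
  have Lm[measurable]: "L \<in> borel_measurable borel" unfolding L_def[abs_def] by measurable
  have le: "ennpow (ntmax u \<xi>) p \<le> L \<xi>" if \<xi>: "norm \<xi> = 1" for \<xi>
  proof (rule ennpow_ntmax_le)
    fix x assume x: "x \<in> Gamma \<xi>"
    have x1: "norm x < 1" by (rule Gamma_bounds[OF \<xi> x])
    have "(\<lambda>n. u (r n *\<^sub>R x)) \<longlonglongrightarrow> u x"
    proof (rule continuous_on_tendsto_compose[of unit_ball u])
      show "continuous_on unit_ball u" using u by (simp add: lame_solution_def)
      show "(\<lambda>n. r n *\<^sub>R x) \<longlonglongrightarrow> x" using tendsto_scaleR[OF r_lim tendsto_const, of x] by simp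
      have "r n * norm x < 1" for n
        using mult_right_mono[of "r n" 1 "norm x"] r[of n] x1 by simp
      then show "\<forall>\<^sub>F n in sequentially. r n *\<^sub>R x \<in> unit_ball" using r by (auto simp: less_imp_le)
    qed (use x1 in simp)
    then have "(\<lambda>n. norm (u (r n *\<^sub>R x)) powr p) \<longlonglongrightarrow> norm (u x) powr p"
      using p by (intro tendsto_powr' tendsto_norm tendsto_const) auto
    then have "(\<lambda>n. ennreal (norm (u (r n *\<^sub>R x)) powr p)) \<longlonglongrightarrow> ennreal (norm (u x) powr p)"
      by (rule tendsto_ennrealI)
    then have "ennreal (norm (u x) powr p) = liminf (\<lambda>n. ennreal (norm (u (r n *\<^sub>R x)) powr p))"
      by (rule lim_imp_Liminf[OF sequentially_bot, symmetric])
    also have "\<dots> \<le> L \<xi>"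
      unfolding L_def
      by (intro Liminf_mono always_eventually allI ennreal_leI powr_mono2) (use p bound[OF \<xi> x] in auto)
    finally show "ennreal (norm (u x) powr p) \<le> L \<xi>" .
  qed (use p in simp)
  have "(\<integral>\<^sup>+ \<xi>. L \<xi> \<partial>sphere_measure) \<le> liminf (\<lambda>n. \<integral>\<^sup>+ \<xi>. ennreal ((m n \<xi> + 3 * e n) powr p) \<partial>sphere_measure)"
    unfolding L_def by (rule nn_integral_liminf) measurable
  also have "\<dots> \<le> ennreal (2 powr p) * (ennreal C * (1 + K) + ennreal (3 powr p) * emeasure sphere_measure UNIV)"
  proof (rule Liminf_le)
    have "(\<integral>\<^sup>+ \<xi>. ennreal ((m n \<xi> + 3 * e n) powr p) \<partial>sphere_measure)
       \<le> ennreal (2 powr p) * (ennreal C * (1 + K) + ennreal (3 powr p) * emeasure sphere_measure UNIV)" for n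
    proof -
      have "(\<integral>\<^sup>+ \<xi>. ennreal ((m n \<xi> + 3 * e n) powr p) \<partial>sphere_measure)
         \<le> (\<integral>\<^sup>+ \<xi>. ennreal (2 powr p) * (ennreal (m n \<xi> powr p) + ennreal (3 powr p)) \<partial>sphere_measure)"
      proof (rule nn_integral_mono)
        fix \<xi>
        have "(m n \<xi> + 3 * e n) powr p \<le> (m n \<xi> + 3) powr p"
          using m0[of n \<xi>] e[of n] p by (intro powr_mono2) auto
        also have "\<dots> \<le> 2 powr p * (m n \<xi> powr p + 3 powr p)"
          using m0[of n \<xi>] p by (intro powr_add_le) auto
        finally have "ennreal ((m n \<xi> + 3 * e n) powr p) \<le> ennreal (2 powr p * (m n \<xi> powr p + 3 powr p))"
          by (rule ennreal_leI)
        then show "ennreal ((m n \<xi> + 3 * e n) powr p) \<le> ennreal (2 powr p) * (ennreal (m n \<xi> powr p) + ennreal (3 powr p))"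
          by (simp add: ennreal_mult)
      qed
      also have "\<dots> = ennreal (2 powr p) * ((\<integral>\<^sup>+ \<xi>. ennreal (m n \<xi> powr p) \<partial>sphere_measure) + ennreal (3 powr p) * emeasure sphere_measure UNIV)"
        by (simp add: nn_integral_cmult nn_integral_add)
      also have "\<dots> \<le> ennreal (2 powr p) * (ennreal C * (1 + K) + ennreal (3 powr p) * emeasure sphere_measure UNIV)"
        by (intro mult_left_mono add_right_mono int) auto
      finally show ?thesis .
    qed
    then show "\<forall>\<^sub>F n in sequentially. (\<integral>\<^sup>+ \<xi>. ennreal ((m n \<xi> + 3 * e n) powr p) \<partial>sphere_measure)
       \<le> ennreal (2 powr p) * (ennreal C * (1 + K) + ennreal (3 powr p) * emeasure sphere_measure UNIV)" by simp
  qed simp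
  also have "\<dots> < \<infinity>"
    using fin by (auto simp: K_def ennreal_mult_less_top sphere.emeasure_eq_measure)
  finally have L_fin: "(\<integral>\<^sup>+ \<xi>. L \<xi> \<partial>sphere_measure) < \<infinity>" .
  have "sphere_nn_integral (\<lambda>\<xi>. ennpow (ntmax u \<xi>) p) \<le> sphere_nn_integral L"
    unfolding sphere_nn_integral_def
  proof (intro mult_left_mono nn_integral_mono_AE)
    \<comment> \<open>The bound \<open>le\<close> is for unit vectors, so the origin, a null set, is
      excluded.\<close>
    show "AE x in lborel. indicator unit_ball x * ennpow (ntmax u (x /\<^sub>R norm x)) p \<le> indicator unit_ball x * L (x /\<^sub>R norm x)"
      using AE_lborel_singleton[of "0::R3"]
      by eventually_elim (intro mult_left_mono le, auto)
  qed simp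
  also have "\<dots> < \<infinity>" using L_fin nn_integral_sphere_measure[OF Lm] by simp
  finally show "u \<in> Hp_e \<mu> lam p" using u by (simp add: Hp_e_def)
qed

theorem mainTheorem5:
  fixes \<mu> lam p :: real
  assumes "\<mu> > 0" and "2 * \<mu> + lam > 0" and "1 < p"
  shows "hp_e \<mu> lam p = Hp_e \<mu> lam p"
  using hp_e_subset_Hp_e[OF assms] Hp_e_subset_hp_e[OF assms(3)] by (rule equalityI)

end
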